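(* Let $f\colon X\to X$ be an invertible transformation preserving an ergodic Borel probability measure $\mu$, and let $\mathcal A$ be a cocycle over $f$ with generator $A\colon X\to\mathbb{R}^{d\times d}$ satisfying $\int_X\log^+\lVert A(x)\rVert\,d\mu(x)<+\infty$, all of whose Lyapunov exponents are nonzero. Then there exists a Borel set $\Lambda\subset X$ of full $\mu$-measure such that for each $x\in\Lambda$ the sequence $(A_n)_{n\in\mathbb Z}$ defined by $A_n=A(f^n(x))$, $n\in\mathbb Z$, admits a nonuniform exponential dichotomy.
   Context: $X$ carries its Borel $\sigma$-algebra; $f$ is bijective and measurable with measurable inverse. The cocycle over $f$ with measurable generator $A$ is $\mathcal A(x,n)=A(f^{n-1}(x))\cdots A(f(x))A(x)$ for $n\ge1$, $\mathcal A(x,0)=\mathrm{Id}$. The norm on $\mathbb{R}^d$ is Euclidean and matrices carry the operator norm. Lyapunov exponents: by the (known) semi-invertible multiplicative ergodic theorem, whenever $f\colon X\to X$ is bijective and measurable with measurable inverse and preserves an ergodic Borel probability measure $\mu$, and $A\colon X\to\mathbb{R}^{d\times d}$ is measurable with $\int_X\log^+\lVert A(x)\rVert\,d\mu(x)<+\infty$, there exist numbers $-\infty\le\lambda_1<\dots<\lambda_k$ (Lyapunov exponents; the value $-\infty$ is allowed) and, for $\mu$-a.e. $x$, a unique measurable decomposition $\mathbb{R}^d=E_1(x)\oplus\dots\oplus E_k(x)$ such that $A(x)E_i(x)\subset E_i(f(x))$, with equality if $\lambda_i>-\infty$, and $\lim_{n\to\infty}\frac1n\log\lVert\mathcal A(x,n)v\rVert=\lambda_i$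 for every $v\in E_i(x)\setminus\{0\}$ and every $i$ (with $\log 0=-\infty$). Nonuniform exponential dichotomy: for a sequence $(A_n)_{n\in\mathbb Z}$ of linear operators on $\mathbb{R}^d$, put $\mathcal A(m,n)=A_{m-1}\cdots A_n$ for $m>n$ and $\mathcal A(n,n)=\mathrm{Id}$. The sequence admits a nonuniform exponential dichotomy if: (i) there exist projections $P_n\colon\mathbb{R}^d\to\mathbb{R}^d$, $n\in\mathbb Z$, with $A_nP_n=P_{n+1}A_n$ for $n\in\mathbb Z$, such that each map $A_n|\ker P_n\colon\ker P_n\to\ker P_{n+1}$ is invertible; (ii) there exist constants $D,\lambda>0$ and $\epsilon\ge0$ such that $\lVert\mathcal A(m,n)P_n\rVert\le De^{-\lambda(m-n)+\epsilon|n|}$ for $m\ge n$ and $\lVert\mathcal A(m,n)Q_n\rVert\le De^{-\lambda(n-m)+\epsilon|n|}$ for $m\le n$, where $Q_n=\mathrm{Id}-P_n$ and, for $m<n$, $\mathcal A(m,n)=(\mathcal A(n,m)|\ker P_m)^{-1}\colon\ker P_n\to\ker P_m$. *)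

theory Defs
  imports "HOL-Probability.Probability"
begin

definition ergodic_automorphism :: "'x measure \<Rightarrow> ('x \<Rightarrow> 'x) \<Rightarrow> bool" where
  "ergodic_automorphism M f \<longleftrightarrow>
     prob_space M \<and>
     bij_betw f (space M) (space M) \<and>
     f \<in> M \<rightarrow>\<^sub>M M \<and>
     inv_into (space M) f \<in> M \<rightarrow>\<^sub>M M \<and>
     distr M M f = M \<and>
     (\<forall>B\<in>sets M. f -` B \<inter> space M = B \<longrightarrow> measure M B = 0 \<or> measure M B = 1)"

definition int_iterate :: "('x \<Rightarrow> 'x) \<Rightarrow> int \<Rightarrow> 'x \<Rightarrow> 'x" where
  "int_iterate f n = (if n \<ge> 0 then f ^^ nat n else inv f ^^ nat (- n))"

primrec cocycle ::
  "('x \<Rightarrow> 'x) \<Rightarrow> ('x \<Rightarrow> real^'d^'d) \<Rightarrow> 'x \<Rightarrow> nat \<Rightarrow> real^'d^'d" where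
  "cocycle f A x 0 = mat 1"
| "cocycle f A x (Suc n) = A ((f ^^ n) x) ** cocycle f A x n"

(* The norm of the type real^'d^'d is not the operator norm, hence onorm. *)
definition op_norm :: "real^'d^'d \<Rightarrow> real" where
  "op_norm B = onorm (\<lambda>v. B *v v)"

definition log_plus :: "real \<Rightarrow> real" where
  "log_plus r = ln (max 1 r)"

(* The logarithm on [0, \<infinity>) with log 0 = -\<infinity>; the function ln satisfies ln 0 = 0. *)
definition elog :: "real \<Rightarrow> ereal" where
  "elog r = (if r \<le> 0 then - \<infinity> else ereal (ln r))"

definition direct_sum_decomposition :: "'i set \<Rightarrow> ('i \<Rightarrow> 'v::real_vector set) \<Rightarrow> bool" where
  "direct_sum_decomposition I E \<longleftrightarrow>
     (\<forall>i\<in>I. subspace (E i)) \<and> (\<forall>v. \<exists>!w. w \<in> Pi\<^sub>E I E \<and> v = (\<Sum>i\<in>I. w i))"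

(* Effros measurability of a set-valued map; for maps into the subspaces of a fixed
   dimension it is Borel measurability with respect to the Grassmannian. *)
definition measurable_multifunction :: "'x measure \<Rightarrow> ('x \<Rightarrow> 'v::topological_space set) \<Rightarrow> bool" where
  "measurable_multifunction M F \<longleftrightarrow>
     (\<forall>U. open U \<longrightarrow> {x \<in> space M. F x \<inter> U \<noteq> {}} \<in> sets M)"

(* The values of E i on a null set are irrelevant, so E i is taken to be a total function. *)
definition oseledets_splitting ::
  "'x measure \<Rightarrow> ('x \<Rightarrow> 'x) \<Rightarrow> ('x \<Rightarrow> real^'d^'d) \<Rightarrow> nat \<Rightarrow> (nat \<Rightarrow> ereal)
     \<Rightarrow> (nat \<Rightarrow> 'x \<Rightarrow> (real^'d) set) \<Rightarrow> bool" where
  "oseledets_splitting M f A k lam E \<longleftrightarrow>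
     (\<forall>i\<in>{1..k}. measurable_multifunction M (E i)) \<and>
     (AE x in M.
        direct_sum_decomposition {1..k} (\<lambda>i. E i x) \<and>
        (\<forall>i\<in>{1..k}.
           E i x \<noteq> {0} \<and>
           (\<lambda>v. A x *v v) ` E i x \<subseteq> E i (f x) \<and>
           (lam i > - \<infinity> \<longrightarrow> (\<lambda>v. A x *v v) ` E i x = E i (f x)) \<and>
           (\<forall>v\<in>E i x - {0}.
              (\<lambda>n. ereal (1 / real n) * elog (norm (cocycle f A x n *v v))) \<longlonglongrightarrow> lam i)))"

definition lyapunov_exponents ::
  "'x measure \<Rightarrow> ('x \<Rightarrow> 'x) \<Rightarrow> ('x \<Rightarrow> real^'d^'d) \<Rightarrow> nat \<Rightarrow> (nat \<Rightarrow> ereal) \<Rightarrow> bool" where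
  "lyapunov_exponents M f A k lam \<longleftrightarrow>
     strict_mono_on {1..k} lam \<and>
     (\<forall>i\<in>{1..k}. lam i < \<infinity>) \<and>
     (\<exists>E. oseledets_splitting M f A k lam E)"

definition kernel :: "('v \<Rightarrow> 'v::zero) \<Rightarrow> 'v set" where
  "kernel T = {v. T v = 0}"

primrec forward_evolution ::
  "(int \<Rightarrow> 'v \<Rightarrow> 'v) \<Rightarrow> int \<Rightarrow> nat \<Rightarrow> 'v \<Rightarrow> 'v" where
  "forward_evolution L n 0 = id"
| "forward_evolution L n (Suc j) = L (n + int j) \<circ> forward_evolution L n j"

(* For m < n the value is the inverse of the evolution from time m to time n, restricted
   to kernel (P m); it is meaningful only on kernel (P n). *)
definition evolution ::
  "(int \<Rightarrow> 'v \<Rightarrow> 'v::zero) \<Rightarrow> (int \<Rightarrow> 'v \<Rightarrow> 'v) \<Rightarrow> int \<Rightarrow> int \<Rightarrow> 'v \<Rightarrow> 'v" where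
  "evolution L P m n =
     (if m \<ge> n then forward_evolution L n (nat (m - n))
      else inv_into (kernel (P m)) (forward_evolution L m (nat (n - m))))"

definition nonuniform_exponential_dichotomy ::
  "(int \<Rightarrow> 'v::euclidean_space \<Rightarrow> 'v) \<Rightarrow> bool" where
  "nonuniform_exponential_dichotomy L \<longleftrightarrow>
     (\<forall>n. linear (L n)) \<and>
     (\<exists>P. (\<forall>n. linear (P n) \<and> P n \<circ> P n = P n) \<and>
          (\<forall>n. L n \<circ> P n = P (n + 1) \<circ> L n) \<and>
          (\<forall>n. bij_betw (L n) (kernel (P n)) (kernel (P (n + 1)))) \<and>
          (\<exists>D lam eps. D > 0 \<and> lam > 0 \<and> eps \<ge> 0 \<and>
             (\<forall>m n. m \<ge> n \<longrightarrow>
                onorm (evolution L P m n \<circ> P n)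
                  \<le> D * exp (- lam * real_of_int (m - n) + eps * real_of_int \<bar>n\<bar>)) \<and>
             (\<forall>m n. m \<le> n \<longrightarrow>
                onorm (evolution L P m n \<circ> (\<lambda>v. v - P n v))
                  \<le> D * exp (- lam * real_of_int (n - m) + eps * real_of_int \<bar>n\<bar>))))"

end

theory Submission
  imports Defs "HOL-Real_Asymp.Real_Asymp"
begin

text \<open>
  Let \<open>E\<^sup>s\<close> and \<open>E\<^sup>u\<close> be the sums of the Oseledets spaces with negative and with positive exponents.
  The splitting only provides the forward growth of individual vectors, whereas the dichotomy asks
  for uniform bounds along the whole orbit, including inverses on \<open>E\<^sup>u\<close>. The only ergodic theorem
  needed is the maximal inequality.

  First, the contraction of \<open>A\<close> on \<open>E\<^sup>u\<close> is log-integrable. Otherwise the volumes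
  of some dimension \<open>p + 1\<close> in \<open>E\<^sup>u\<close> collapse faster than any exponential, while those of dimension
  \<open>p\<close> do not; the resulting gap between singular values forces the nearly contracted directions to
  converge to a vector of \<open>E\<^sup>u\<close> that does not grow, a contradiction. Second, by compactness every
  unit vector of \<open>E\<^sup>u\<close> is expanded at the right rate at some time bounded by \<open>L\<close>, outside a set of
  small measure. Jumping along such times, and paying the integrable contraction on the exceptional
  set, yields backward contraction on \<open>E\<^sup>u\<close> at almost every point.

  Finally, the best constant \<open>K\<close> in the resulting bounds at a point, which includes the angle between
  the two spaces, satisfies \<open>K x \<le> C * exp (log\<^sup>+ \<parallel>A x\<parallel>) * K (f x)\<close>. This one-sided inequality,
  together with recurrence to \<open>{K \<le> c}\<close>, shows that \<open>K\<close> grows at most exponentially along the orbit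
  in both directions, which is what a nonuniform dichotomy allows.
\<close>

section \<open>Maximal ergodic inequality\<close>

text \<open>The generator may be singular, so neither integrability of the backward motion on
  \<open>Eu\<close> nor subexponential decay of the angle is available at the outset. Volumes enter
  because the worst contraction of single vectors does not add up along an orbit, while the
  logarithm of the volume of a family spanning \<open>Eu\<close> telescopes: the total contraction
  is bounded by the volume lost plus a multiple of the sum of \<open>h\<close>. Volumes of dimension
  0 are constantly 1, so if the top dimension collapsed there would be a least collapsing dimension,
  and \<open>p\<close> is its predecessor. The collapse must be known at all late times, while the
  failure of a uniform lower bound gives only one time for each rate; a zero-infinity law bridges
  this. Limits of averages never matter: each estimate is an upper bound linear in \<open>n\<close>,
  and a small slope comes from a set on which an integrable weight has small integral. The
  inequality for the best constant bounds the past by the present but not the future by the present,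
  which is why the future is reached through a later return.\<close>

definition birkhoff_sum :: "('x \<Rightarrow> 'x) \<Rightarrow> ('x \<Rightarrow> real) \<Rightarrow> nat \<Rightarrow> 'x \<Rightarrow> real" where
  "birkhoff_sum T g n x = (\<Sum>k<n. g ((T ^^ k) x))"

lemma birkhoff_sum_Suc: "birkhoff_sum T g (Suc n) x = g x + birkhoff_sum T g n (T x)"
  unfolding birkhoff_sum_def by (subst sum.lessThan_Suc_shift) (simp add: funpow_swap1)

lemma birkhoff_sum_add:
  "birkhoff_sum T g (m + n) x = birkhoff_sum T g m x + birkhoff_sum T g n ((T ^^ m) x)"
  by (induction n) (simp_all add: birkhoff_sum_def funpow_add add.commute[of m])

lemma birkhoff_sum_mono:
  "(\<And>y. g y \<le> g' y) \<Longrightarrow> birkhoff_sum T g n x \<le> birkhoff_sum T g' n x"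
  unfolding birkhoff_sum_def by (rule sum_mono) simp

text \<open>It is instantiated for \<open>f\<close> and for its inverse, since the unstable
  estimates sum over the past orbit. Ergodicity enters as an explicit premise of
  \<open>integrable_of_linear_birkhoff_sum\<close>.\<close>

locale measure_preserving = prob_space M for M :: "'x measure" +
  fixes T :: "'x \<Rightarrow> 'x"
  assumes T_measurable [measurable]: "T \<in> M \<rightarrow>\<^sub>M M"
    and distr_T: "distr M M T = M"
begin

lemma funpow_measurable [measurable]: "T ^^ k \<in> M \<rightarrow>\<^sub>M M"
  by (induction k) (auto simp: id_def)

lemma birkhoff_sum_measurable [measurable]:
  "g \<in> borel_measurable M \<Longrightarrow> birkhoff_sum T g n \<in> borel_measurable M"
  unfolding birkhoff_sum_def[abs_def]
  by (intro borel_measurable_sum measurable_compose[OF funpow_measurable])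

lemma integrable_comp: "integrable M (g :: 'x \<Rightarrow> real) \<Longrightarrow> integrable M (\<lambda>x. g (T x))"
  by (metis T_measurable distr_T integrable_distr)

lemma integral_comp:
  assumes "integrable M (g :: 'x \<Rightarrow> real)" shows "(\<integral>x. g (T x) \<partial>M) = (\<integral>x. g x \<partial>M)"
  using integral_distr[of T M M g] assms by (simp add: distr_T)

lemma integrable_comp_funpow:
  "integrable M (g :: 'x \<Rightarrow> real) \<Longrightarrow> integrable M (\<lambda>x. g ((T ^^ k) x))"
  by (induction k arbitrary: g) (auto simp: funpow_swap1 dest: integrable_comp)

lemma integral_comp_funpow:
  "integrable M (g :: 'x \<Rightarrow> real) \<Longrightarrow> (\<integral>x. g ((T ^^ k) x) \<partial>M) = (\<integral>x. g x \<partial>M)"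
proof (induction k)
  case (Suc k)
  then show ?case
    using integral_comp[of "\<lambda>x. g ((T ^^ k) x)"] integrable_comp_funpow[of g k]
    by (simp add: funpow_swap1)
qed simp

lemma integrable_birkhoff_sum: "integrable M g \<Longrightarrow> integrable M (birkhoff_sum T g n)"
  unfolding birkhoff_sum_def[abs_def] by (intro Bochner_Integration.integrable_sum integrable_comp_funpow)

lemma integral_birkhoff_sum:
  "integrable M g \<Longrightarrow> (\<integral>x. birkhoff_sum T g n x \<partial>M) = n * (\<integral>x. g x \<partial>M)"
  unfolding birkhoff_sum_def
  by (subst Bochner_Integration.integral_sum) (auto intro: integrable_comp_funpow simp: integral_comp_funpow)

text \<open>Garsia's argument uses the running maximum of the partial sums in this recursive form.\<close>

primrec max_birkhoff_sum :: "('x \<Rightarrow> real) \<Rightarrow> nat \<Rightarrow> 'x \<Rightarrow> real" where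
  "max_birkhoff_sum g 0 x = 0"
| "max_birkhoff_sum g (Suc n) x = max 0 (g x + max_birkhoff_sum g n (T x))"

lemma max_birkhoff_sum_nonneg: "0 \<le> max_birkhoff_sum g n x"
  by (cases n) auto

lemma birkhoff_sum_le_max: "birkhoff_sum T g n x \<le> max_birkhoff_sum g n x"
proof (induction n arbitrary: x)
  case (Suc n)
  show ?case using Suc[of "T x"] by (simp add: birkhoff_sum_Suc)
qed (simp add: birkhoff_sum_def)

lemma max_birkhoff_sum_mono: "max_birkhoff_sum g n x \<le> max_birkhoff_sum g (Suc n) x"
proof (induction n arbitrary: x)
  case (Suc n)
  show ?case using Suc[of "T x"] by auto
qed auto

lemma integrable_max_birkhoff_sum:
  assumes "integrable M g" shows "integrable M (max_birkhoff_sum g n)"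
proof (induction n)
  case 0
  have "max_birkhoff_sum g 0 = (\<lambda>x. 0)" by auto
  then show ?case by simp
next
  case (Suc n)
  have eq: "max_birkhoff_sum g (Suc n) = (\<lambda>x. max 0 (g x + max_birkhoff_sum g n (T x)))" by auto
  show ?case unfolding eq
    by (intro Bochner_Integration.integrable_max Bochner_Integration.integrable_add assms
        integrable_comp[OF Suc.IH]) auto
qed

text \<open>The running maximum and its composition with \<open>T\<close> have equal integrals, so a
  pointwise bound on their difference suffices.\<close>

lemma maximal_ergodic:
  assumes g: "integrable M g"
  shows "0 \<le> (\<integral>x. g x * indicator {x \<in> space M. 0 < max_birkhoff_sum g (Suc n) x} x \<partial>M)"
proof -
  let ?m = "max_birkhoff_sum g (Suc n)"
  have m: "integrable M ?m" by (rule integrable_max_birkhoff_sum[OF g])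
  have mm[measurable]: "?m \<in> borel_measurable M" using m by auto
  have "0 = (\<integral>x. ?m x \<partial>M) - (\<integral>x. ?m (T x) \<partial>M)" using integral_comp[OF m] by simp
  also have "\<dots> = (\<integral>x. ?m x - ?m (T x) \<partial>M)"
    by (rule Bochner_Integration.integral_diff[symmetric, OF m integrable_comp[OF m]])
  also have "\<dots> \<le> (\<integral>x. g x * indicator {x \<in> space M. 0 < ?m x} x \<partial>M)"
  proof (rule integral_mono)
    show "integrable M (\<lambda>x. ?m x - ?m (T x))"
      by (rule Bochner_Integration.integrable_diff[OF m integrable_comp[OF m]])
    have "{x \<in> space M. 0 < ?m x} \<in> sets M" by measurable
    then show "integrable M (\<lambda>x. g x * indicator {x \<in> space M. 0 < ?m x} x)"
      using g by (rule integrable_real_mult_indicator)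
    fix x assume x: "x \<in> space M"
    \<comment> \<open>Where \<open>?m x\<close> is positive it equals \<open>g x\<close> plus the
      maximum of order \<open>n\<close> at \<open>T x\<close>, which is at most
      \<open>?m (T x)\<close>; elsewhere it is 0 while \<open>?m (T x)\<close> is
      nonnegative.\<close>
    show "?m x - ?m (T x) \<le> g x * indicator {x \<in> space M. 0 < ?m x} x"
      using x max_birkhoff_sum_nonneg[of g "Suc n" "T x"] max_birkhoff_sum_mono[of g n "T x"]
      by (auto simp: indicator_def max_def)
  qed
  finally show ?thesis .
qed

text \<open>Subtracting \<open>\<eta>\<close> from \<open>w\<close> turns averages above
  \<open>\<eta>\<close> into positive partial sums. The maximal inequality applies to each finite
  order, and the orders exhaust the set.\<close>

lemma weak_type_inequality:
  fixes \<eta> :: real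
  assumes w: "integrable M w" and w0: "\<And>x. 0 \<le> w x" and \<eta>: "\<eta> > 0"
  shows "\<eta> * prob {x \<in> space M. \<exists>n. birkhoff_sum T w n x > \<eta> * real n} \<le> (\<integral>x. w x \<partial>M)"
proof -
  define g where "g x = w x - \<eta>" for x
  have g: "integrable M g" unfolding g_def using w by auto
  have bs: "birkhoff_sum T g n x = birkhoff_sum T w n x - \<eta> * real n" for n x
    by (simp add: birkhoff_sum_def g_def sum_subtractf)
  define U where "U n = {x \<in> space M. 0 < max_birkhoff_sum g (Suc n) x}" for n
  have mm[measurable]: "max_birkhoff_sum g n \<in> borel_measurable M" for n
    using integrable_max_birkhoff_sum[OF g] by auto
  have [measurable]: "w \<in> borel_measurable M" using w by auto
  have U[measurable]: "U n \<in> sets M" for n unfolding U_def by measurable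
  have le: "\<eta> * prob (U n) \<le> (\<integral>x. w x \<partial>M)" for n
  proof -
    have "0 \<le> (\<integral>x. g x * indicator (U n) x \<partial>M)" unfolding U_def by (rule maximal_ergodic[OF g])
    also have "\<dots> = (\<integral>x. w x * indicator (U n) x - \<eta> * indicator (U n) x \<partial>M)"
      by (simp add: g_def algebra_simps)
    also have "\<dots> = (\<integral>x. w x * indicator (U n) x \<partial>M) - \<eta> * prob (U n)"
      by (subst Bochner_Integration.integral_diff)
         (use w in \<open>auto intro!: integrable_real_mult_indicator integrable_real_indicator simp: emeasure_eq_measure\<close>)
    also have "(\<integral>x. w x * indicator (U n) x \<partial>M) \<le> (\<integral>x. w x \<partial>M)"
      by (rule integral_mono[OF integrable_real_mult_indicator w])
         (use w w0 in \<open>auto simp: indicator_def\<close>)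
    finally show ?thesis by simp
  qed
  have inc: "incseq U"
    unfolding incseq_Suc_iff U_def using max_birkhoff_sum_mono[of g] by (auto simp del: max_birkhoff_sum.simps intro: less_le_trans)
  have "(\<lambda>n. prob (U n)) \<longlonglongrightarrow> prob (\<Union>n. U n)"
    by (rule finite_Lim_measure_incseq) (use inc in auto)
  then have "(\<lambda>n. \<eta> * prob (U n)) \<longlonglongrightarrow> \<eta> * prob (\<Union>n. U n)" by (intro tendsto_intros)
  then have lim: "\<eta> * prob (\<Union>n. U n) \<le> (\<integral>x. w x \<partial>M)"
    by (rule LIMSEQ_le_const2) (use le in auto)
  have sub: "{x \<in> space M. \<exists>n. birkhoff_sum T w n x > \<eta> * real n} \<subseteq> (\<Union>n. U n)"
  proof safe
    fix x n assume "x \<in> space M" "\<eta> * real n < birkhoff_sum T w n x"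
    then have "0 < max_birkhoff_sum g n x" using birkhoff_sum_le_max[of g n x] by (simp add: bs)
    then have "0 < max_birkhoff_sum g (Suc n) x" using max_birkhoff_sum_mono[of g n x] by linarith
    then show "x \<in> (\<Union>n. U n)" using \<open>x \<in> space M\<close> unfolding U_def by blast
  qed
  have "prob {x \<in> space M. \<exists>n. birkhoff_sum T w n x > \<eta> * real n} \<le> prob (\<Union>n. U n)"
    by (rule finite_measure_mono[OF sub]) auto
  then have "\<eta> * prob {x \<in> space M. \<exists>n. birkhoff_sum T w n x > \<eta> * real n} \<le> \<eta> * prob (\<Union>n. U n)"
    using \<eta> by simp
  with lim show ?thesis by linarith
qed

text \<open>This takes the place of Birkhoff's theorem: dominated convergence makes the integral of
  \<open>w\<close> over \<open>B L\<close> tend to 0, so by the weak type inequality the points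
  violating the bound for every \<open>L\<close> form a null set.\<close>

lemma AE_small_birkhoff_sum:
  fixes \<eta> :: real
  assumes w: "integrable M w" and w0: "\<And>x. 0 \<le> w x" and \<eta>: "\<eta> > 0"
    and B: "\<And>L::nat. B L \<in> sets M" "decseq B" "AE x in M. x \<notin> (\<Inter>L. B L)"
  shows "AE x in M. \<exists>L. \<forall>n. birkhoff_sum T (\<lambda>y. w y * indicator (B L) y) n x \<le> \<eta> * real n"
proof -
  note B(1)[measurable]
  have [measurable]: "w \<in> borel_measurable M" using w by auto
  define U where "U L = {x \<in> space M. \<exists>n. birkhoff_sum T (\<lambda>y. w y * indicator (B L) y) n x > \<eta> * real n}" for L
  have U[measurable]: "U L \<in> sets M" for L unfolding U_def by measurable
  have le: "\<eta> * prob (U L) \<le> (\<integral>x. w x * indicator (B L) x \<partial>M)" for L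
    unfolding U_def by (rule weak_type_inequality)
      (use w w0 \<eta> in \<open>auto intro!: integrable_real_mult_indicator\<close>)
  have "(\<lambda>L. \<integral>x. w x * indicator (B L) x \<partial>M) \<longlonglongrightarrow> (\<integral>x. 0 \<partial>M)"
  proof (rule integral_dominated_convergence[where w=w])
    show "AE x in M. (\<lambda>L. w x * indicator (B L) x) \<longlonglongrightarrow> 0"
      using B(3)
    proof eventually_elim
      case (elim x)
      then obtain L0 where "x \<notin> B L0" by auto
      then have "\<forall>L\<ge>L0. x \<notin> B L" using B(2) unfolding decseq_def by blast
      then have "\<forall>\<^sub>F L in sequentially. w x * indicator (B L) x = 0"
        unfolding eventually_sequentially by (auto simp: indicator_def)
      then show ?case by (rule tendsto_eventually)
    qed
  qed (use w w0 in \<open>auto simp: indicator_def\<close>)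
  then have lim: "(\<lambda>L. \<integral>x. w x * indicator (B L) x \<partial>M) \<longlonglongrightarrow> 0" by simp
  have "\<eta> * prob (\<Inter>L. U L) \<le> (\<integral>x. w x * indicator (B L) x \<partial>M)" for L
  proof -
    have "prob (\<Inter>L. U L) \<le> prob (U L)" by (rule finite_measure_mono) auto
    then have "\<eta> * prob (\<Inter>L. U L) \<le> \<eta> * prob (U L)" using \<eta> by simp
    with le[of L] show ?thesis by linarith
  qed
  then have "\<eta> * prob (\<Inter>L. U L) \<le> 0" by (intro LIMSEQ_le_const[OF lim]) auto
  then have "prob (\<Inter>L. U L) = 0" using \<eta> by (simp add: mult_le_0_iff measure_le_0_iff)
  then have "(\<Inter>L. U L) \<in> null_sets M" by (simp add: emeasure_eq_measure null_sets_def)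
  then have "AE x in M. x \<notin> (\<Inter>L. U L)" by (rule AE_not_in)
  with AE_space show ?thesis
    by eventually_elim (auto simp: U_def not_less)
qed

text \<open>Values of \<open>w\<close> up to a level \<open>L\<close> contribute at most
  \<open>L\<close> per step; the terms above a suitable level have small sums by the preceding lemma
  with slope 1.\<close>

lemma AE_linear_birkhoff_sum:
  assumes w: "integrable M w" and w0: "\<And>x. 0 \<le> w x"
  shows "AE x in M. \<exists>C\<ge>0. \<forall>n. birkhoff_sum T w n x \<le> C * real n"
proof -
  have [measurable]: "w \<in> borel_measurable M" using w by auto
  define B where "B L = {x \<in> space M. w x > real L}" for L
  have "AE x in M. \<exists>L. \<forall>n. birkhoff_sum T (\<lambda>y. w y * indicator (B L) y) n x \<le> 1 * real n"
  proof (rule AE_small_birkhoff_sum[OF w w0])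
    show "decseq B" unfolding decseq_def B_def by force
    have "x \<notin> (\<Inter>L. B L)" for x
      using reals_Archimedean2[of "w x"] unfolding B_def by (auto simp: not_less intro: less_imp_le)
    then show "AE x in M. x \<notin> (\<Inter>L. B L)" by simp
  qed (auto simp: B_def)
  with AE_space show ?thesis
  proof eventually_elim
    case (elim x)
    then obtain L where L: "\<And>n. birkhoff_sum T (\<lambda>y. w y * indicator (B L) y) n x \<le> real n" by auto
    have sp: "(T ^^ k) x \<in> space M" for k
      using measurable_space[OF funpow_measurable elim(1)] .
    have "birkhoff_sum T w n x \<le> (real L + 1) * real n" for n
    proof -
      have "birkhoff_sum T w n x \<le> (\<Sum>k<n. real L + w ((T ^^ k) x) * indicator (B L) ((T ^^ k) x))"
        unfolding birkhoff_sum_def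
        by (rule sum_mono) (use sp w0 in \<open>auto simp: B_def indicator_def not_less\<close>)
      also have "\<dots> = real L * real n + birkhoff_sum T (\<lambda>y. w y * indicator (B L) y) n x"
        by (simp add: birkhoff_sum_def sum.distrib)
      finally show ?thesis using L[of n] by (simp add: algebra_simps)
    qed
    then show ?case by (intro exI[of _ "real L + 1"]) auto
  qed
qed

text \<open>A converse to the ergodic theorem. Ergodicity replaces the pointwise slopes by one slope
  \<open>C\<close>; averaging preserves the integral of the truncation at \<open>j\<close>, which is
  therefore at most \<open>C\<close>, and \<open>j\<close> is sent to infinity.\<close>

lemma integrable_of_linear_birkhoff_sum:
  assumes g[measurable]: "g \<in> borel_measurable M" and g0: "\<And>x. 0 \<le> g x"
    and lin: "AE x in M. \<exists>C. \<forall>n. birkhoff_sum T g n x \<le> C * real n"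
    and ergodic: "\<And>B. B \<in> sets M \<Longrightarrow> T -` B \<inter> space M = B \<Longrightarrow> prob B = 0 \<or> prob B = 1"
  shows "integrable M g"
proof -
  \<comment> \<open>The slack \<open>b\<close> absorbs the term gained or lost by shifting the
    orbit, so \<open>Y C\<close> is invariant exactly, as the ergodicity premise demands. Natural
    numbers keep the unions countable.\<close>
  define Y where "Y C = {x \<in> space M. \<exists>b::nat. \<forall>n. birkhoff_sum T g n x \<le> real C * n + b}" for C :: nat
  have Y[measurable]: "Y C \<in> sets M" for C unfolding Y_def by measurable
  have Y_inv: "T -` Y C \<inter> space M = Y C" for C
  proof (intro equalityI subsetI)
    fix x assume "x \<in> T -` Y C \<inter> space M"
    then have x: "x \<in> space M" "T x \<in> Y C" by auto
    then obtain b :: nat where b: "\<And>n. birkhoff_sum T g n (T x) \<le> real C * n + b" by (auto simp: Y_def)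
    obtain b' :: nat where b': "g x + b \<le> b'" using real_arch_simple by blast
    have "birkhoff_sum T g n x \<le> real C * n + b'" for n
    proof (cases n)
      case 0
      then show ?thesis by (simp add: birkhoff_sum_def)
    next
      case (Suc m)
      then show ?thesis using b[of m] b' by (simp add: birkhoff_sum_Suc algebra_simps)
    qed
    then show "x \<in> Y C" using x unfolding Y_def by blast
  next
    fix x assume x: "x \<in> Y C"
    then have xs: "x \<in> space M" by (auto simp: Y_def)
    from x obtain b :: nat where b: "\<And>n. birkhoff_sum T g n x \<le> real C * n + b" by (auto simp: Y_def)
    have "birkhoff_sum T g n (T x) \<le> real C * n + (b + C)" for n
      using b[of "Suc n"] g0[of x] by (simp add: birkhoff_sum_Suc algebra_simps)
    then show "x \<in> T -` Y C \<inter> space M" using measurable_space[OF T_measurable xs] xs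
      unfolding Y_def by (auto intro!: exI[of _ "b + C"])
  qed
  have "AE x in M. x \<in> (\<Union>C. Y C)"
    using lin AE_space
  proof eventually_elim
    case (elim x)
    then obtain C where C: "\<And>n. birkhoff_sum T g n x \<le> C * real n" by auto
    obtain C' :: nat where "C \<le> C'" using real_arch_simple by blast
    then have "birkhoff_sum T g n x \<le> real C' * n" for n
      using C[of n] mult_right_mono[of C C' n] by simp
    then have "x \<in> Y C'" using elim(2) unfolding Y_def by (auto intro!: exI[of _ "0::nat"])
    then show ?case by blast
  qed
  then have "prob (\<Union>C. Y C) = 1" by (subst prob_eq_1) auto
  then have "\<not> (\<forall>C. Y C \<in> null_sets M)"
    by (metis Y measure_eq_0_null_sets null_sets_UN zero_neq_one)
  then obtain C where "prob (Y C) \<noteq> 0" by (auto simp: null_sets_def emeasure_eq_measure)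
  then have "prob (Y C) = 1" using ergodic[OF Y Y_inv] by blast
  then have AEY: "AE x in M. x \<in> Y C" by (subst (asm) prob_eq_1) auto
  have bound: "(\<integral>x. min (g x) (real j) \<partial>M) \<le> C" for j :: nat
  proof -
    let ?g = "\<lambda>x. min (g x) (real j)"
    have ig: "integrable M ?g"
      by (rule integrable_const_bound[of _ "real j"]) (use g0 in auto)
    \<comment> \<open>Only the positive excess over \<open>C\<close> is passed to the limit: it is
      bounded by \<open>j\<close> and squeezed to 0 by \<open>b / n\<close>, whether or not the
      averages converge.\<close>
    have isum: "integrable M (\<lambda>x. max 0 (birkhoff_sum T ?g n x / n - C))" for n
      using integrable_birkhoff_sum[OF ig, of n] by auto
    have b0: "0 \<le> birkhoff_sum T ?g n x" and bj: "birkhoff_sum T ?g n x \<le> n * j" for n x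
      unfolding birkhoff_sum_def using g0 by (auto intro!: sum_nonneg sum_bounded_above[of "{..<n}", simplified])
    have "(\<lambda>n. \<integral>x. max 0 (birkhoff_sum T ?g n x / n - C) \<partial>M) \<longlonglongrightarrow> (\<integral>x. 0 \<partial>M)"
    proof (rule integral_dominated_convergence[where w="\<lambda>x. real j"])
      show "AE x in M. (\<lambda>n. max 0 (birkhoff_sum T ?g n x / n - C)) \<longlonglongrightarrow> 0"
        using AEY
      proof eventually_elim
        case (elim x)
        then obtain b :: nat where b: "\<And>n. birkhoff_sum T g n x \<le> real C * n + b" by (auto simp: Y_def)
        have le: "birkhoff_sum T ?g n x \<le> real C * n + b" for n
          using b[of n] birkhoff_sum_mono[of ?g g T n x] by auto
        show ?case
        proof (rule real_tendsto_sandwich[where f="\<lambda>n. 0" and h="\<lambda>n. real b / real n"])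
          show "\<forall>\<^sub>F n in sequentially. max 0 (birkhoff_sum T ?g n x / n - C) \<le> real b / real n"
            using eventually_gt_at_top[of 0]
          proof eventually_elim
            case (elim n)
            have "birkhoff_sum T ?g n x / n \<le> (real C * n + b) / n"
              by (rule divide_right_mono[OF le]) simp
            also have "\<dots> = C + real b / n" using elim by (simp add: field_simps)
            finally show ?case by simp
          qed
          show "(\<lambda>n. real b / real n) \<longlonglongrightarrow> 0" by real_asymp
        qed auto
      qed
      show "AE x in M. norm (max 0 (birkhoff_sum T ?g n x / n - C)) \<le> real j" for n
      proof (rule AE_I2)
        fix x
        have "birkhoff_sum T ?g n x / n \<le> j"
          using bj[of n x] by (cases "n = 0") (auto simp: field_simps)
        then show "norm (max 0 (birkhoff_sum T ?g n x / n - C)) \<le> real j" by auto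
      qed
    qed (use isum in auto)
    moreover have "(\<integral>x. ?g x \<partial>M) - C \<le> (\<integral>x. max 0 (birkhoff_sum T ?g (Suc n) x / Suc n - C) \<partial>M)" for n
    proof -
      have "(\<integral>x. ?g x \<partial>M) - C = (\<integral>x. birkhoff_sum T ?g (Suc n) x / Suc n - C \<partial>M)"
        using integrable_birkhoff_sum[OF ig, of "Suc n"] integral_birkhoff_sum[OF ig, of "Suc n"]
        by (simp add: prob_space)
      also have "\<dots> \<le> (\<integral>x. max 0 (birkhoff_sum T ?g (Suc n) x / Suc n - C) \<partial>M)"
        by (rule integral_mono[OF _ isum]) (use integrable_birkhoff_sum[OF ig, of "Suc n"] in auto)
      finally show ?thesis .
    qed
    ultimately have "(\<integral>x. ?g x \<partial>M) - C \<le> 0"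
      by (intro LIMSEQ_le_const[OF LIMSEQ_Suc]) auto
    then show ?thesis by simp
  qed
  have "(\<integral>\<^sup>+x. ennreal (g x) \<partial>M) = (SUP j::nat. \<integral>\<^sup>+x. ennreal (min (g x) (real j)) \<partial>M)"
  proof -
    have "ennreal (g x) = (SUP j::nat. ennreal (min (g x) (real j)))" for x
    proof (rule antisym)
      obtain j :: nat where "g x \<le> j" using real_arch_simple by blast
      then have "ennreal (g x) = ennreal (min (g x) (real j))" by simp
      then show "ennreal (g x) \<le> (SUP j::nat. ennreal (min (g x) (real j)))"
        by (metis SUP_upper UNIV_I)
    qed (auto intro!: SUP_least ennreal_leI)
    then show ?thesis
      by (subst nn_integral_monotone_convergence_SUP[symmetric])
         (auto simp: incseq_def le_fun_def intro!: ennreal_leI)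
  qed
  also have "\<dots> \<le> ennreal C"
  proof (rule SUP_least)
    fix j :: nat
    have "(\<integral>\<^sup>+x. ennreal (min (g x) (real j)) \<partial>M) = ennreal (\<integral>x. min (g x) (real j) \<partial>M)"
      by (rule nn_integral_eq_integral) (use g0 in \<open>auto intro!: integrable_const_bound[of _ "real j"]\<close>)
    then show "(\<integral>\<^sup>+x. ennreal (min (g x) (real j)) \<partial>M) \<le> ennreal C"
      using bound[of j] by (simp add: ennreal_leI)
  qed
  finally have "(\<integral>\<^sup>+x. ennreal (g x) \<partial>M) < \<infinity>" by (rule le_less_trans) auto
  then show ?thesis using g0 by (auto simp: integrable_iff_bounded)
qed

lemma AE_comp_funpow:
  assumes "AE x in M. P x" shows "AE x in M. \<forall>k. P ((T ^^ k) x)"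
proof -
  have comp: "AE x in M. Q (T x)" if "AE x in M. Q x" for Q
    using AE_distrD[OF T_measurable, unfolded distr_T, OF that] .
  have "AE x in M. P ((T ^^ k) x)" for k
  proof (induction k)
    case (Suc k)
    show ?case using comp[OF Suc] by (simp add: funpow_swap1)
  qed (use assms in simp)
  then show ?thesis by (simp add: AE_all_countable)
qed

text \<open>The preimage of \<open>Z\<close> lies in \<open>Z\<close> and has the same measure, so
  the points of \<open>Z\<close> that leave it in one step form a null set.\<close>

lemma AE_backward_invariant:
  assumes Z: "Z \<in> sets M" and inv: "\<And>x. x \<in> space M \<Longrightarrow> T x \<in> Z \<Longrightarrow> x \<in> Z"
  shows "AE x in M. x \<in> Z \<longrightarrow> (\<forall>k. (T ^^ k) x \<in> Z)"
proof -
  have V: "T -` Z \<inter> space M \<in> sets M" using Z by measurable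
  have "emeasure M (T -` Z \<inter> space M) = emeasure M Z"
    using emeasure_distr[OF T_measurable Z] by (simp add: distr_T)
  moreover have "T -` Z \<inter> space M \<subseteq> Z" using inv by auto
  ultimately have "Z - (T -` Z \<inter> space M) \<in> null_sets M"
    using emeasure_Diff[OF _ Z V] Z V by (auto simp: null_sets_def emeasure_eq_measure)
  then have "AE x in M. x \<notin> Z - (T -` Z \<inter> space M)" by (rule AE_not_in)
  with AE_space have "AE x in M. x \<in> Z \<longrightarrow> T x \<in> Z"
    by eventually_elim auto
  from AE_comp_funpow[OF this] show ?thesis
  proof eventually_elim
    case (elim x)
    have "(T ^^ k) x \<in> Z" if "x \<in> Z" for k
      by (induction k) (use elim that in auto)
    then show ?case by blast
  qed
qed

end

section \<open>Volumes of parallelotopes\<close>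

(* reject 0 is the identity, because x / 0 = 0. *)
definition reject :: "'a::real_inner \<Rightarrow> 'a \<Rightarrow> 'a" where
  "reject v u = u - (u \<bullet> v / (v \<bullet> v)) *\<^sub>R v"

lemma linear_reject: "linear (reject v)"
  by (rule linearI) (auto simp: reject_def inner_add_left algebra_simps add_divide_distrib)

lemma reject_self [simp]: "reject v v = 0"
  by (simp add: reject_def)

lemma inner_reject [simp]: "v \<bullet> reject v u = 0" "reject v u \<bullet> v = 0"
  by (auto simp: reject_def inner_diff_right inner_diff_left inner_commute)

text \<open>The factor \<open>norm v\<close> clears the denominator and makes the right side the
  Gram determinant of \<open>u\<close> and \<open>v\<close>, whose symmetry gives
  \<open>norm_reject_commute\<close>.\<close>

lemma norm_reject_sq: "(norm (reject v u) * norm v)\<^sup>2 = (norm u * norm v)\<^sup>2 - (u \<bullet> v)\<^sup>2"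
proof (cases "v = 0")
  case False
  then have "(norm (reject v u))\<^sup>2 = u \<bullet> u - (u \<bullet> v)\<^sup>2 / (v \<bullet> v)"
    unfolding power2_norm_eq_inner reject_def
    by (simp add: inner_diff_left inner_diff_right inner_commute power2_eq_square)
  then show ?thesis using False
    by (simp add: power_mult_distrib power2_norm_eq_inner field_simps)
qed (simp add: reject_def)

lemma norm_reject_commute: "norm (reject v u) * norm v = norm (reject u v) * norm u"
proof -
  have "(norm (reject v u) * norm v)\<^sup>2 = (norm (reject u v) * norm u)\<^sup>2"
    unfolding norm_reject_sq by (simp add: inner_commute mult.commute)
  then show ?thesis by (simp add: power2_eq_iff_nonneg)
qed

lemma norm_reject_le: "norm (reject v u) \<le> norm u"
proof (cases "v = 0")
  case False
  have "(norm (reject v u) * norm v)\<^sup>2 \<le> (norm u * norm v)\<^sup>2"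
    unfolding norm_reject_sq by simp
  then have "norm (reject v u) * norm v \<le> norm u * norm v"
    by (rule power2_le_imp_le) simp
  with False show ?thesis by simp
qed (simp add: reject_def)

lemma infdist_orthogonal:
  fixes S :: "'a::euclidean_space set"
  assumes S: "subspace S" "s \<in> S" "\<And>y. y \<in> S \<Longrightarrow> t \<bullet> y = 0"
  shows "infdist (s + t) S = norm t"
proof (rule antisym)
  show "infdist (s + t) S \<le> norm t"
    using infdist_le[OF S(2), of "s + t"] by (simp add: dist_norm)
  have "norm t \<le> dist (s + t) y" if "y \<in> S" for y
  proof -
    have "t \<bullet> (s - y) = 0" using S that by (intro S(3) subspace_diff) auto
    then have "(norm (t + (s - y)))\<^sup>2 = (norm t)\<^sup>2 + (norm (s - y))\<^sup>2"
      by (intro norm_add_Pythagorean) (simp add: orthogonal_def)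
    then have "(norm t)\<^sup>2 \<le> (norm (t + (s - y)))\<^sup>2" by simp
    then have "norm t \<le> norm (t + (s - y))" by (rule power2_le_imp_le) simp
    then show ?thesis by (simp add: dist_norm algebra_simps)
  qed
  then show "norm t \<le> infdist (s + t) S"
    using S(2) by (subst infdist_notempty) (auto intro!: cINF_greatest)
qed

lemma orthogonal_decomp:
  fixes S :: "'a::euclidean_space set"
  obtains s t where "w = s + t" "s \<in> span S" "\<And>y. y \<in> span S \<Longrightarrow> t \<bullet> y = 0"
  using orthogonal_subspace_decomp_exists[of S w] by (metis orthogonal_def)

text \<open>The component of \<open>reject v w\<close> orthogonal to the rejected span is orthogonal
  to \<open>v\<close> as well, hence to the whole larger span.\<close>

lemma infdist_span_insert:
  fixes S :: "'a::euclidean_space set"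
  shows "infdist w (span (insert v S)) = infdist (reject v w) (span (reject v ` S))"
proof -
  obtain s t where st: "reject v w = s + t" "s \<in> span (reject v ` S)"
    "\<And>y. y \<in> span (reject v ` S) \<Longrightarrow> t \<bullet> y = 0"
    using orthogonal_decomp by metis
  have v: "v \<in> span (insert v S)" by (simp add: span_base)
  have "reject v y \<in> span (insert v S)" if "y \<in> S" for y
    unfolding reject_def using that v by (intro span_diff span_scale) (auto intro: span_base)
  then have "span (reject v ` S) \<subseteq> span (insert v S)"
    by (intro span_minimal) auto
  then have s: "s \<in> span (insert v S)" using st by auto
  have "s \<bullet> v = 0" using st(2)
    by (induction rule: span_induct_alt) (auto simp: inner_add_left)
  then have tv: "t \<bullet> v = 0"
    using st(1) inner_reject(2)[of v w] by (metis add_0 inner_add_left)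
  have t: "t \<bullet> y = 0" if "y \<in> span (insert v S)" for y
    using that
  proof (induction rule: span_induct_alt)
    case (step c x y)
    have "t \<bullet> x = 0"
    proof (cases "x = v")
      case False
      then have "t \<bullet> reject v x = 0" using step st(3) by (auto intro: span_base)
      then show ?thesis using tv by (simp add: reject_def inner_diff_right)
    qed (use tv in simp)
    then show ?case using step by (simp add: inner_add_right)
  qed simp
  have w: "w = ((w \<bullet> v / (v \<bullet> v)) *\<^sub>R v + s) + t" using st(1) by (simp add: reject_def algebra_simps)
  have "infdist w (span (insert v S)) = norm t"
    by (subst w, rule infdist_orthogonal) (use s v t in \<open>auto intro: span_add span_scale\<close>)
  moreover have "infdist (reject v w) (span (reject v ` S)) = norm t"
    unfolding st(1) by (rule infdist_orthogonal) (use st in auto)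
  ultimately show ?thesis by simp
qed

text \<open>Both sides are the area of the parallelogram of \<open>a\<close> and \<open>b\<close>
  modulo \<open>span S\<close>; for the components orthogonal to \<open>span S\<close> this is
  \<open>norm_reject_commute\<close>.\<close>

lemma infdist_span_swap:
  fixes S :: "'a::euclidean_space set"
  shows "infdist a (span (insert b S)) * infdist b (span S) =
         infdist b (span (insert a S)) * infdist a (span S)"
proof -
  have *: "infdist a (span (insert b S)) = norm (reject tb ta)"
    if "a = sa + ta" "sa \<in> span S" "\<And>y. y \<in> span S \<Longrightarrow> ta \<bullet> y = 0"
       "b = sb + tb" "sb \<in> span S" "\<And>y. y \<in> span S \<Longrightarrow> tb \<bullet> y = 0" for a sa ta b sb tb :: 'a
  proof -
    have sub: "span S \<subseteq> span (insert b S)" by (intro span_mono) auto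
    have b: "b \<in> span (insert b S)" by (simp add: span_base)
    have tb: "tb \<in> span (insert b S)"
      using span_diff[OF b, of sb] sub that by auto
    let ?r = "reject tb ta"
    have r: "?r \<bullet> y = 0" if "y \<in> span S" for y
      using \<open>\<And>y. y \<in> span S \<Longrightarrow> ta \<bullet> y = 0\<close> \<open>\<And>y. y \<in> span S \<Longrightarrow> tb \<bullet> y = 0\<close> that
      by (simp add: reject_def inner_diff_left)
    have rb: "?r \<bullet> b = 0" using that r by (simp add: inner_add_right)
    have r': "?r \<bullet> y = 0" if "y \<in> span (insert b S)" for y
      using that
    proof (induction rule: span_induct_alt)
      case (step c x y)
      then show ?case using r[of x] rb by (auto simp: inner_add_right span_base)
    qed simp
    have "a = (sa + (ta \<bullet> tb / (tb \<bullet> tb)) *\<^sub>R tb) + ?r"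
      using that by (simp add: reject_def)
    then show ?thesis
      by (metis (no_types, lifting) infdist_orthogonal r' subspace_span span_add span_scale tb sub subsetD that(2))
  qed
  obtain sa ta where a: "a = sa + ta" "sa \<in> span S" "\<And>y. y \<in> span S \<Longrightarrow> ta \<bullet> y = 0"
    using orthogonal_decomp by metis
  obtain sb tb where b: "b = sb + tb" "sb \<in> span S" "\<And>y. y \<in> span S \<Longrightarrow> tb \<bullet> y = 0"
    using orthogonal_decomp by metis
  have "infdist a (span S) = norm ta" "infdist b (span S) = norm tb"
    using a b by (auto intro!: infdist_orthogonal)
  then show ?thesis
    using *[OF a b] *[OF b a] norm_reject_commute[of tb ta] by simp
qed

lemma infdist_scale_add:
  fixes S :: "'a::euclidean_space set"
  assumes "s \<in> span S"
  shows "infdist (c *\<^sub>R u + s) (span S) = \<bar>c\<bar> * infdist u (span S)"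
proof -
  obtain s' t where st: "u = s' + t" "s' \<in> span S" "\<And>y. y \<in> span S \<Longrightarrow> t \<bullet> y = 0"
    using orthogonal_decomp by metis
  have "c *\<^sub>R u + s = (c *\<^sub>R s' + s) + c *\<^sub>R t" using st by (simp add: algebra_simps)
  moreover have "infdist ((c *\<^sub>R s' + s) + c *\<^sub>R t) (span S) = norm (c *\<^sub>R t)"
    using st assms by (intro infdist_orthogonal) (auto intro: span_add span_scale)
  moreover have "infdist u (span S) = norm t"
    unfolding st(1) using st by (intro infdist_orthogonal) auto
  ultimately show ?thesis by (metis norm_scaleR)
qed

text \<open>The square root of the Gram determinant of the first \<open>p\<close> vectors, built as
  height times base.\<close>

primrec parvol :: "nat \<Rightarrow> (nat \<Rightarrow> 'a::euclidean_space) \<Rightarrow> real" where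
  "parvol 0 u = 1"
| "parvol (Suc p) u = infdist (u p) (span (u ` {..<p})) * parvol p u"

lemma parvol_nonneg: "0 \<le> parvol p u"
  by (induction p) (auto intro!: mult_nonneg_nonneg infdist_nonneg)

lemma infdist_span_le_norm: "infdist v (span S) \<le> norm v"
  using infdist_le[OF span_zero, of v S] by simp

lemma parvol_le_prod: "parvol p u \<le> (\<Prod>i<p. norm (u i))"
proof (induction p)
  case (Suc p)
  have "infdist (u p) (span (u ` {..<p})) * parvol p u \<le> norm (u p) * (\<Prod>i<p. norm (u i))"
    by (intro mult_mono Suc infdist_span_le_norm) (auto intro: parvol_nonneg)
  then show ?case by (simp add: mult.commute)
qed simp

text \<open>Both sides are the volume of the first \<open>p\<close> vectors together with
  \<open>f\<close>, which is the last edge on the left and the first edge on the right.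
  \<open>infdist_span_swap\<close> moves \<open>f\<close> past one edge at a time.\<close>

lemma parvol_swap:
  "infdist f (span (u ` {..<p})) * parvol p u = norm f * parvol p (\<lambda>i. reject f (u i))"
proof (induction p)
  case 0
  have "infdist f {0} = norm f" using infdist_orthogonal[of "{0}" 0 f] by (simp add: subspace_0)
  then show ?case by simp
next
  case (Suc p)
  have "infdist f (span (u ` {..<Suc p})) * parvol (Suc p) u
      = (infdist f (span (insert (u p) (u ` {..<p}))) * infdist (u p) (span (u ` {..<p}))) * parvol p u"
    by (simp add: lessThan_Suc)
  also have "\<dots> = infdist (u p) (span (insert f (u ` {..<p}))) * (infdist f (span (u ` {..<p})) * parvol p u)"
    by (subst infdist_span_swap) simp
  also have "\<dots> = norm f * parvol (Suc p) (\<lambda>i. reject f (u i))"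
    unfolding Suc infdist_span_insert by (simp add: image_image)
  finally show ?case .
qed

lemma parvol_Suc_reject: "parvol (Suc p) u = norm (u p) * parvol p (\<lambda>i. reject (u p) (u i))"
  using parvol_swap[of "u p" u p] by simp

text \<open>The distance to a span is discontinuous where the spanning vectors become dependent.
  Peeling off the last vector by \<open>parvol_Suc_reject\<close> avoids spans: rejecting along a
  vector is continuous where that vector is nonzero, and at a zero limit the product of the norms
  squeezes the volume to 0.\<close>

lemma tendsto_parvol:
  assumes "\<And>i. ((\<lambda>z. F z i) \<longlongrightarrow> L i) G"
  shows "((\<lambda>z. parvol p (F z)) \<longlongrightarrow> parvol p L) G"
  using assms
proof (induction p arbitrary: F L)
  case (Suc p)
  show ?case
  proof (cases "L p = 0")
    case True
    have "((\<lambda>z. norm (F z p) * (\<Prod>i<p. norm (F z i))) \<longlongrightarrow> norm (L p) * (\<Prod>i<p. norm (L i))) G"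
      by (intro tendsto_intros Suc.prems)
    then have lim: "((\<lambda>z. norm (F z p) * (\<Prod>i<p. norm (F z i))) \<longlongrightarrow> 0) G" using True by simp
    have "((\<lambda>z. parvol (Suc p) (F z)) \<longlongrightarrow> 0) G"
    proof (rule real_tendsto_sandwich[OF _ _ tendsto_const lim])
      show "\<forall>\<^sub>F z in G. parvol (Suc p) (F z) \<le> norm (F z p) * (\<Prod>i<p. norm (F z i))"
        using parvol_le_prod[of "Suc p" "F _"] by (intro always_eventually) (auto simp: mult.commute simp del: parvol.simps)
    qed (auto intro!: always_eventually simp: parvol_nonneg simp del: parvol.simps)
    then show ?thesis using True by (simp add: parvol_Suc_reject del: parvol.simps)
  next
    case False
    have "((\<lambda>z. reject (F z p) (F z i)) \<longlongrightarrow> reject (L p) (L i)) G" for i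
      unfolding reject_def using False by (intro tendsto_intros Suc.prems) simp
    then show ?thesis unfolding parvol_Suc_reject by (intro tendsto_intros Suc)
  qed
qed simp

lemma infdist_linear_image_le:
  fixes T :: "'a::euclidean_space \<Rightarrow> 'b::euclidean_space"
  assumes T: "linear T" and C: "0 \<le> C" "\<And>v. norm (T v) \<le> C * norm v"
  shows "infdist (T w) (span (T ` S)) \<le> C * infdist w (span S)"
proof -
  obtain s where s: "s \<in> span S" "infdist w (span S) = dist w s"
    using infdist_attains_inf[of "span S" w] span_zero[of S] by (auto simp: closed_subspace)
  have "T s \<in> span (T ` S)" using s T by (simp add: linear_span_image)
  then have "infdist (T w) (span (T ` S)) \<le> norm (T (w - s))"
    using infdist_le[of "T s" "span (T ` S)" "T w"] T by (simp add: dist_norm linear_diff)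
  also have "\<dots> \<le> C * infdist w (span S)" using C(2)[of "w - s"] s by (simp add: dist_norm)
  finally show ?thesis .
qed

lemma parvol_linear_image_le:
  fixes T :: "'a::euclidean_space \<Rightarrow> 'b::euclidean_space"
  assumes T: "linear T" and C: "0 \<le> C" "\<And>v. norm (T v) \<le> C * norm v"
  shows "parvol p (\<lambda>i. T (u i)) \<le> C ^ p * parvol p u"
proof (induction p)
  case (Suc p)
  have "infdist (T (u p)) (span (T ` u ` {..<p})) * parvol p (\<lambda>i. T (u i))
      \<le> (C * infdist (u p) (span (u ` {..<p}))) * (C ^ p * parvol p u)"
    by (intro mult_mono infdist_linear_image_le[OF T C] Suc)
       (auto intro: parvol_nonneg mult_nonneg_nonneg C infdist_nonneg)
  then show ?case by (simp add: image_image mult_ac)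
qed simp

text \<open>A linear map that does not collapse the volume of a family much cannot contract any vector of
  its span much: one exchanges a member of the family for that vector.\<close>

lemma parvol_norm_bound:
  fixes T :: "'a::euclidean_space \<Rightarrow> 'b::euclidean_space"
  assumes T: "linear T" and C: "1 \<le> C" "\<And>v. norm (T v) \<le> C * norm v"
    and f: "f \<in> span (u ` {..<p})"
  shows "parvol p (\<lambda>i. T (u i)) * norm f \<le> C ^ p * parvol p u * norm (T f)"
  using f
proof (induction p)
  case (Suc p)
  let ?S = "u ` {..<p}"
  \<comment> \<open>\<open>c\<close> is the coefficient of the last vector. If it is nonzero,
    \<open>f\<close> can replace \<open>u p\<close>, which multiplies the volume by the absolute
    value of \<open>c\<close>.\<close>
  obtain c where "f - c *\<^sub>R u p \<in> span (?S - {u p})"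
    using Suc.prems span_breakdown[of "u p" "u ` {..<Suc p}" f] by (auto simp: lessThan_Suc)
  then obtain s where s: "s \<in> span ?S" "f = c *\<^sub>R u p + s"
    using span_mono[of "?S - {u p}" ?S] by (metis Diff_subset add.commute diff_add_cancel subsetD)
  have Ts: "T s \<in> span (T ` ?S)" using s T by (simp add: linear_span_image)
  have C0: "0 \<le> C" using C by simp
  show ?case
  proof (cases "c = 0")
    case True
    then have IH: "parvol p (\<lambda>i. T (u i)) * norm f \<le> C ^ p * parvol p u * norm (T f)"
      using Suc.IH s by simp
    have "infdist (T (u p)) (span (T ` ?S)) * (parvol p (\<lambda>i. T (u i)) * norm f)
       \<le> (C * infdist (u p) (span ?S)) * (C ^ p * parvol p u * norm (T f))"
      by (rule mult_mono[OF infdist_linear_image_le[OF T C0 C(2)] IH])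
        (auto intro!: mult_nonneg_nonneg C0 infdist_nonneg parvol_nonneg zero_le_power)
    then show ?thesis by (simp add: image_image mult_ac)
  next
    case False
    have Tf: "T f = c *\<^sub>R T (u p) + T s" using s T by (simp add: linear_add linear_scale)
    have "\<bar>c\<bar> * parvol (Suc p) (\<lambda>i. T (u i)) = infdist (T f) (span (T ` ?S)) * parvol p (\<lambda>i. T (u i))"
      unfolding Tf infdist_scale_add[OF Ts] by (simp add: image_image)
    also have "\<dots> = norm (T f) * parvol p (\<lambda>i. reject (T f) (T (u i)))"
      using parvol_swap[of "T f" "\<lambda>i. T (u i)" p] by (simp add: image_image)
    \<comment> \<open>\<open>reject (T f)\<close> annihilates \<open>T f\<close>, so subtracting
      multiples of \<open>f\<close> before applying \<open>T\<close> changes nothing. The composed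
      map obeys the same bound \<open>C\<close> and spends only \<open>p\<close> factors of it,
      since \<open>f\<close> itself contributes \<open>norm (T f)\<close>.\<close>
    also have "(\<lambda>i. reject (T f) (T (u i))) = (\<lambda>i. (reject (T f) \<circ> T) (reject f (u i)))"
    proof
      fix i
      have "T (reject f (u i)) = T (u i) - (u i \<bullet> f / (f \<bullet> f)) *\<^sub>R T f"
        using T by (simp add: reject_def linear_diff linear_scale)
      then show "reject (T f) (T (u i)) = (reject (T f) \<circ> T) (reject f (u i))"
        by (simp add: linear_diff[OF linear_reject] linear_scale[OF linear_reject])
    qed
    also have "norm (T f) * parvol p \<dots> \<le> norm (T f) * (C ^ p * parvol p (\<lambda>i. reject f (u i)))"
    proof (intro mult_left_mono parvol_linear_image_le C0)
      show "linear (reject (T f) \<circ> T)" by (intro linear_compose T linear_reject)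
      show "norm ((reject (T f) \<circ> T) v) \<le> C * norm v" for v
        using norm_reject_le[of "T f" "T v"] C(2)[of v] by simp
    qed auto
    finally have "\<bar>c\<bar> * parvol (Suc p) (\<lambda>i. T (u i))
        \<le> norm (T f) * (C ^ p * parvol p (\<lambda>i. reject f (u i)))" .
    from mult_right_mono[OF this norm_ge_zero[of f]]
    have "\<bar>c\<bar> * parvol (Suc p) (\<lambda>i. T (u i)) * norm f
        \<le> norm (T f) * (C ^ p * (norm f * parvol p (\<lambda>i. reject f (u i))))"
      by (simp only: mult_ac)
    also have "norm f * parvol p (\<lambda>i. reject f (u i)) = \<bar>c\<bar> * parvol (Suc p) u"
      unfolding parvol_swap[symmetric] using infdist_scale_add[OF s(1), of c "u p"] s(2) by simp
    finally have "\<bar>c\<bar> * (parvol (Suc p) (\<lambda>i. T (u i)) * norm f)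
        \<le> \<bar>c\<bar> * (C ^ p * parvol (Suc p) u * norm (T f))" by (simp only: mult_ac)
    then have "parvol (Suc p) (\<lambda>i. T (u i)) * norm f \<le> C ^ p * (parvol (Suc p) u * norm (T f))"
      using False by (simp add: mult_ac)
    also have "\<dots> \<le> C ^ Suc p * (parvol (Suc p) u * norm (T f))"
      by (intro mult_right_mono power_increasing C) (auto intro!: mult_nonneg_nonneg infdist_nonneg parvol_nonneg)
    finally show ?thesis by (simp only: mult_ac)
  qed
qed simp

lemma dim_of_parvol_nonzero: "parvol p u \<noteq> 0 \<Longrightarrow> dim (u ` {..<p}) = p"
proof (induction p)
  case (Suc p)
  then have "infdist (u p) (span (u ` {..<p})) \<noteq> 0" "dim (u ` {..<p}) = p" by auto
  then have "u p \<notin> span (u ` {..<p})" by auto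
  then show ?case using \<open>dim (u ` {..<p}) = p\<close> by (simp add: lessThan_Suc dim_insert)
qed simp


lemma parvol_cong: "(\<And>i. i < p \<Longrightarrow> u i = v i) \<Longrightarrow> parvol p u = parvol p v"
proof (induction p)
  case (Suc p)
  then have "u ` {..<p} = v ` {..<p}" by (auto intro!: image_cong)
  with Suc show ?case by simp
qed simp

text \<open>\<open>F n\<close> plays the role of the span of the large singular directions of
  \<open>T n\<close>. A vector nearly killed at time \<open>n\<close> becomes nearly killed at time
  \<open>n + 1\<close> by subtracting an element of \<open>F (n + 1)\<close>. This correction has a
  tiny image under \<open>T (n + 1)\<close>, which contracts \<open>F (n + 1)\<close> only
  moderately, so the correction itself is tiny and the vectors converge.\<close>

lemma slow_vector:
  fixes T :: "nat \<Rightarrow> 'a::euclidean_space \<Rightarrow> 'a" and F :: "nat \<Rightarrow> 'a set" and c C :: real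
  assumes lin: "\<And>n. linear (T n)" and C0: "0 \<le> C" "0 \<le> c"
    and step: "\<And>n v. norm (T (Suc n) v) \<le> exp (C * Suc n) * norm (T n v)"
    and growth: "\<And>n v. norm (T n v) \<le> exp (C * n) * norm v"
    and E: "subspace E" and N: "1 \<le> N"
    and FE: "F N \<subseteq> E" "dim (F N) < dim E"
    and F: "\<And>n. N \<le> n \<Longrightarrow> subspace (F n) \<and> F n \<subseteq> E"
    and fast: "\<And>n f. N \<le> n \<Longrightarrow> f \<in> F n \<Longrightarrow> norm f \<le> exp (c * n) * norm (T n f)"
    and slow: "\<And>n w. N \<le> n \<Longrightarrow> w \<in> E \<Longrightarrow>
       \<exists>f\<in>F n. norm (T n (w - f)) \<le> exp (- (2 * c + 3 * C + 5) * n) * norm w"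
  shows "\<exists>w\<in>E. w \<noteq> 0 \<and> (\<forall>n\<ge>N. norm (T n w) \<le> 13 * exp (- 5 * real n))"
proof -
  \<comment> \<open>Of the rate, \<open>2 * (c + C)\<close> pays for the size of a correction at
    time \<open>n + 1\<close>, using \<open>n + 1 \<le> 2 * n\<close>, and a further
    \<open>C\<close> for the growth of \<open>T n\<close> on the remaining error. The 5 is the
    surviving decay; it also keeps all corrections together below \<open>10 / 32\<close>, so the
    limit is nonzero.\<close>
  define \<rho> where "\<rho> = 2 * c + 3 * C + 5"
  define e where "e k = exp (- (C + 5) * real (N + k))" for k
  have e_half: "e (k + j) \<le> e k * (1/2) ^ j" for k j
  proof -
    have "exp (- (C + 5)) \<le> exp (- 1 :: real)" using C0 by simp
    also have "\<dots> \<le> 1 / 2" using exp_ge_add_one_self[of "1::real"] by (simp add: exp_minus field_simps)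
    finally have "exp (- (C + 5)) ^ j \<le> (1 / 2) ^ j" by (intro power_mono) auto
    moreover have "e (k + j) = e k * exp (- (C + 5)) ^ j"
      unfolding e_def exp_of_nat_mult[symmetric] exp_add[symmetric] by (simp add: algebra_simps)
    ultimately show ?thesis by (simp add: e_def)
  qed
  have e0: "e 0 \<le> 1 / 32"
  proof -
    have "5 * 1 \<le> (C + 5) * real N" using C0 N by (intro mult_mono) auto
    then have "e 0 \<le> exp (- (5 :: real))" unfolding e_def by (simp add: algebra_simps)
    also have "\<dots> = exp (- 1) ^ 5" by (simp flip: exp_of_nat_mult)
    also have "\<dots> \<le> (1 / 2) ^ 5"
      using exp_ge_add_one_self[of "1::real"] by (intro power_mono) (simp_all add: exp_minus field_simps)
    finally show ?thesis by (simp add: power_divide)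
  qed
  \<comment> \<open>\<open>y\<close> is orthogonal to \<open>F N\<close>, so subtracting
    \<open>f0\<close> cannot shorten it, and the normalised difference is still nearly killed by
    \<open>T N\<close>.\<close>
  obtain y where y: "y \<noteq> 0" "y \<in> E" "\<And>z. z \<in> F N \<Longrightarrow> orthogonal y z"
  proof -
    have "span (F N) \<subset> span E"
      using FE dim_subset[of "span (F N)"] by (metis dim_span less_irrefl psubsetI span_mono)
    then obtain y where "y \<noteq> 0" "y \<in> span E" "\<And>z. z \<in> span (F N) \<Longrightarrow> orthogonal y z"
      using orthogonal_to_subspace_exists_gen by metis
    then show ?thesis using that E by (metis span_base span_eq_iff)
  qed
  obtain f0 where f0: "f0 \<in> F N" "norm (T N (y - f0)) \<le> exp (- \<rho> * N) * norm y"
    using slow[OF order_refl y(2)] unfolding \<rho>_def by auto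
  define w0 where "w0 = (1 / norm (y - f0)) *\<^sub>R (y - f0)"
  have "norm (y - f0) ^ 2 = norm y ^ 2 + norm f0 ^ 2"
    using norm_add_Pythagorean[of y "- f0"] y(3)[OF f0(1)] by (simp add: orthogonal_clauses)
  then have "norm y ^ 2 \<le> norm (y - f0) ^ 2" by simp
  then have ny: "norm y \<le> norm (y - f0)" by (rule power2_le_imp_le) simp
  then have pos: "0 < norm (y - f0)" using y(1) by (metis less_le_trans zero_less_norm_iff)
  have w0: "norm w0 = 1" using pos by (simp add: w0_def)
  have w0E: "w0 \<in> E" unfolding w0_def using E y(2) f0(1) FE(1) by (intro subspace_scale subspace_diff) auto
  have Tw0: "norm (T N w0) \<le> exp (- \<rho> * N)"
  proof -
    have "norm (T N w0) = norm (T N (y - f0)) / norm (y - f0)"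
      by (simp add: w0_def linear_scale[OF lin] del: linear_diff)
    also have "\<dots> \<le> exp (- \<rho> * N) * norm (y - f0) / norm (y - f0)"
      using f0(2) ny by (intro divide_right_mono) (auto intro: order_trans)
    finally show ?thesis using pos by simp
  qed
  define \<phi> where "\<phi> n v = (SOME f. f \<in> F n \<and> norm (T n (v - f)) \<le> exp (- \<rho> * n) * norm v)" for n v
  have \<phi>: "\<phi> n v \<in> F n" "norm (T n (v - \<phi> n v)) \<le> exp (- \<rho> * n) * norm v"
    if "N \<le> n" "v \<in> E" for n v
    using someI_ex[of "\<lambda>f. f \<in> F n \<and> norm (T n (v - f)) \<le> exp (- \<rho> * n) * norm v"] slow[OF that]
    unfolding \<phi>_def \<rho>_def by blast+
  define w where "w = rec_nat w0 (\<lambda>k v. v - \<phi> (N + Suc k) v)"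
  have w_0: "w 0 = w0" and w_Suc: "w (Suc k) = w k - \<phi> (N + Suc k) (w k)" for k
    by (simp_all add: w_def)
  \<comment> \<open>A correction bounds the new image relative to the norm of the old vector; the
    factor 2 in the premise is the price of passing to the norm of the new vector, and it does not
    accumulate.\<close>
  have increment: "norm (w (Suc k) - w k) \<le> 5 * e k \<and> norm (T (N + Suc k) (w (Suc k))) \<le> exp (- \<rho> * (N + Suc k)) * norm (w k)"
    if wE: "w k \<in> E" and wk: "norm (w k) \<le> 3 / 2"
      and Tw: "norm (T (N + k) (w k)) \<le> 2 * exp (- \<rho> * (N + k)) * norm (w k)" for k
  proof
    let ?n = "N + k" and ?f = "\<phi> (N + Suc k) (w k)"
    note f = \<phi>[of "N + Suc k" "w k", OF _ wE, simplified le_add1, OF TrueI]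
    show *: "norm (T (N + Suc k) (w (Suc k))) \<le> exp (- \<rho> * (N + Suc k)) * norm (w k)"
      using f(2) by (simp add: w_Suc)
    have "T (N + Suc k) ?f = T (N + Suc k) (w k) - T (N + Suc k) (w (Suc k))"
      by (simp add: w_Suc linear_diff[OF lin])
    then have "norm (T (N + Suc k) ?f) \<le> norm (T (N + Suc k) (w k)) + norm (T (N + Suc k) (w (Suc k)))"
      by (metis norm_triangle_ineq4)
    also have "\<dots> \<le> exp (C * Suc ?n) * (2 * exp (- \<rho> * ?n) * norm (w k)) + exp (C * Suc ?n) * exp (- \<rho> * ?n) * norm (w k)"
    proof (rule add_mono)
      show "norm (T (N + Suc k) (w k)) \<le> exp (C * Suc ?n) * (2 * exp (- \<rho> * ?n) * norm (w k))"
        using order_trans[OF step[of ?n "w k"] mult_left_mono[OF Tw]] by simp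
      have "0 \<le> C * Suc ?n" "0 \<le> \<rho>" using C0 by (auto simp: \<rho>_def)
      moreover have "- \<rho> * (N + Suc k) = - \<rho> * ?n - \<rho>" by (simp add: algebra_simps)
      ultimately have "- \<rho> * (N + Suc k) \<le> C * Suc ?n + - \<rho> * ?n" by linarith
      then have "exp (- \<rho> * (N + Suc k)) \<le> exp (C * Suc ?n) * exp (- \<rho> * ?n)"
        by (simp only: exp_le_cancel_iff flip: exp_add)
      then show "norm (T (N + Suc k) (w (Suc k))) \<le> exp (C * Suc ?n) * exp (- \<rho> * ?n) * norm (w k)"
        using * by (meson mult_right_mono norm_ge_zero order_trans)
    qed
    also have "\<dots> = 3 * (exp (C * Suc ?n) * exp (- \<rho> * ?n)) * norm (w k)" by simp
    also have "exp (C * Suc ?n) * exp (- \<rho> * ?n) = exp (C * Suc ?n - \<rho> * ?n)"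
      by (simp only: flip: exp_add) simp
    finally have "norm ?f \<le> exp (c * Suc ?n) * (3 * exp (C * Suc ?n - \<rho> * ?n) * norm (w k))"
      using order_trans[OF fast[OF _ f(1)] mult_left_mono] by simp
    also have "\<dots> = 3 * norm (w k) * exp (c * Suc ?n + C * Suc ?n - \<rho> * ?n)"
      by (simp add: exp_diff exp_add)
    also have "\<dots> \<le> 3 * (3/2) * e k"
    proof (intro mult_mono)
      have "(c + C) * Suc ?n \<le> (c + C) * (2 * real ?n)"
        using N C0 by (intro mult_left_mono) auto
      then show "exp (c * Suc ?n + C * Suc ?n - \<rho> * ?n) \<le> e k"
        unfolding e_def \<rho>_def by (simp add: algebra_simps)
    qed (use wk in auto)
    finally have "norm ?f \<le> 3 * (3/2) * e k" .
    moreover have "0 \<le> e k" by (simp add: e_def)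
    ultimately show "norm (w (Suc k) - w k) \<le> 5 * e k" by (simp add: w_Suc)
  qed
  have inv: "w k \<in> E \<and> norm (w k - w0) \<le> (10/32) * (1 - (1/2) ^ k)
      \<and> norm (T (N + k) (w k)) \<le> 2 * exp (- \<rho> * (N + k)) * norm (w k)" for k
  proof (induction k)
    case 0
    have "norm (T N w0) \<le> 2 * exp (- \<rho> * N)" using Tw0 exp_ge_zero[of "- \<rho> * N"] by linarith
    then show ?case using w0 w0E by (simp add: w_0)
  next
    case (Suc k)
    have "(10/32) * (1 - (1/2 :: real) ^ k) \<le> 10/32" by simp
    then have *: "norm (w k - w0) \<le> 10/32" using Suc by linarith
    have wk: "norm (w k) \<le> 3/2" "norm (w k) \<ge> 22/32"
      using * w0 norm_triangle_ineq2[of "w k" w0] norm_triangle_ineq2[of w0 "w k"] by (auto simp: norm_minus_commute)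
    have i1: "norm (w (Suc k) - w k) \<le> 5 * e k"
      and i2: "norm (T (N + Suc k) (w (Suc k))) \<le> exp (- \<rho> * (N + Suc k)) * norm (w k)"
      using increment[of k] Suc wk by auto
    have ek: "e k \<le> 1/32 * (1/2) ^ k"
      using order_trans[OF e_half[of 0 k, unfolded add_0] mult_right_mono[OF e0]] by simp
    have "norm (w (Suc k) - w0) \<le> norm (w (Suc k) - w k) + norm (w k - w0)"
      by (metis norm_triangle_ineq diff_add_cancel add_diff_eq)
    also have "\<dots> \<le> (10/32) * (1 - (1/2) ^ Suc k)"
      using i1 ek Suc by simp
    finally have a: "norm (w (Suc k) - w0) \<le> (10/32) * (1 - (1/2) ^ Suc k)" .
    have "w (Suc k) \<in> E" unfolding w_Suc
      using Suc \<phi>(1)[of "N + Suc k" "w k"] F[of "N + Suc k"] by (intro subspace_diff E) auto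
    moreover have "norm (w k) \<le> 2 * norm (w (Suc k))"
    proof -
      have "5 * e k \<le> 5/32" using ek power_le_one[of "1/2::real" k] by simp
      then have "norm (w (Suc k) - w k) \<le> 5/32" using i1 by linarith
      then show ?thesis using wk norm_triangle_ineq2[of "w k" "w (Suc k)"] by (simp add: norm_minus_commute)
    qed
    then have "norm (T (N + Suc k) (w (Suc k))) \<le> exp (- \<rho> * (N + Suc k)) * (2 * norm (w (Suc k)))"
      using i2 by (meson exp_ge_zero mult_left_mono order_trans)
    ultimately show ?case using a by (simp add: mult_ac)
  qed
  have wk: "norm (w k) \<le> 3/2" for k
  proof -
    have "(10/32) * (1 - (1/2 :: real) ^ k) \<le> 10/32" by simp
    then have "norm (w k - w0) \<le> 10/32" using inv[of k] by linarith
    then show ?thesis using w0 norm_triangle_ineq2[of "w k" w0] by simp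
  qed
  have dist: "norm (w (k + j) - w k) \<le> 10 * e k * (1 - (1/2) ^ j)" for k j
  proof (induction j)
    case (Suc j)
    have "norm (w (Suc (k + j)) - w k) \<le> norm (w (Suc (k + j)) - w (k + j)) + norm (w (k + j) - w k)"
      by (metis norm_triangle_ineq diff_add_cancel add_diff_eq)
    also have "\<dots> \<le> 5 * (e k * (1/2) ^ j) + 10 * e k * (1 - (1/2) ^ j)"
      using increment[of "k + j"] inv[of "k + j"] wk[of "k + j"] e_half[of k j] Suc by auto
    also have "\<dots> = 10 * e k * (1 - (1/2) ^ Suc j)" by (simp add: algebra_simps)
    finally show ?case by simp
  qed simp
  have dist': "norm (w m - w k) \<le> 10 * e k" if "k \<le> m" for k m
  proof -
    have "10 * e k * (1 - (1/2) ^ (m - k)) \<le> 10 * e k * 1" by (intro mult_left_mono) (auto simp: e_def)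
    then show ?thesis using dist[of k "m - k"] that by simp
  qed
  have "Cauchy w"
  proof (rule CauchyI')
    fix \<delta> :: real assume "\<delta> > 0"
    have "(\<lambda>k. (1/2 :: real) ^ k) \<longlonglongrightarrow> 0" by (rule LIMSEQ_realpow_zero) auto
    from order_tendstoD(2)[OF this \<open>\<delta> > 0\<close>]
    obtain M where M: "\<And>k. k \<ge> M \<Longrightarrow> (1/2 :: real) ^ k < \<delta>"
      unfolding eventually_sequentially by auto
    show "\<exists>M. \<forall>m\<ge>M. \<forall>n>m. dist (w m) (w n) < \<delta>"
    proof (intro exI[of _ M] allI impI)
      fix m n assume mn: "M \<le> m" "m < n"
      have "e m \<le> 1/32 * (1/2) ^ m"
        using order_trans[OF e_half[of 0 m, unfolded add_0] mult_right_mono[OF e0]] by simp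
      then have "norm (w n - w m) \<le> (1/2) ^ m"
        using dist'[of m n] mn zero_le_power[of "1/2::real" m] by linarith
      then show "dist (w m) (w n) < \<delta>" using M[of m] mn by (simp add: dist_norm norm_minus_commute)
    qed
  qed
  then obtain W where W: "w \<longlonglongrightarrow> W" using Cauchy_convergent convergent_def by blast
  have WE: "W \<in> E"
    using closed_sequentially[OF closed_subspace[OF E] _ W] inv by auto
  have Wd: "norm (W - w k) \<le> 10 * e k" for k
  proof (rule Lim_norm_ubound)
    show "((\<lambda>m. w m - w k) \<longlongrightarrow> W - w k) sequentially" using W by (intro tendsto_intros)
    show "\<forall>\<^sub>F m in sequentially. norm (w m - w k) \<le> 10 * e k"
      using eventually_ge_at_top[of k] by eventually_elim (rule dist')
  qed simp
  have "norm (W - w0) \<le> 10/32" using Wd[of 0] e0 by (simp add: w_0)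
  then have "W \<noteq> 0" using w0 by auto
  moreover have "norm (T n W) \<le> 13 * exp (- 5 * real n)" if "N \<le> n" for n
  proof -
    obtain k where n: "n = N + k" using \<open>N \<le> n\<close> le_Suc_ex by blast
    have "norm (T n W) = norm (T n (w k) + T n (W - w k))" by (simp add: linear_diff[OF lin])
    also have "\<dots> \<le> norm (T n (w k)) + norm (T n (W - w k))" by (rule norm_triangle_ineq)
    also have "\<dots> \<le> 2 * exp (- \<rho> * n) * norm (w k) + exp (C * n) * (10 * e k)"
    proof (rule add_mono)
      show "norm (T n (w k)) \<le> 2 * exp (- \<rho> * n) * norm (w k)" using inv[of k] unfolding n by blast
      show "norm (T n (W - w k)) \<le> exp (C * n) * (10 * e k)"
        by (rule order_trans[OF growth mult_left_mono[OF Wd]]) simp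
    qed
    \<comment> \<open>The 13 consists of 3 from \<open>w k\<close>, whose norm is at most
      \<open>3 / 2\<close>, and 10 from its distance to the limit, a geometric series of
      corrections.\<close>
    also have "\<dots> \<le> 2 * exp (- 5 * real n) * (3/2) + 10 * exp (- 5 * real n)"
    proof (rule add_mono)
      have "5 * real n \<le> \<rho> * n" unfolding \<rho>_def using C0 by (intro mult_right_mono) auto
      then have "exp (- \<rho> * n) \<le> exp (- 5 * real n)" by simp
      then show "2 * exp (- \<rho> * n) * norm (w k) \<le> 2 * exp (- 5 * real n) * (3/2)"
        using wk by (intro mult_mono) auto
      have "exp (C * n) * e k = exp (- 5 * real n)"
        by (simp add: e_def n algebra_simps flip: exp_add)
      then show "exp (C * n) * (10 * e k) \<le> 10 * exp (- 5 * real n)" by simp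
    qed
    finally show ?thesis by simp
  qed
  ultimately show ?thesis using WE by blast
qed

text \<open>A bound on the norm of the \<open>p\<close>-th exterior power on \<open>E\<close>, on a
  logarithmic scale so that composition adds the parameters. Families are infinite sequences so that
  \<open>measurable_multifunction_sequences\<close> applies to the set of all of them.\<close>

definition parvol_le :: "nat \<Rightarrow> 'a::euclidean_space set \<Rightarrow> ('a \<Rightarrow> 'a) \<Rightarrow> real \<Rightarrow> bool" where
  "parvol_le p E T r \<longleftrightarrow>
     (\<forall>u. range u \<subseteq> E \<longrightarrow> parvol p (\<lambda>i. T (u i)) \<le> exp r * parvol p u)"

text \<open>For each \<open>n\<close> some family of \<open>p\<close> vectors keeps more than the
  fraction \<open>exp (- R0 * n)\<close> of its volume; by \<open>parvol_norm_bound\<close> its span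
  \<open>F n\<close> is contracted only moderately. Adding any \<open>w\<close> as a further edge
  must lose far more volume, and comparing the two volumes bounds the distance of
  \<open>T n w\<close> from the image of \<open>F n\<close>.\<close>

lemma gap_slow_vector:
  fixes T :: "nat \<Rightarrow> 'a::euclidean_space \<Rightarrow> 'a" and C R0 :: real
  assumes lin: "\<And>n. linear (T n)" and C0: "0 \<le> C" and R0: "0 \<le> R0"
    and step: "\<And>n v. norm (T (Suc n) v) \<le> exp (C * Suc n) * norm (T n v)"
    and growth: "\<And>n v. norm (T n v) \<le> exp (C * n) * norm v"
    and E: "subspace E" and p: "p < dim E"
    and fast: "\<And>n. 1 \<le> n \<Longrightarrow> \<not> parvol_le p E (T n) (- R0 * n)"
    and slow: "\<And>R. \<exists>n0. \<forall>n\<ge>n0. parvol_le (Suc p) E (T n) (- R * n)"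
  shows "\<exists>w\<in>E. w \<noteq> 0 \<and> (\<exists>N. \<forall>n\<ge>N. norm (T n w) \<le> 13 * exp (- 5 * real n))"
proof -
  \<comment> \<open>\<open>R0\<close> is the rate of volume loss of the chosen family, and
    \<open>C * p\<close> comes from the \<open>p\<close> factors \<open>exp (C * n)\<close> in
    \<open>parvol_norm_bound\<close>. The additional \<open>R0\<close> in the choice of
    \<open>n0\<close> compensates for dividing by the \<open>p\<close>-dimensional volume.\<close>
  define c where "c = R0 + C * p"
  define \<rho> where "\<rho> = 2 * c + 3 * C + 5"
  obtain n0 where n0: "\<And>n. n0 \<le> n \<Longrightarrow> parvol_le (Suc p) E (T n) (- (\<rho> + R0) * n)"
    using slow by blast
  have "\<exists>u. range u \<subseteq> E \<and> exp (- R0 * n) * parvol p u < parvol p (\<lambda>i. T n (u i))" if "1 \<le> n" for n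
    using fast[OF that] by (auto simp: parvol_le_def not_le)
  then obtain u where u: "\<And>n. 1 \<le> n \<Longrightarrow> range (u n) \<subseteq> E"
    "\<And>n. 1 \<le> n \<Longrightarrow> exp (- R0 * n) * parvol p (u n) < parvol p (\<lambda>i. T n (u n i))"
    by metis
  define F where "F n = span (u n ` {..<p})" for n
  define N where "N = max 1 n0"
  have FE: "F n \<subseteq> E" "dim (F n) < dim E" if "1 \<le> n" for n
  proof -
    have "u n ` {..<p} \<subseteq> E" using u(1)[OF that] by auto
    then show "F n \<subseteq> E" unfolding F_def using E by (rule span_minimal)
    have "dim (F n) \<le> card (u n ` {..<p})" unfolding F_def dim_span by (rule dim_le_card') simp
    also have "\<dots> \<le> p" using card_image_le[of "{..<p}" "u n"] by simp
    finally show "dim (F n) < dim E" using p by simp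
  qed
  have pos: "0 < parvol p (u n)" if "1 \<le> n" for n
  proof -
    have "0 \<le> exp (- R0 * n) * parvol p (u n)" using parvol_nonneg[of p "u n"] by simp
    also have "\<dots> < parvol p (\<lambda>i. T n (u n i))" by (rule u(2)[OF that])
    also have "\<dots> \<le> exp (C * n) ^ p * parvol p (u n)"
      by (rule parvol_linear_image_le[OF lin _ growth]) simp
    finally show ?thesis by (simp add: zero_less_mult_iff)
  qed
  have "\<exists>w\<in>E. w \<noteq> 0 \<and> (\<forall>n\<ge>N. norm (T n w) \<le> 13 * exp (- 5 * real n))"
  proof (rule slow_vector[where C=C and c=c and F=F, OF lin C0 _ step growth E])
    show "0 \<le> c" using R0 C0 by (simp add: c_def)
    show "1 \<le> N" by (simp add: N_def)
    then show "F N \<subseteq> E" "dim (F N) < dim E" using FE by auto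
    show "subspace (F n) \<and> F n \<subseteq> E" if "N \<le> n" for n
      using FE(1)[of n] that by (auto simp: F_def N_def)
    fix n assume n: "N \<le> n"
    then have n1: "1 \<le> n" "n0 \<le> n" by (auto simp: N_def)
    have K: "1 \<le> exp (C * n)" using C0 by simp
    show "norm f \<le> exp (c * n) * norm (T n f)" if f: "f \<in> F n" for f
    proof -
      have "(exp (- R0 * n) * parvol p (u n)) * norm f \<le> parvol p (\<lambda>i. T n (u n i)) * norm f"
        using u(2)[OF n1(1)] by (intro mult_right_mono) auto
      also have "\<dots> \<le> exp (C * n) ^ p * parvol p (u n) * norm (T n f)"
        by (rule parvol_norm_bound[OF lin K growth]) (use f in \<open>simp add: F_def\<close>)
      finally have "parvol p (u n) * norm f \<le> parvol p (u n) * (exp (R0 * n) * exp (C * n) ^ p * norm (T n f))"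
        by (simp add: exp_minus field_simps)
      then have "norm f \<le> exp (R0 * n) * exp (C * n) ^ p * norm (T n f)"
        using pos[OF n1(1)] by simp
      then show ?thesis unfolding c_def
        by (simp add: exp_add algebra_simps flip: exp_of_nat_mult)
    qed
    show "\<exists>f\<in>F n. norm (T n (w - f)) \<le> exp (- (2 * c + 3 * C + 5) * n) * norm w" if w: "w \<in> E" for w
    proof -
      let ?u = "(u n)(p := w)"
      have img: "?u ` {..<p} = u n ` {..<p}" "(\<lambda>i. T n (?u i)) ` {..<p} = T n ` u n ` {..<p}"
        by auto
      have cong: "parvol p ?u = parvol p (u n)" "parvol p (\<lambda>i. T n (?u i)) = parvol p (\<lambda>i. T n (u n i))"
        by (auto intro!: parvol_cong)
      have "range ?u \<subseteq> E" using u(1)[OF n1(1)] w by auto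
      then have "parvol (Suc p) (\<lambda>i. T n (?u i)) \<le> exp (- (\<rho> + R0) * n) * parvol (Suc p) ?u"
        using n0[OF n1(2)] unfolding parvol_le_def by blast
      then have *: "infdist (T n w) (span (T n ` u n ` {..<p})) * parvol p (\<lambda>i. T n (u n i))
          \<le> exp (- (\<rho> + R0) * n) * (infdist w (span (u n ` {..<p})) * parvol p (u n))"
        unfolding parvol.simps img cong by simp
      have "infdist (T n w) (span (T n ` u n ` {..<p})) * (exp (- R0 * n) * parvol p (u n))
         \<le> infdist (T n w) (span (T n ` u n ` {..<p})) * parvol p (\<lambda>i. T n (u n i))"
        using u(2)[OF n1(1)] by (intro mult_left_mono infdist_nonneg) auto
      also note *
      also have "exp (- (\<rho> + R0) * n) * (infdist w (span (u n ` {..<p})) * parvol p (u n))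
         \<le> exp (- (\<rho> + R0) * n) * (norm w * parvol p (u n))"
        by (intro mult_left_mono mult_right_mono infdist_span_le_norm parvol_nonneg) auto
      also have "\<dots> = (exp (- \<rho> * n) * norm w) * (exp (- R0 * n) * parvol p (u n))"
        by (simp add: algebra_simps flip: exp_add)
      finally have "infdist (T n w) (span (T n ` u n ` {..<p})) \<le> exp (- \<rho> * n) * norm w"
        using pos[OF n1(1)] by simp
      moreover obtain y where "y \<in> span (T n ` u n ` {..<p})"
        "infdist (T n w) (span (T n ` u n ` {..<p})) = dist (T n w) y"
        using infdist_attains_inf[of "span (T n ` u n ` {..<p})" "T n w"] span_zero
        by (metis closed_subspace empty_iff subspace_span)
      moreover then obtain f where "f \<in> F n" "y = T n f"
        using linear_span_image[OF lin, of n "u n ` {..<p}"] by (auto simp: F_def)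
      ultimately show ?thesis
        by (intro bexI[of _ f]) (auto simp: dist_norm linear_diff[OF lin] \<rho>_def)
    qed
  qed
  then show ?thesis by blast
qed

lemma continuous_on_parvol:
  assumes "\<And>i. continuous_on S (\<lambda>z. F z i)" shows "continuous_on S (\<lambda>z. parvol p (F z))"
  using assms unfolding continuous_on_def by (auto intro: tendsto_parvol)

lemma parvol_le_mono: "parvol_le p E T r \<Longrightarrow> r \<le> r' \<Longrightarrow> parvol_le p E T r'"
  unfolding parvol_le_def
  by (meson exp_le_cancel_iff mult_right_mono order_trans parvol_nonneg)

lemma parvol_le_compose:
  assumes "parvol_le p E T r" "parvol_le p E' T' r'" "T ` E \<subseteq> E'"
  shows "parvol_le p E (\<lambda>v. T' (T v)) (r + r')"
  unfolding parvol_le_def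
proof (intro allI impI)
  fix u :: "nat \<Rightarrow> 'a" assume u: "range u \<subseteq> E"
  then have "range (\<lambda>i. T (u i)) \<subseteq> E'" using assms(3) by auto
  then have "parvol p (\<lambda>i. T' (T (u i))) \<le> exp r' * parvol p (\<lambda>i. T (u i))"
    using assms(2) unfolding parvol_le_def by blast
  also have "\<dots> \<le> exp r' * (exp r * parvol p u)"
    using assms(1) u unfolding parvol_le_def by (intro mult_left_mono) auto
  finally show "parvol p (\<lambda>i. T' (T (u i))) \<le> exp (r + r') * parvol p u"
    by (simp add: exp_add mult_ac)
qed

lemma parvol_le_linear:
  assumes "linear T" "\<And>v. norm (T v) \<le> exp r * norm v"
  shows "parvol_le p E T (p * r)"
  unfolding parvol_le_def
  using parvol_linear_image_le[OF assms(1) _ assms(2), of p] by (simp add: exp_of_nat_mult)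

section \<open>Measurable multifunctions\<close>

lemma measurable_multifunctionD:
  "measurable_multifunction M F \<Longrightarrow> open U \<Longrightarrow> {x \<in> space M. F x \<inter> U \<noteq> {}} \<in> sets M"
  by (simp add: measurable_multifunction_def)

lemma measurable_multifunction_Times:
  fixes F :: "'x \<Rightarrow> 'a::second_countable_topology set" and G :: "'x \<Rightarrow> 'b::second_countable_topology set"
  assumes F: "measurable_multifunction M F" and G: "measurable_multifunction M G"
  shows "measurable_multifunction M (\<lambda>x. F x \<times> G x)"
  unfolding measurable_multifunction_def
proof (intro allI impI)
  fix U :: "('a \<times> 'b) set" assume U: "open U"
  obtain B1 :: "'a set set" where B1: "countable B1" "topological_basis B1"
    using ex_countable_basis by blast
  obtain B2 :: "'b set set" where B2: "countable B2" "topological_basis B2"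
    using ex_countable_basis by blast
  define I where "I = {(a, b) \<in> B1 \<times> B2. a \<times> b \<subseteq> U}"
  have I: "countable I" unfolding I_def
    by (rule countable_subset[of _ "B1 \<times> B2"]) (use B1 B2 in auto)
  have "{x \<in> space M. F x \<times> G x \<inter> U \<noteq> {}} =
    (\<Union>i\<in>I. {x \<in> space M. F x \<inter> fst i \<noteq> {}} \<inter> {x \<in> space M. G x \<inter> snd i \<noteq> {}})"
  proof (intro equalityI subsetI)
    fix x assume "x \<in> {x \<in> space M. F x \<times> G x \<inter> U \<noteq> {}}"
    then obtain u v where uv: "x \<in> space M" "u \<in> F x" "v \<in> G x" "(u, v) \<in> U" by auto
    obtain S T where ST: "open S" "open T" "u \<in> S" "v \<in> T" "S \<times> T \<subseteq> U"
      using U uv(4) by (auto elim: open_prod_elim)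
    obtain a where a: "a \<in> B1" "u \<in> a" "a \<subseteq> S" using topological_basisE[OF B1(2) ST(1,3)] .
    obtain b where b: "b \<in> B2" "v \<in> b" "b \<subseteq> T" using topological_basisE[OF B2(2) ST(2,4)] .
    have "(a, b) \<in> I" using a b ST by (auto simp: I_def)
    then show "x \<in> (\<Union>i\<in>I. {x \<in> space M. F x \<inter> fst i \<noteq> {}} \<inter> {x \<in> space M. G x \<inter> snd i \<noteq> {}})"
      using uv a b by (auto intro!: bexI[of _ "(a, b)"])
  qed (auto simp: I_def)
  moreover have "{x \<in> space M. F x \<inter> fst i \<noteq> {}} \<inter> {x \<in> space M. G x \<inter> snd i \<noteq> {}} \<in> sets M" if "i \<in> I" for i
    using that topological_basis_open[OF B1(2)] topological_basis_open[OF B2(2)]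
    by (intro sets.Int measurable_multifunctionD[OF F] measurable_multifunctionD[OF G]) (auto simp: I_def)
  ultimately show "{x \<in> space M. F x \<times> G x \<inter> U \<noteq> {}} \<in> sets M"
    by (simp only:) (rule sets.countable_UN'[OF I], blast)
qed

text \<open>A basic open set of the product is a box, and a sequence in \<open>F x\<close> that lies
  in a box can be chosen coordinate by coordinate, so the condition is a countable
  intersection.\<close>

lemma measurable_multifunction_sequences:
  fixes F :: "'x \<Rightarrow> 'a::second_countable_topology set"
  assumes F: "measurable_multifunction M F" and ne: "\<And>x. F x \<noteq> {}"
  shows "measurable_multifunction M (\<lambda>x. {u :: nat \<Rightarrow> 'a. range u \<subseteq> F x})"
  unfolding measurable_multifunction_def
proof (intro allI impI)
  fix U :: "(nat \<Rightarrow> 'a) set" assume U: "open U"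
  obtain K :: "(nat \<Rightarrow> 'a) set set" where basis: "topological_basis K \<and> countable K \<and>
      (\<forall>k\<in>K. \<exists>X. k = Pi\<^sub>E UNIV X \<and> (\<forall>i. open (X i)) \<and> finite {i. X i \<noteq> UNIV})"
    by (rule exE[OF product_topology_countable_basis[where 'a=nat and 'b='a]]) (rule that)
  note K = conjunct1[OF basis] conjunct1[OF conjunct2[OF basis]] conjunct2[OF conjunct2[OF basis]]
  have "{x \<in> space M. {u. range u \<subseteq> F x} \<inter> k \<noteq> {}} \<in> sets M" if k: "k \<in> K" for k
  proof -
    obtain X where X: "k = Pi\<^sub>E UNIV X" "\<And>i. open (X i)" using K(3) k by blast
    have "{x \<in> space M. {u. range u \<subseteq> F x} \<inter> k \<noteq> {}} = (\<Inter>i. {x \<in> space M. F x \<inter> X i \<noteq> {}})"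
    proof (intro equalityI subsetI)
      fix x assume x: "x \<in> (\<Inter>i. {x \<in> space M. F x \<inter> X i \<noteq> {}})"
      then have "\<forall>i. \<exists>v. v \<in> F x \<inter> X i" by auto
      then obtain u where "\<And>i. u i \<in> F x \<inter> X i" by metis
      then have "u \<in> {u. range u \<subseteq> F x} \<inter> k" by (auto simp: X(1))
      then show "x \<in> {x \<in> space M. {u. range u \<subseteq> F x} \<inter> k \<noteq> {}}" using x by auto
    qed (auto simp: X(1) PiE_iff)
    also have "\<dots> \<in> sets M"
      using measurable_multifunctionD[OF F X(2)] by (intro sets.countable_INT) auto
    finally show ?thesis .
  qed
  moreover obtain K' where K': "K' \<subseteq> K" "U = \<Union>K'"
    using K(1) U unfolding topological_basis_def by blast
  have "{x \<in> space M. {u. range u \<subseteq> F x} \<inter> U \<noteq> {}} = (\<Union>k\<in>K'. {x \<in> space M. {u. range u \<subseteq> F x} \<inter> k \<noteq> {}})"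
    unfolding K'(2) by blast
  moreover have "countable K'" using K' K(2) countable_subset by blast
  ultimately show "{x \<in> space M. {u. range u \<subseteq> F x} \<inter> U \<noteq> {}} \<in> sets M"
    using K'(1) by (auto intro!: sets.countable_UN')
qed

lemma measurable_multifunction_image:
  fixes h :: "'a::topological_space \<Rightarrow> 'b::topological_space"
  assumes F: "measurable_multifunction M F" and h: "continuous_on UNIV h"
  shows "measurable_multifunction M (\<lambda>x. h ` F x)"
  unfolding measurable_multifunction_def
proof (intro allI impI)
  fix U :: "'b set" assume "open U"
  then have "open (h -` U)" using h by (simp add: continuous_on_open_vimage)
  moreover have "{x \<in> space M. h ` F x \<inter> U \<noteq> {}} = {x \<in> space M. F x \<inter> h -` U \<noteq> {}}" by blast
  ultimately show "{x \<in> space M. h ` F x \<inter> U \<noteq> {}} \<in> sets M"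
    using F by (simp add: measurable_multifunction_def)
qed

lemma measurable_multifunction_singleton:
  fixes B :: "'x \<Rightarrow> 'b::topological_space"
  assumes "B \<in> borel_measurable M" shows "measurable_multifunction M (\<lambda>x. {B x})"
  unfolding measurable_multifunction_def
proof (intro allI impI)
  fix U :: "'b set" assume "open U"
  moreover have "{x \<in> space M. {B x} \<inter> U \<noteq> {}} = B -` U \<inter> space M" by auto
  ultimately show "{x \<in> space M. {B x} \<inter> U \<noteq> {}} \<in> sets M"
    using assms by (simp add: measurable_sets)
qed

lemma measurable_multifunction_compose:
  fixes F :: "'y \<Rightarrow> 'b::topological_space set"
  assumes T: "T \<in> M \<rightarrow>\<^sub>M N" and F: "measurable_multifunction N F"
  shows "measurable_multifunction M (\<lambda>x. F (T x))"
  unfolding measurable_multifunction_def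
proof (intro allI impI)
  fix U :: "'b set" assume "open U"
  then have "T -` {x \<in> space N. F x \<inter> U \<noteq> {}} \<inter> space M \<in> sets M"
    using F by (intro measurable_sets[OF T]) (simp add: measurable_multifunction_def)
  moreover have "T -` {x \<in> space N. F x \<inter> U \<noteq> {}} \<inter> space M = {x \<in> space M. F (T x) \<inter> U \<noteq> {}}"
    using measurable_space[OF T] by auto
  ultimately show "{x \<in> space M. F (T x) \<inter> U \<noteq> {}} \<in> sets M" by simp
qed

lemma measurable_multifunction_If:
  fixes F :: "'x \<Rightarrow> 'b::topological_space set"
  assumes X: "X \<in> sets M" and F: "measurable_multifunction M F" and G: "measurable_multifunction M G"
  shows "measurable_multifunction M (\<lambda>x. if x \<in> X then F x else G x)"
  unfolding measurable_multifunction_def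
proof (intro allI impI)
  fix U :: "'b set" assume U: "open U"
  have "{x \<in> space M. (if x \<in> X then F x else G x) \<inter> U \<noteq> {}}
     = (X \<inter> {x \<in> space M. F x \<inter> U \<noteq> {}}) \<union> ({x \<in> space M. G x \<inter> U \<noteq> {}} - X)"
    by auto
  then show "{x \<in> space M. (if x \<in> X then F x else G x) \<inter> U \<noteq> {}} \<in> sets M"
    using sets.Un[OF sets.Int[OF X measurable_multifunctionD[OF F U]]
        sets.Diff[OF measurable_multifunctionD[OF G U] X]] by simp
qed

lemma measurable_multifunction_sum:
  fixes F :: "'i \<Rightarrow> 'x \<Rightarrow> 'a::euclidean_space set"
  assumes "finite I" and F: "\<And>i. i \<in> I \<Longrightarrow> measurable_multifunction M (F i)"
  shows "measurable_multifunction M (\<lambda>x. {\<Sum>i\<in>I. w i |w. \<forall>i\<in>I. w i \<in> F i x})"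
  using assms
proof (induction I rule: finite_induct)
  case empty
  have "{x \<in> space M. {0 :: 'a} \<inter> U \<noteq> {}} \<in> sets M" for U
    by (cases "{0} \<inter> U = {}") auto
  then show ?case by (simp add: measurable_multifunction_def)
next
  case (insert j I)
  have eq: "{\<Sum>i\<in>insert j I. w i |w. \<forall>i\<in>insert j I. w i \<in> F i x}
      = (\<lambda>(a, b). a + b) ` (F j x \<times> {\<Sum>i\<in>I. w i |w. \<forall>i\<in>I. w i \<in> F i x})" for x
  proof (intro equalityI subsetI)
    fix v assume "v \<in> {\<Sum>i\<in>insert j I. w i |w. \<forall>i\<in>insert j I. w i \<in> F i x}"
    then obtain w where "v = w j + (\<Sum>i\<in>I. w i)" "w j \<in> F j x" "\<forall>i\<in>I. w i \<in> F i x"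
      using insert by auto
    then show "v \<in> (\<lambda>(a, b). a + b) ` (F j x \<times> {\<Sum>i\<in>I. w i |w. \<forall>i\<in>I. w i \<in> F i x})"
      by (intro image_eqI[of _ _ "(w j, \<Sum>i\<in>I. w i)"]) auto
  next
    fix v assume "v \<in> (\<lambda>(a, b). a + b) ` (F j x \<times> {\<Sum>i\<in>I. w i |w. \<forall>i\<in>I. w i \<in> F i x})"
    then obtain a w where aw: "v = a + (\<Sum>i\<in>I. w i)" "a \<in> F j x" "\<forall>i\<in>I. w i \<in> F i x" by auto
    have "(\<Sum>i\<in>I. (w(j := a)) i) = (\<Sum>i\<in>I. w i)" using insert by (intro sum.cong) auto
    then have "v = (\<Sum>i\<in>insert j I. (w(j := a)) i)" using insert aw by simp
    moreover have "\<forall>i\<in>insert j I. (w(j := a)) i \<in> F i x" using aw by auto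
    ultimately show "v \<in> {\<Sum>i\<in>insert j I. w i |w. \<forall>i\<in>insert j I. w i \<in> F i x}" by blast
  qed
  have "continuous_on UNIV (\<lambda>(a, b). a + b :: 'a)"
    unfolding case_prod_beta by (intro continuous_intros)
  then show ?case unfolding eq
    by (intro measurable_multifunction_image measurable_multifunction_Times insert) (use insert in auto)
qed

text \<open>An existential quantifier over an uncountable fibre becomes the hitting of an open set
  by a product multifunction. Bounds over a fibre are therefore handled below through their
  violation, a strict inequality.\<close>

lemma sets_ex_multifunction:
  fixes F :: "'x \<Rightarrow> 'a::second_countable_topology set" and B :: "'x \<Rightarrow> 'b::second_countable_topology"
  assumes B: "B \<in> borel_measurable M" and F: "measurable_multifunction M F"
    and U: "open {(b, v). P b v}"
  shows "{x \<in> space M. \<exists>v\<in>F x. P (B x) v} \<in> sets M"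
proof -
  have "{x \<in> space M. \<exists>v\<in>F x. P (B x) v} = {x \<in> space M. ({B x} \<times> F x) \<inter> {(b, v). P b v} \<noteq> {}}"
    by auto
  also have "\<dots> \<in> sets M"
    using measurable_multifunctionD[OF measurable_multifunction_Times[OF measurable_multifunction_singleton[OF B] F] U] .
  finally show ?thesis .
qed

lemma continuous_on_matrix_vector_mult [continuous_intros]:
  fixes f :: "'z::topological_space \<Rightarrow> real^'n^'m" and g :: "'z \<Rightarrow> real^'n"
  shows "continuous_on S f \<Longrightarrow> continuous_on S g \<Longrightarrow> continuous_on S (\<lambda>z. f z *v g z)"
  unfolding matrix_vector_mult_def by (intro continuous_intros)

lemma continuous_on_matrix_matrix_mult [continuous_intros]:
  fixes f :: "'z::topological_space \<Rightarrow> real^'n^'m" and g :: "'z \<Rightarrow> real^'k^'n"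
  shows "continuous_on S f \<Longrightarrow> continuous_on S g \<Longrightarrow> continuous_on S (\<lambda>z. f z ** g z)"
  unfolding matrix_matrix_mult_def by (intro continuous_intros)

lemma borel_measurable_matrix_matrix_mult [measurable (raw)]:
  fixes f :: "'z \<Rightarrow> real^'n^'m" and g :: "'z \<Rightarrow> real^'k^'n"
  assumes "f \<in> borel_measurable M" "g \<in> borel_measurable M"
  shows "(\<lambda>z. f z ** g z) \<in> borel_measurable M"
  by (rule borel_measurable_continuous_Pair[OF assms]) (intro continuous_intros)

section \<open>Hyperbolic splittings\<close>

text \<open>Read \<open>P s t a\<close> as: moving from time \<open>s\<close> to time \<open>t\<close> costs at most \<open>a\<close>. One jumps from every good
  time, except during the last \<open>L\<close> steps, where a jump might overshoot \<open>n\<close>; this is the last sum.\<close>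

lemma greedy_cost:
  fixes P :: "nat \<Rightarrow> nat \<Rightarrow> real \<Rightarrow> bool" and h :: "nat \<Rightarrow> real"
  assumes R: "0 \<le> R" and h: "\<And>t. 0 \<le> h t"
    and refl: "\<And>t. P t t 0"
    and trans: "\<And>s t q a b. s \<le> t \<Longrightarrow> t \<le> q \<Longrightarrow> P s t a \<Longrightarrow> P t q b \<Longrightarrow> P s q (a + b)"
    and mono: "\<And>s t a b. s \<le> t \<Longrightarrow> P s t a \<Longrightarrow> a \<le> b \<Longrightarrow> P s t b"
    and step: "\<And>t. P t (Suc t) (h t)"
    and good: "\<And>t. t \<notin> B \<Longrightarrow> \<exists>j\<in>{1..L}. P t (t + j) (- R * j)"
  shows "P 0 n (- R * n + (\<Sum>t<n. indicator B t * (h t + R)) + (\<Sum>t | t < n \<and> n \<le> t + L. h t + R))"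
proof -
  define b where "b t = indicator B t * (h t + R) + (if n \<le> t + L then h t + R else 0)" for t
  have b0: "0 \<le> b t" for t using R h[of t] by (auto simp: b_def indicator_def)
  have "P s n (- R * (n - s) + (\<Sum>t\<in>{s..<n}. b t))" if "s \<le> n" for s
    using that
  proof (induction "n - s" arbitrary: s rule: less_induct)
    case less
    \<comment> \<open>A single step costs \<open>h s = - R + (h s + R)\<close>, so it keeps to the
      rate \<open>R\<close> wherever \<open>b s\<close> covers the surplus
      \<open>h s + R\<close>.\<close>
    have unit: "P s n (- R * (n - s) + (\<Sum>t\<in>{s..<n}. b t))" if s: "s < n" "h s + R \<le> b s"
    proof -
      have "P (Suc s) n (- R * (n - Suc s) + (\<Sum>t\<in>{Suc s..<n}. b t))" using s by (intro less) auto
      then have "P s n (h s + (- R * (n - Suc s) + (\<Sum>t\<in>{Suc s..<n}. b t)))"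
        using s by (intro trans[OF _ _ step]) auto
      then show ?thesis
      proof (rule mono[rotated])
        have "(\<Sum>t\<in>{s..<n}. b t) = b s + (\<Sum>t\<in>{Suc s..<n}. b t)"
          using s by (simp add: sum.atLeast_Suc_lessThan)
        moreover have "- R * (n - s) = - R * (n - Suc s) - R" using s by (simp add: algebra_simps of_nat_diff)
        ultimately show "h s + (- R * (n - Suc s) + (\<Sum>t\<in>{Suc s..<n}. b t)) \<le> - R * (n - s) + (\<Sum>t\<in>{s..<n}. b t)"
          using s(2) by linarith
      qed (use s in simp)
    qed
    show ?case
    proof (cases "s = n")
      case True
      then show ?thesis using refl by simp
    next
      case False
      then have s: "s < n" using less by simp
      show ?thesis
      proof (cases "n \<le> s + L \<or> s \<in> B")
        case True
        then show ?thesis using R h[of s] by (intro unit[OF s]) (auto simp: b_def indicator_def)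
      next
        case False
        then obtain j where j: "1 \<le> j" "j \<le> L" "P s (s + j) (- R * j)"
          using good[of s] by auto
        have "P (s + j) n (- R * (n - (s + j)) + (\<Sum>t\<in>{s + j..<n}. b t))"
          using False j by (intro less) auto
        then have "P s n (- R * j + (- R * (n - (s + j)) + (\<Sum>t\<in>{s + j..<n}. b t)))"
          using False j by (intro trans[OF _ _ j(3)]) auto
        then show ?thesis
        proof (rule mono[rotated])
          have "(\<Sum>t\<in>{s + j..<n}. b t) \<le> (\<Sum>t\<in>{s..<n}. b t)"
            by (rule sum_mono2) (use b0 in auto)
          moreover have "- R * j + - R * (n - (s + j)) = - R * (n - s)"
            using False j by (simp add: algebra_simps of_nat_diff)
          ultimately show "- R * j + (- R * (n - (s + j)) + (\<Sum>t\<in>{s + j..<n}. b t))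
             \<le> - R * (n - s) + (\<Sum>t\<in>{s..<n}. b t)" by linarith
        qed (use s in simp)
      qed
    qed
  qed
  from this[of 0] have "P 0 n (- R * n + (\<Sum>t<n. b t))" by (simp add: lessThan_atLeast0)
  moreover have "(\<Sum>t<n. if n \<le> t + L then h t + R else 0) = (\<Sum>t | t < n \<and> n \<le> t + L. h t + R)"
    by (subst sum.inter_filter[symmetric]) (auto intro!: sum.cong)
  then have "(\<Sum>t<n. b t)
      = (\<Sum>t<n. indicator B t * (h t + R)) + (\<Sum>t | t < n \<and> n \<le> t + L. h t + R)"
    unfolding b_def by (subst sum.distrib) (simp only:)
  ultimately show ?thesis by (simp only: add.assoc)
qed

section \<open>Cocycles over an invertible map and their invariant splittings\<close>

abbreviation act :: "('x \<Rightarrow> 'x) \<Rightarrow> ('x \<Rightarrow> real^'d^'d) \<Rightarrow> 'x \<Rightarrow> nat \<Rightarrow> real^'d \<Rightarrow> real^'d" where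
  "act f A x n v \<equiv> cocycle f A x n *v v"

lemma act_Suc': "act f A x (Suc n) v = act f A (f x) n (A x *v v)"
proof (induction n)
  case (Suc n)
  have "act f A x (Suc (Suc n)) v = A ((f ^^ Suc n) x) *v act f A x (Suc n) v"
    by (simp add: matrix_vector_mul_assoc)
  also have "\<dots> = act f A (f x) (Suc n) (A x *v v)"
    unfolding Suc by (simp add: matrix_vector_mul_assoc matrix_mul_assoc funpow_swap1)
  finally show ?case .
qed simp

lemma act_Suc: "act f A x (Suc n) v = A ((f ^^ n) x) *v act f A x n v"
  by (simp add: matrix_vector_mul_assoc)

lemma act_add: "act f A x (m + n) v = act f A ((f ^^ m) x) n (act f A x m v)"
  by (induction n) (simp_all add: act_Suc funpow_add add.commute[of m] del: cocycle.simps(2))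

text \<open>The algebraic conditions hold at every point, which keeps null sets out of inductions
  along orbits; only the growth conditions are confined to the exactly invariant set
  \<open>X\<close>. On \<open>Es\<close> mere inclusion is asked because an exponent minus infinity
  allows \<open>A x\<close> to be singular there.\<close>

locale hyperbolic_splitting =
  f: measure_preserving M f + g: measure_preserving M g
  for M :: "'x measure" and f g :: "'x \<Rightarrow> 'x" +
  fixes A :: "'x \<Rightarrow> real^'d^'d" and Es Eu :: "'x \<Rightarrow> (real^'d) set" and X :: "'x set" and lam :: real
    and h :: "'x \<Rightarrow> real"
  assumes fg: "f (g x) = x" and gf: "g (f x) = x"
    and ergodic: "B \<in> sets M \<Longrightarrow> f -` B \<inter> space M = B \<Longrightarrow> measure M B = 0 \<or> measure M B = 1"
    and A_measurable [measurable]: "A \<in> borel_measurable M"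
    and h_integrable: "integrable M h" and h_nonneg: "0 \<le> h x"
    and norm_A_le: "norm (A x *v v) \<le> exp (h x) * norm v"
    and X_sets [measurable]: "X \<in> sets M" and AE_X: "AE x in M. x \<in> X"
    and X_invariant: "f x \<in> X \<longleftrightarrow> x \<in> X"
    and lam_pos: "0 < lam"
    and Es_measurable: "measurable_multifunction M Es"
    and Eu_measurable: "measurable_multifunction M Eu"
    and Es_subspace: "subspace (Es x)" and Eu_subspace: "subspace (Eu x)"
    and Es_Int_Eu: "Es x \<inter> Eu x = {0}"
    and Es_plus_Eu: "\<exists>s\<in>Es x. \<exists>u\<in>Eu x. v = s + u"
    and Es_invariant: "s \<in> Es x \<Longrightarrow> A x *v s \<in> Es (f x)"
    and Eu_invariant: "(\<lambda>v. A x *v v) ` Eu x = Eu (f x)"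
    and stable: "x \<in> X \<Longrightarrow> s \<in> Es x \<Longrightarrow> \<exists>C. \<forall>n. norm (act f A x n s) \<le> C * exp (- lam * n)"
    and unstable: "x \<in> X \<Longrightarrow> u \<in> Eu x \<Longrightarrow> u \<noteq> 0 \<Longrightarrow>
       \<exists>N. \<forall>n\<ge>N. norm (act f A x n u) > exp (lam * n) * norm u"
begin

lemma X_funpow_f [simp]: "(f ^^ n) x \<in> X \<longleftrightarrow> x \<in> X"
  by (induction n) (auto simp: X_invariant)

lemma f_funpow_g: "(f ^^ n) ((g ^^ n) x) = x"
  by (induction n arbitrary: x) (auto simp: fg funpow_swap1)

lemma X_funpow_g [simp]: "(g ^^ n) x \<in> X \<longleftrightarrow> x \<in> X"
  using X_funpow_f[of n "(g ^^ n) x"] by (simp add: f_funpow_g)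

lemma f_funpow_g_le: "m \<le> n \<Longrightarrow> (f ^^ m) ((g ^^ n) x) = (g ^^ (n - m)) x"
  using f_funpow_g[of m "(g ^^ (n - m)) x"] by (simp add: funpow_add[symmetric, unfolded comp_def, THEN fun_cong])

lemma linear_act: "linear (act f A x n)"
  by simp

lemma norm_act_le: "norm (act f A x n v) \<le> exp (birkhoff_sum f h n x) * norm v"
proof (induction n)
  case (Suc n)
  have "norm (act f A x (Suc n) v) \<le> exp (h ((f ^^ n) x)) * norm (act f A x n v)"
    unfolding act_Suc by (rule norm_A_le)
  also have "\<dots> \<le> exp (h ((f ^^ n) x)) * (exp (birkhoff_sum f h n x) * norm v)"
    by (intro mult_left_mono Suc) auto
  finally show ?case by (simp add: birkhoff_sum_def exp_add mult_ac)
qed (simp add: birkhoff_sum_def)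

lemma act_Eu: "act f A x n ` Eu x = Eu ((f ^^ n) x)"
proof (induction n)
  case (Suc n)
  have "act f A x (Suc n) ` Eu x = (\<lambda>v. A ((f ^^ n) x) *v v) ` act f A x n ` Eu x"
    unfolding act_Suc by (simp add: image_image)
  then show ?case unfolding Suc Eu_invariant by simp
qed simp

lemma act_Eu_in: "u \<in> Eu x \<Longrightarrow> act f A x n u \<in> Eu ((f ^^ n) x)"
  using act_Eu by blast

lemma act_Eu_inj: "x \<in> X \<Longrightarrow> u \<in> Eu x \<Longrightarrow> act f A x n u = 0 \<Longrightarrow> u = 0"
proof (rule ccontr)
  assume u: "x \<in> X" "u \<in> Eu x" "act f A x n u = 0" "u \<noteq> 0"
  then obtain N where N: "\<And>n. N \<le> n \<Longrightarrow> norm (act f A x n u) > exp (lam * n) * norm u"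
    using unstable by blast
  have "act f A x (n + N) u = 0" using u(3) by (simp add: act_add)
  then have "exp (lam * (n + N)) * norm u < 0" using N[of "n + N"] by simp
  then show False by (simp add: mult_less_0_iff)
qed

lemma cocycle_measurable [measurable]: "(\<lambda>x. cocycle f A x n) \<in> borel_measurable M"
proof (induction n)
  case (Suc n)
  have [measurable]: "(\<lambda>x. A ((f ^^ n) x)) \<in> borel_measurable M"
    by (rule measurable_compose[OF f.funpow_measurable A_measurable])
  note Suc[measurable]
  show ?case by simp
qed simp

subsection \<open>Volumes in the unstable spaces\<close>

lemma parvol_le_measurable:
  "{x \<in> space M. parvol_le p (Eu x) (act f A x n) r} \<in> sets M"
proof -
  have "open {(B, u :: nat \<Rightarrow> real^'d). exp r * parvol p u < parvol p (\<lambda>i. (B :: real^'d^'d) *v u i)}"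
    unfolding case_prod_beta
    by (intro open_Collect_less continuous_intros continuous_on_parvol
        continuous_on_product_then_coordinatewise)
  then have "{x \<in> space M. \<exists>u\<in>{u. range u \<subseteq> Eu x}. exp r * parvol p u < parvol p (\<lambda>i. act f A x n (u i))} \<in> sets M"
    using subspace_0[OF Eu_subspace]
    by (intro sets_ex_multifunction[OF cocycle_measurable measurable_multifunction_sequences[OF Eu_measurable]]) auto
  then have "space M - {x \<in> space M. \<exists>u\<in>{u. range u \<subseteq> Eu x}. exp r * parvol p u < parvol p (\<lambda>i. act f A x n (u i))} \<in> sets M"
    by auto
  also have "space M - {x \<in> space M. \<exists>u\<in>{u. range u \<subseteq> Eu x}. exp r * parvol p u < parvol p (\<lambda>i. act f A x n (u i))}
     = {x \<in> space M. parvol_le p (Eu x) (act f A x n) r}"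
    unfolding parvol_le_def by (auto simp flip: not_le)
  finally show ?thesis .
qed

text \<open>The infimum over \<open>n\<close> of the logarithmic volume growth per step is minus
  infinity. Time 0 is excluded because there the cocycle is the identity and every such bound holds
  trivially.\<close>

definition collapsing :: "nat \<Rightarrow> 'x set" where
  "collapsing p = {x \<in> space M. \<forall>R::nat. \<exists>n\<ge>1. parvol_le p (Eu x) (act f A x n) (- real R * n)}"

lemma collapsing_sets [measurable]: "collapsing p \<in> sets M"
proof -
  note parvol_le_measurable[measurable]
  show ?thesis unfolding collapsing_def by measurable
qed

lemma parvol_le_unit: "parvol_le p (Eu x) (\<lambda>v. A x *v v) (p * h x)"
  by (rule parvol_le_linear) (auto simp: norm_A_le)

lemma collapsing_backward:
  assumes x: "x \<in> space M" "f x \<in> collapsing p" shows "x \<in> collapsing p"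
proof -
  have "\<exists>n\<ge>1. parvol_le p (Eu x) (act f A x n) (- real R * n)" for R :: nat
  proof -
    obtain k :: nat where k: "p * h x \<le> k" using real_arch_simple by blast
    \<comment> \<open>Since \<open>n \<ge> 1\<close>, the surplus \<open>k * n\<close> pays for the
      first step, and \<open>2 * R * n \<ge> R * (n + 1)\<close> accounts for the additional unit of
      time.\<close>
    obtain n where n: "1 \<le> n" "parvol_le p (Eu (f x)) (act f A (f x) n) (- real (2 * R + k) * n)"
      using x(2) unfolding collapsing_def by blast
    have "parvol_le p (Eu x) (\<lambda>v. act f A (f x) n (A x *v v)) (p * h x + - real (2 * R + k) * n)"
      by (rule parvol_le_compose[OF parvol_le_unit n(2)]) (simp add: Eu_invariant)
    then have "parvol_le p (Eu x) (act f A x (Suc n)) (- real R * Suc n)"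
      unfolding act_Suc'[symmetric]
    proof (rule parvol_le_mono)
      have "k * 1 \<le> k * real n" "R * 1 \<le> R * real n"
        using mult_left_mono[of 1 "real n" "real k"] mult_left_mono[of 1 "real n" "real R"] n(1) by auto
      then show "p * h x + - real (2 * R + k) * n \<le> - real R * Suc n"
        using k by (simp add: algebra_simps)
    qed
    then show ?thesis by (intro exI[of _ "Suc n"]) auto
  qed
  then show ?thesis using x by (simp add: collapsing_def)
qed

definition fast_collapse :: "nat \<Rightarrow> 'x \<Rightarrow> bool" where
  "fast_collapse p x \<longleftrightarrow> (\<forall>R. \<exists>n0. \<forall>n\<ge>n0. parvol_le p (Eu x) (act f A x n) (- R * real n))"

text \<open>The zero-infinity law for the volume growth; it replaces Kingman's subadditive ergodic theorem.\<close>

lemma AE_fast_collapse: "AE x in M. x \<in> collapsing p \<longrightarrow> fast_collapse p x"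
proof -
  \<comment> \<open>For fixed \<open>R\<close> these sets decrease to the empty set as
    \<open>L\<close> grows, so single steps taken on them cost little on average.\<close>
  define B where "B R L = {x \<in> collapsing p. \<not> (\<exists>j\<in>{1..L}. parvol_le p (Eu x) (act f A x j) (- real R * real j))}"
    for R L :: nat
  have B: "B R L \<in> sets M" for R L
  proof -
    have "B R L = collapsing p - (\<Union>j\<in>{1..L}. {x \<in> space M. parvol_le p (Eu x) (act f A x j) (- real R * real j)})"
      unfolding B_def using sets.sets_into_space[OF collapsing_sets] by auto
    also have "\<dots> \<in> sets M" by (intro sets.Diff sets.finite_UN parvol_le_measurable) auto
    finally show ?thesis .
  qed
  define w where "w R x = p * h x + real R" for R :: nat and x
  have w: "integrable M (w R)" "0 \<le> w R x" for R x
    unfolding w_def using h_integrable h_nonneg by auto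
  have "AE x in M. \<exists>L. \<forall>n. birkhoff_sum f (\<lambda>y. w R y * indicator (B R L) y) n x \<le> 1 * real n" for R
  proof (rule f.AE_small_birkhoff_sum[OF w zero_less_one B])
    show "decseq (B R)" unfolding decseq_def B_def by force
    have "x \<notin> (\<Inter>L. B R L)" for x
    proof
      assume x: "x \<in> (\<Inter>L. B R L)"
      then have "x \<in> collapsing p" by (auto simp: B_def)
      then obtain n where "1 \<le> n" "parvol_le p (Eu x) (act f A x n) (- real R * n)"
        unfolding collapsing_def by blast
      then have "x \<notin> B R n" by (auto simp: B_def)
      with x show False by blast
    qed
    then show "AE x in M. x \<notin> (\<Inter>L. B R L)" by simp
  qed
  then have "AE x in M. \<forall>R. \<exists>L. \<forall>n. birkhoff_sum f (\<lambda>y. w R y * indicator (B R L) y) n x \<le> 1 * real n"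
    by (simp add: AE_all_countable)
  moreover have "AE x in M. \<exists>C\<ge>0. \<forall>n. birkhoff_sum f h n x \<le> C * real n"
    by (rule f.AE_linear_birkhoff_sum[OF h_integrable h_nonneg])
  moreover have "AE x in M. x \<in> collapsing p \<longrightarrow> (\<forall>k. (f ^^ k) x \<in> collapsing p)"
    by (rule f.AE_backward_invariant) (auto intro: collapsing_backward)
  ultimately show ?thesis
  proof eventually_elim
    case (elim x)
    from elim(2) obtain C where C: "0 \<le> C" "\<And>n. birkhoff_sum f h n x \<le> C * real n" by auto
    show ?case
    proof
      assume "x \<in> collapsing p"
      then have orbit: "(f ^^ k) x \<in> collapsing p" for k using elim by blast
      show "fast_collapse p x"
        unfolding fast_collapse_def
      proof
        fix R0 :: real
        \<comment> \<open>Of the surplus over \<open>R0\<close>, one unit pays for the bad times,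
          one for \<open>L * R \<le> n\<close>, and \<open>p * C\<close> for the last
          \<open>L\<close> steps, whose sum of \<open>h\<close> is bounded crudely by that of the
          whole orbit segment.\<close>
        obtain R :: nat where R: "R0 + 2 + p * C \<le> R" using real_arch_simple by blast
        from elim(1) obtain L where L: "\<And>n. birkhoff_sum f (\<lambda>y. w R y * indicator (B R L) y) n x \<le> real n"
          by auto
        let ?P = "\<lambda>s t a. parvol_le p (Eu ((f ^^ s) x)) (act f A ((f ^^ s) x) (t - s)) a"
        have "parvol_le p (Eu x) (act f A x n) (- R0 * n)" if n: "n \<ge> L * R" for n
        proof -
          have "?P 0 n (- real R * n + (\<Sum>t<n. indicator {t. (f ^^ t) x \<in> B R L} t * (p * h ((f ^^ t) x) + real R))
              + (\<Sum>t | t < n \<and> n \<le> t + L. p * h ((f ^^ t) x) + real R))"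
          proof (rule greedy_cost)
            show "?P t t 0" for t by (simp add: parvol_le_def)
            show "?P s q (a + b)" if "s \<le> t" "t \<le> q" "?P s t a" "?P t q b" for s t q a b
            proof -
              have "(f ^^ (t - s)) ((f ^^ s) x) = (f ^^ t) x"
                using that(1) by (simp flip: funpow_add[unfolded comp_def, THEN fun_cong])
              then show ?thesis
                using parvol_le_compose[OF that(3,4)] that(1,2)
                  act_add[of f A "(f ^^ s) x" "t - s" "q - t"] act_Eu[of "(f ^^ s) x" "t - s"] by simp
            qed
            show "?P s t b" if "?P s t a" "a \<le> b" for s t a b using that by (rule parvol_le_mono)
            show "?P t (Suc t) (p * h ((f ^^ t) x))" for t
              using parvol_le_unit[of p "(f ^^ t) x"] by simp
            show "\<exists>j\<in>{1..L}. ?P t (t + j) (- real R * j)" if "t \<notin> {t. (f ^^ t) x \<in> B R L}" for t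
              using that orbit[of t] by (auto simp: B_def)
          qed (use h_nonneg in auto)
          then show ?thesis
          proof (simp only: funpow_0 diff_zero, elim parvol_le_mono)
            have 1: "(\<Sum>t<n. indicator {t. (f ^^ t) x \<in> B R L} t * (p * h ((f ^^ t) x) + real R)) \<le> n"
              using L[of n] by (simp add: birkhoff_sum_def w_def indicator_def mult_ac)
            have "(\<Sum>t | t < n \<and> n \<le> t + L. p * h ((f ^^ t) x) + real R)
                = p * (\<Sum>t | t < n \<and> n \<le> t + L. h ((f ^^ t) x)) + card {t. t < n \<and> n \<le> t + L} * R"
              by (simp add: sum.distrib sum_distrib_left)
            also have "\<dots> \<le> p * (C * n) + L * R"
            proof (intro add_mono mult_left_mono)
              have "(\<Sum>t | t < n \<and> n \<le> t + L. h ((f ^^ t) x)) \<le> birkhoff_sum f h n x"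
                unfolding birkhoff_sum_def by (rule sum_mono2) (use h_nonneg in auto)
              then show "(\<Sum>t | t < n \<and> n \<le> t + L. h ((f ^^ t) x)) \<le> C * n" using C(2)[of n] by linarith
              have "card {t. t < n \<and> n \<le> t + L} \<le> card {n - L..<n}" by (rule card_mono) auto
              then show "real (card {t. t < n \<and> n \<le> t + L} * R) \<le> real (L * R)"
                by (auto intro!: mult_right_mono simp del: of_nat_mult)
            qed auto
            also have "real (L * R) \<le> n" using n by linarith
            finally have 2: "(\<Sum>t | t < n \<and> n \<le> t + L. p * h ((f ^^ t) x) + real R) \<le> p * (C * n) + n" by simp
            have "(R0 + 2 + p * C) * n \<le> real R * n" by (intro mult_right_mono R) auto
            then show "- real R * n + (\<Sum>t<n. indicator {t. (f ^^ t) x \<in> B R L} t * (p * h ((f ^^ t) x) + real R))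
              + (\<Sum>t | t < n \<and> n \<le> t + L. p * h ((f ^^ t) x) + real R) \<le> - R0 * n"
              using 1 2 by (simp add: algebra_simps)
          qed
        qed
        then show "\<exists>n0. \<forall>n\<ge>n0. parvol_le p (Eu x) (act f A x n) (- R0 * n)" by blast
      qed
    qed
  qed
qed

subsection \<open>The contraction of the generator on the unstable spaces\<close>

text \<open>The positive part of the logarithm of the norm of the inverse of \<open>A x\<close> on
  \<open>Eu x\<close>. Off \<open>X\<close> injectivity on \<open>Eu x\<close> is not guaranteed and
  the infimum could be over the empty set, hence the default 0.\<close>

definition contraction :: "'x \<Rightarrow> real" where
  "contraction x = (if x \<in> X then Inf {c. 0 \<le> c \<and> (\<forall>w\<in>Eu x. norm w \<le> exp c * norm (A x *v w))} else 0)"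

lemma contraction_le:
  "0 \<le> c \<Longrightarrow> (\<And>w. w \<in> Eu x \<Longrightarrow> norm w \<le> exp c * norm (A x *v w)) \<Longrightarrow> contraction x \<le> c"
  unfolding contraction_def by (auto intro!: cInf_lower bdd_belowI[of _ 0])

text \<open>Injectivity on a finite-dimensional space makes some \<open>c\<close> admissible, and
  the admissible set is closed, so its infimum belongs to it.\<close>

lemma contraction_attained:
  assumes x: "x \<in> X"
  shows "0 \<le> contraction x \<and> (\<forall>w\<in>Eu x. norm w \<le> exp (contraction x) * norm (A x *v w))"
proof -
  define S where "S = {c. 0 \<le> c \<and> (\<forall>w\<in>Eu x. norm w \<le> exp c * norm (A x *v w))}"
  have "\<exists>e>0. \<forall>w\<in>Eu x. norm (A x *v w) \<ge> e * norm w"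
    using act_Eu_inj[OF x, of _ 1]
    by (intro injective_imp_isometric closed_subspace Eu_subspace) auto
  then obtain e where e: "0 < e" "\<And>w. w \<in> Eu x \<Longrightarrow> e * norm w \<le> norm (A x *v w)" by blast
  have "max 0 (- ln e) \<in> S"
    unfolding S_def
  proof (intro CollectI conjI ballI)
    fix w assume w: "w \<in> Eu x"
    have "norm w \<le> exp (- ln e) * norm (A x *v w)"
      using e(1) e(2)[OF w] by (simp add: exp_minus field_simps)
    also have "\<dots> \<le> exp (max 0 (- ln e)) * norm (A x *v w)" by (intro mult_right_mono) auto
    finally show "norm w \<le> exp (max 0 (- ln e)) * norm (A x *v w)" .
  qed auto
  moreover have "closed S"
  proof -
    have "S = {0..} \<inter> (\<Inter>w\<in>Eu x. {c. norm w \<le> exp c * norm (A x *v w)})" unfolding S_def by auto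
    moreover have "closed {c. norm w \<le> exp c * norm (A x *v w)}" for w
      by (intro closed_Collect_le continuous_intros)
    ultimately show ?thesis by auto
  qed
  moreover have "bdd_below S" unfolding S_def by (auto intro!: bdd_belowI[of _ 0])
  ultimately have "Inf S \<in> S" by (intro closed_contains_Inf) auto
  then show ?thesis using x unfolding contraction_def S_def by auto
qed

lemma contraction_nonneg: "0 \<le> contraction x"
  using contraction_attained[of x] by (cases "x \<in> X") (auto simp: contraction_def)

lemma contraction_measurable [measurable]: "contraction \<in> borel_measurable M"
  unfolding borel_measurable_iff_le
proof
  fix c :: real
  show "{x \<in> space M. contraction x \<le> c} \<in> sets M"
  proof (cases "0 \<le> c")
    case True
    have "open {(B, w :: real^'d). exp c * norm ((B :: real^'d^'d) *v w) < norm w}"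
      unfolding case_prod_beta by (intro open_Collect_less continuous_intros)
    then have V: "{x \<in> space M. \<exists>w\<in>Eu x. exp c * norm (A x *v w) < norm w} \<in> sets M"
      by (rule sets_ex_multifunction[OF A_measurable Eu_measurable])
    have "contraction x \<le> c \<longleftrightarrow> x \<notin> X \<or> \<not> (\<exists>w\<in>Eu x. exp c * norm (A x *v w) < norm w)" for x
    proof
      assume le: "contraction x \<le> c"
      have "norm w \<le> exp c * norm (A x *v w)" if "x \<in> X" "w \<in> Eu x" for w
      proof -
        have "norm w \<le> exp (contraction x) * norm (A x *v w)" using contraction_attained that by blast
        also have "\<dots> \<le> exp c * norm (A x *v w)" using le by (intro mult_right_mono) auto
        finally show ?thesis .
      qed
      then show "x \<notin> X \<or> \<not> (\<exists>w\<in>Eu x. exp c * norm (A x *v w) < norm w)" by (auto simp: not_less)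
    next
      assume "x \<notin> X \<or> \<not> (\<exists>w\<in>Eu x. exp c * norm (A x *v w) < norm w)"
      then show "contraction x \<le> c"
      proof
        assume "\<not> (\<exists>w\<in>Eu x. exp c * norm (A x *v w) < norm w)"
        then show ?thesis using True by (intro contraction_le) (auto simp: not_less)
      qed (use True in \<open>simp add: contraction_def\<close>)
    qed
    then have "{x \<in> space M. contraction x \<le> c}
        = space M - X \<inter> {x \<in> space M. \<exists>w\<in>Eu x. exp c * norm (A x *v w) < norm w}" by auto
    then show ?thesis using V by simp
  next
    case False
    then have "\<not> contraction x \<le> c" for x using contraction_nonneg[of x] by linarith
    then have "{x \<in> space M. contraction x \<le> c} = {}" by blast
    then show ?thesis by (simp only: sets.empty_sets)
  qed
qed

text \<open>A moving family of \<open>dim (Eu x)\<close> vectors spans the fibre as long as its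
  volume is positive, so by \<open>parvol_norm_bound\<close> the contraction of one step is at most
  the logarithmic volume lost plus \<open>r * h\<close>. The losses telescope, and the premise
  supplies a family that loses less than \<open>R * n\<close> in total.\<close>

lemma contraction_sum_le:
  assumes x: "x \<in> X" and n: "\<not> parvol_le (dim (Eu x)) (Eu x) (act f A x n) (- R * n)"
  shows "birkhoff_sum f contraction n x \<le> R * n + dim (Eu x) * birkhoff_sum f h n x"
proof -
  define r where "r = dim (Eu x)"
  obtain u :: "nat \<Rightarrow> real^'d" where u: "range u \<subseteq> Eu x"
    and un: "exp (- R * n) * parvol r u < parvol r (\<lambda>i. act f A x n (u i))"
    using n unfolding parvol_le_def r_def by (auto simp: not_le)
  define V where "V t = parvol r (\<lambda>i. act f A x t (u i))" for t
  have V0: "V 0 = parvol r u" by (simp add: V_def)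
  have V_Suc: "V (Suc t) \<le> exp (h ((f ^^ t) x)) ^ r * V t" for t
    unfolding V_def act_Suc by (rule parvol_linear_image_le) (auto simp: norm_A_le)
  have "0 \<le> exp (- R * n) * parvol r u" by (simp add: parvol_nonneg)
  then have Vn: "0 < V n" using un unfolding V_def by linarith
  \<comment> \<open>Positivity is propagated backwards from time \<open>n\<close>: a vanishing
    volume cannot become positive again.\<close>
  have Vpos: "0 < V t" if "t \<le> n" for t
    using that
  proof (induction rule: inc_induct)
    case (step t)
    have "0 < exp (h ((f ^^ t) x)) ^ r * V t" using less_le_trans[OF step.IH V_Suc] .
    then show ?case by (simp add: zero_less_mult_iff)
  qed (rule Vn)
  have le: "contraction ((f ^^ t) x) \<le> ln (V t) - ln (V (Suc t)) + r * h ((f ^^ t) x)" if t: "t < n" for t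
  proof -
    let ?y = "(f ^^ t) x" and ?w = "\<lambda>i. act f A x t (u i)"
    have pos: "0 < V t" "0 < V (Suc t)" using Vpos t by auto
    have "ln (V (Suc t)) \<le> ln (exp (h ?y) ^ r * V t)" using V_Suc[of t] pos by simp
    also have "\<dots> = r * h ?y + ln (V t)" using pos by (simp add: ln_mult ln_realpow)
    finally have c0: "0 \<le> ln (V t) - ln (V (Suc t)) + r * h ?y" by simp
    have wE: "?w ` {..<r} \<subseteq> Eu ?y" using u act_Eu_in by fastforce
    \<comment> \<open>Dimensions do not increase under the cocycle, so \<open>r\<close> independent
      vectors fill the fibre.\<close>
    have "dim (Eu ?y) \<le> r" unfolding act_Eu[symmetric] r_def by (rule dim_image_le) simp
    moreover have "dim (span (?w ` {..<r})) = r"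
      using dim_of_parvol_nonzero[of r ?w] pos by (simp add: V_def)
    ultimately have span: "span (?w ` {..<r}) = Eu ?y"
      using span_minimal[OF wE Eu_subspace] by (intro subspace_dim_equal Eu_subspace) auto
    show ?thesis
    proof (rule contraction_le[OF c0])
      fix w assume w: "w \<in> Eu ?y"
      have "V (Suc t) * norm w \<le> exp (h ?y) ^ r * V t * norm (A ?y *v w)"
        unfolding V_def act_Suc
        by (rule parvol_norm_bound) (use w span norm_A_le h_nonneg in auto)
      then have "norm w \<le> exp (h ?y) ^ r * V t * norm (A ?y *v w) / V (Suc t)"
        using pos by (simp add: field_simps)
      also have "\<dots> = exp (ln (V t) - ln (V (Suc t)) + r * h ?y) * norm (A ?y *v w)"
        using pos by (simp add: exp_add exp_diff exp_of_nat_mult)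
      finally show "norm w \<le> exp (ln (V t) - ln (V (Suc t)) + r * h ?y) * norm (A ?y *v w)" .
    qed
  qed
  have "birkhoff_sum f contraction n x \<le> (\<Sum>t<n. ln (V t) - ln (V (Suc t)) + r * h ((f ^^ t) x))"
    unfolding birkhoff_sum_def by (rule sum_mono) (use le in auto)
  also have "\<dots> = ln (V 0) - ln (V n) + r * birkhoff_sum f h n x"
    by (simp add: sum.distrib sum_lessThan_telescope'[of "\<lambda>t. ln (V t)" n] birkhoff_sum_def sum_distrib_left)
  also have "ln (V 0) - ln (V n) \<le> R * n"
  proof -
    have "ln (exp (- R * n) * V 0) \<le> ln (V n)"
      using un Vpos[of 0] Vn by (subst ln_le_cancel_iff) (auto simp: V0 V_def)
    then show ?thesis using Vpos[of 0] by (simp add: ln_mult)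
  qed
  finally show ?thesis by (simp add: r_def)
qed

text \<open>Just below the least dimension of fast collapse, the zero-infinity law turns the failure
  of fast collapse into a lower bound with one \<open>R\<close> for all \<open>n \<ge> 1\<close>.
  Then \<open>gap_slow_vector\<close> produces a vector that contradicts the growth on
  \<open>Eu\<close>.\<close>

lemma AE_not_collapsing:
  "AE x in M. x \<in> X \<longrightarrow> x \<notin> collapsing (dim (Eu x))"
proof -
  have "AE x in M. \<exists>C\<ge>0. \<forall>n. birkhoff_sum f h n x \<le> C * real n"
    by (rule f.AE_linear_birkhoff_sum[OF h_integrable h_nonneg])
  moreover have "AE x in M. \<forall>p. x \<in> collapsing p \<longrightarrow> fast_collapse p x"
    using AE_fast_collapse by (simp add: AE_all_countable)
  ultimately show ?thesis using AE_space
  proof eventually_elim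
    case (elim x)
    obtain C where C: "0 \<le> C" "\<And>n. birkhoff_sum f h n x \<le> C * real n" using elim(1) by auto
    show ?case
    proof (intro impI notI)
      assume x: "x \<in> X" and "x \<in> collapsing (dim (Eu x))"
      then have *: "fast_collapse (dim (Eu x)) x" using elim by blast
      define q where "q = (LEAST p. fast_collapse p x)"
      have q: "fast_collapse q x" "q \<le> dim (Eu x)" unfolding q_def using * by (auto intro: LeastI Least_le)
      have "\<not> fast_collapse 0 x"
      proof
        assume "fast_collapse 0 x"
        then obtain n0 where "\<forall>n\<ge>n0. parvol_le 0 (Eu x) (act f A x n) (- 1 * real n)"
          unfolding fast_collapse_def by blast
        then have "parvol_le 0 (Eu x) (act f A x (Suc n0)) (- 1 * real (Suc n0))" by (metis le_SucI order_refl)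
        then have "1 \<le> exp (- real (Suc n0))"
          unfolding parvol_le_def using subspace_0[OF Eu_subspace, of x] by (auto dest!: spec[of _ "\<lambda>_. 0"])
        then show False by simp
      qed
      then obtain p where p: "q = Suc p" using q(1) by (cases q) auto
      then have "\<not> fast_collapse p x" unfolding q_def using not_less_Least by (metis lessI)
      then have "x \<notin> collapsing p" using elim by blast
      then obtain R :: nat where R: "\<And>n. 1 \<le> n \<Longrightarrow> \<not> parvol_le p (Eu x) (act f A x n) (- real R * n)"
        using elim(3) unfolding collapsing_def by blast
      have "\<exists>w\<in>Eu x. w \<noteq> 0 \<and> (\<exists>N. \<forall>n\<ge>N. norm (act f A x n w) \<le> 13 * exp (- 5 * real n))"
      proof (rule gap_slow_vector[where C=C and ?R0.0=R and p=p])
        fix n v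
        \<comment> \<open>The same \<open>C\<close> controls single steps, because one term of a
          Birkhoff sum of nonnegative terms is at most the whole sum.\<close>
        have "h ((f ^^ n) x) \<le> birkhoff_sum f h (Suc n) x"
          using h_nonneg by (auto simp: birkhoff_sum_def intro!: sum_nonneg)
        also have "\<dots> \<le> C * Suc n" by (rule C)
        finally show "norm (act f A x (Suc n) v) \<le> exp (C * Suc n) * norm (act f A x n v)"
          unfolding act_Suc using order_trans[OF norm_A_le mult_right_mono] by simp
        show "norm (act f A x n v) \<le> exp (C * n) * norm v"
          using order_trans[OF norm_act_le mult_right_mono] C(2)[of n] by simp
      next
        fix r show "\<exists>n0. \<forall>n\<ge>n0. parvol_le (Suc p) (Eu x) (act f A x n) (- r * real n)"
          using q(1) unfolding p fast_collapse_def by blast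
      qed (use C R q(2) p in \<open>auto simp: Eu_subspace\<close>)
      then obtain w N where w: "w \<in> Eu x" "w \<noteq> 0"
        "\<And>n. N \<le> n \<Longrightarrow> norm (act f A x n w) \<le> 13 * exp (- 5 * real n)" by blast
      obtain N' where N': "\<And>n. N' \<le> n \<Longrightarrow> norm (act f A x n w) > exp (lam * n) * norm w"
        using unstable[OF x w(1,2)] by blast
      have "(\<lambda>n. 13 * exp (- 5 * real n)) \<longlonglongrightarrow> 0" by real_asymp
      from order_tendstoD(2)[OF this, of "norm w"] obtain N''
        where N'': "\<And>n. N'' \<le> n \<Longrightarrow> 13 * exp (- 5 * real n) < norm w"
        using w(2) unfolding eventually_sequentially by auto
      define n where "n = max N (max N' N'')"
      have "norm w \<le> exp (lam * n) * norm w"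
        using mult_right_mono[of 1 "exp (lam * n)" "norm w"] lam_pos by simp
      then show False using w(3)[of n] N'[of n] N''[of n] unfolding n_def by linarith
    qed
  qed
qed

lemma contraction_integrable: "integrable M contraction"
proof (rule f.integrable_of_linear_birkhoff_sum[OF contraction_measurable contraction_nonneg _ ergodic])
  have "AE x in M. \<exists>C\<ge>0. \<forall>n. birkhoff_sum f h n x \<le> C * real n"
    by (rule f.AE_linear_birkhoff_sum[OF h_integrable h_nonneg])
  then show "AE x in M. \<exists>C. \<forall>n. birkhoff_sum f contraction n x \<le> C * real n"
    using AE_not_collapsing AE_X AE_space
  proof eventually_elim
    case (elim x)
    obtain C where C: "0 \<le> C" "\<And>n. birkhoff_sum f h n x \<le> C * real n" using elim(1) by auto
    obtain R :: nat where R: "\<And>n. 1 \<le> n \<Longrightarrow> \<not> parvol_le (dim (Eu x)) (Eu x) (act f A x n) (- real R * n)"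
      using elim(2,3,4) unfolding collapsing_def by blast
    have "birkhoff_sum f contraction n x \<le> (R + dim (Eu x) * C) * real n" for n
    proof (cases "n = 0")
      case False
      then have "birkhoff_sum f contraction n x \<le> real R * n + dim (Eu x) * birkhoff_sum f h n x"
        by (intro contraction_sum_le elim R) auto
      also have "\<dots> \<le> real R * n + dim (Eu x) * (C * n)" by (intro add_mono mult_left_mono C) auto
      finally show ?thesis by (simp add: algebra_simps)
    qed (simp add: birkhoff_sum_def)
    then show ?case by blast
  qed
qed auto

subsection \<open>Backward contraction on the unstable spaces\<close>

text \<open>Unit vectors that are not expanded up to ever later times accumulate at one that is
  never expanded at the rate \<open>lam\<close>, against its growth.\<close>

lemma uniform_expansion_time:
  assumes x: "x \<in> X"
  shows "\<exists>L. \<forall>w\<in>Eu x. \<exists>j\<in>{1..L::nat}. exp (lam * j) * norm w \<le> norm (act f A x j w)"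
proof (rule ccontr)
  assume "\<not> ?thesis"
  then have "\<forall>L. \<exists>w. w \<in> Eu x \<and> (\<forall>j\<in>{1..L}. norm (act f A x j w) < exp (lam * j) * norm w)"
    by (auto simp: not_le)
  then obtain w where w: "\<And>L. w L \<in> Eu x"
    "\<And>L j. j \<in> {1..L} \<Longrightarrow> norm (act f A x j (w L)) < exp (lam * j) * norm (w L)" by metis
  \<comment> \<open>The index \<open>Suc L\<close> makes the time range nonempty, and the strict
    inequality at time 1 excludes the zero vector.\<close>
  have w0: "w (Suc L) \<noteq> 0" for L
    using w(2)[of 1 "Suc L"] by auto
  define v where "v L = (1 / norm (w (Suc L))) *\<^sub>R w (Suc L)" for L
  have v: "v L \<in> Eu x \<inter> sphere 0 1" for L
    unfolding v_def using w(1) w0 by (auto intro: subspace_scale Eu_subspace)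
  have vj: "norm (act f A x j (v L)) \<le> exp (lam * j)" if "j \<in> {1..Suc L}" for j L
  proof -
    have "norm (act f A x j (v L)) = norm (act f A x j (w (Suc L))) / norm (w (Suc L))"
      by (simp add: v_def linear_scale[OF linear_act])
    also have "\<dots> \<le> exp (lam * j)" using w(2)[OF that] w0[of L] by (simp add: field_simps)
    finally show ?thesis .
  qed
  have "compact (Eu x \<inter> sphere 0 1)"
    by (intro closed_Int_compact closed_subspace Eu_subspace) auto
  then obtain z r where z: "z \<in> Eu x \<inter> sphere 0 1" "strict_mono r" "(v \<circ> r) \<longlonglongrightarrow> z"
    using v unfolding compact_def by metis
  have zj: "norm (act f A x j z) \<le> exp (lam * j)" if "1 \<le> j" for j
  proof (rule LIMSEQ_le_const2)
    show "(\<lambda>L. norm (act f A x j ((v \<circ> r) L))) \<longlonglongrightarrow> norm (act f A x j z)"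
      by (intro tendsto_norm bounded_linear.tendsto[OF _ z(3)]) simp
    show "\<exists>N. \<forall>n\<ge>N. norm (act f A x j ((v \<circ> r) n)) \<le> exp (lam * j)"
    proof (intro exI[of _ j] allI impI)
      fix n assume "j \<le> n"
      then have "j \<le> Suc (r n)" using seq_suble[OF z(2), of n] by linarith
      then show "norm (act f A x j ((v \<circ> r) n)) \<le> exp (lam * j)" using vj that by simp
    qed
  qed
  have "z \<noteq> 0" "norm z = 1" using z(1) by auto
  then obtain N where N: "\<And>n. N \<le> n \<Longrightarrow> norm (act f A x n z) > exp (lam * n) * norm z"
    using unstable[OF x] z(1) by blast
  show False using N[of "max 1 N"] zj[of "max 1 N"] \<open>norm z = 1\<close> by simp
qed

text \<open>The jumps run forward from \<open>(g ^^ m) x\<close> to \<open>x\<close>, but the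
  weights are summed over the backward orbit of \<open>x\<close>, so that the null set and
  \<open>C\<close> do not depend on \<open>m\<close>. Half of the rate \<open>lam\<close> is given
  up to the bad times.\<close>

lemma AE_backward:
  "AE x in M. \<exists>C\<ge>0. \<forall>m. \<forall>w\<in>Eu ((g ^^ m) x).
     norm w \<le> C * exp (- (lam / 2) * m) * norm (act f A ((g ^^ m) x) m w)"
proof -
  define B where "B L = {x \<in> X. \<exists>w\<in>Eu x. \<forall>j\<in>{1..L}. norm (act f A x j w) < exp (lam * real j) * norm w}"
    for L :: nat
  have XM: "X \<subseteq> space M" using sets.sets_into_space[OF X_sets] .
  have B: "B L \<in> sets M" for L
  proof -
    have "open {(B :: nat \<Rightarrow> real^'d^'d, w). \<forall>j\<in>{1..L}. norm (B j *v w) < exp (lam * real j) * norm w}"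
    proof -
      have "{(B :: nat \<Rightarrow> real^'d^'d, w). \<forall>j\<in>{1..L}. norm (B j *v w) < exp (lam * real j) * norm w}
        = (\<Inter>j\<in>{1..L}. {z. norm (fst z j *v snd z) < exp (lam * real j) * norm (snd z)})" by auto
      moreover have "open {z :: (nat \<Rightarrow> real^'d^'d) \<times> _. norm (fst z j *v snd z) < exp (lam * real j) * norm (snd z)}" for j
        by (intro open_Collect_less continuous_intros continuous_on_product_then_coordinatewise)
      ultimately show ?thesis by (simp add: open_INT)
    qed
    then have "{x \<in> space M. \<exists>w\<in>Eu x. \<forall>j\<in>{1..L}. norm (act f A x j w) < exp (lam * real j) * norm w} \<in> sets M"
      by (intro sets_ex_multifunction[where B="\<lambda>x j. cocycle f A x j", OF _ Eu_measurable]
          measurable_coordinatewise_then_product cocycle_measurable)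
    moreover have "B L = X \<inter> {x \<in> space M. \<exists>w\<in>Eu x. \<forall>j\<in>{1..L}. norm (act f A x j w) < exp (lam * real j) * norm w}"
      unfolding B_def using XM by auto
    ultimately show ?thesis by simp
  qed
  define w where "w x = contraction x + lam" for x
  have w: "integrable M w" "0 \<le> w x" for x
    unfolding w_def using contraction_integrable contraction_nonneg lam_pos by (auto intro: add_nonneg_nonneg less_imp_le)
  have "AE x in M. \<exists>L. \<forall>n. birkhoff_sum g (\<lambda>y. w y * indicator (B L) y) n x \<le> (lam / 2) * real n"
  proof (rule g.AE_small_birkhoff_sum[OF w _ B])
    show "decseq B" unfolding decseq_def B_def by force
    have "x \<notin> (\<Inter>L. B L)" for x
    proof
      assume x: "x \<in> (\<Inter>L. B L)"
      then have "x \<in> X" by (auto simp: B_def)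
      then obtain L where "\<forall>w\<in>Eu x. \<exists>j\<in>{1..L}. exp (lam * j) * norm w \<le> norm (act f A x j w)"
        using uniform_expansion_time by blast
      then have "x \<notin> B L" by (force simp: B_def not_less)
      with x show False by blast
    qed
    then show "AE x in M. x \<notin> (\<Inter>L. B L)" by simp
  qed (use lam_pos in simp)
  with AE_X show ?thesis
  proof eventually_elim
    case (elim x)
    obtain L where L: "\<And>n. birkhoff_sum g (\<lambda>y. w y * indicator (B L) y) n x \<le> (lam / 2) * real n"
      using elim(2) by auto
    \<comment> \<open>Whatever \<open>m\<close> is, the last \<open>L\<close> steps before reaching
      \<open>x\<close> pass through the same points \<open>(g ^^ k) x\<close> with
      \<open>k \<le> L\<close>.\<close>
    define K where "K = (\<Sum>k\<le>L. w ((g ^^ k) x))"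
    have "norm v \<le> exp (lam / 2 + K) * exp (- (lam / 2) * m) * norm (act f A ((g ^^ m) x) m v)"
      if v: "v \<in> Eu ((g ^^ m) x)" for m v
    proof -
      define y where "y = (g ^^ m) x"
      have yX: "(f ^^ t) y \<in> X" for t using elim(1) by (simp add: y_def)
      have yE: "act f A y t v \<in> Eu ((f ^^ t) y)" for t using act_Eu_in v by (simp add: y_def)
      have yt: "(f ^^ t) y = (g ^^ (m - t)) x" if "t \<le> m" for t
        unfolding y_def using that by (rule f_funpow_g_le)
      let ?P = "\<lambda>s t a. norm (act f A y s v) \<le> exp a * norm (act f A y t v)"
      have "?P 0 m (- lam * m + (\<Sum>t<m. indicator {t. (f ^^ t) y \<in> B L} t * (contraction ((f ^^ t) y) + lam))
              + (\<Sum>t | t < m \<and> m \<le> t + L. contraction ((f ^^ t) y) + lam))"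
      proof (rule greedy_cost)
        show "?P t t 0" for t by simp
        show "?P s q (a + b)" if "s \<le> t" "t \<le> q" "?P s t a" "?P t q b" for s t q a b
          using order_trans[OF that(3) mult_left_mono[OF that(4)]] by (simp add: exp_add mult_ac)
        show "?P s t b" if "?P s t a" "a \<le> b" for s t a b
          using order_trans[OF that(1) mult_right_mono] that(2) by simp
        show "?P t (Suc t) (contraction ((f ^^ t) y))" for t
          using contraction_attained[OF yX] yE unfolding act_Suc by blast
        show "\<exists>j\<in>{1..L}. ?P t (t + j) (- lam * j)" if "t \<notin> {t. (f ^^ t) y \<in> B L}" for t
        proof -
          have "\<exists>j\<in>{1..L}. exp (lam * real j) * norm (act f A y t v) \<le> norm (act f A ((f ^^ t) y) j (act f A y t v))"
            using that yX[of t] yE[of t] unfolding B_def by (auto simp: not_less)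
          then show ?thesis unfolding act_add by (auto simp: exp_minus field_simps intro: bexI)
        qed
      qed (use lam_pos contraction_nonneg in auto)
      \<comment> \<open>Reversing time gives the indices 1 to \<open>m\<close>, whereas a Birkhoff
        sum starts at 0; hence \<open>Suc m\<close>, and the factor \<open>exp (lam / 2)\<close> in
        the constant.\<close>
      moreover have "(\<Sum>t<m. indicator {t. (f ^^ t) y \<in> B L} t * (contraction ((f ^^ t) y) + lam)) \<le> (lam / 2) * Suc m"
      proof -
        let ?G = "\<lambda>y. w y * indicator (B L) y"
        have "(\<Sum>t<m. indicator {t. (f ^^ t) y \<in> B L} t * (contraction ((f ^^ t) y) + lam))
            = (\<Sum>t<m. ?G ((g ^^ (m - t)) x))"
          by (rule sum.cong) (auto simp: yt w_def indicator_def)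
        also have "\<dots> = (\<Sum>k\<in>{1..m}. ?G ((g ^^ k) x))"
          by (rule sum.reindex_bij_witness[of _ "\<lambda>k. m - k" "\<lambda>t. m - t"]) auto
        also have "\<dots> \<le> birkhoff_sum g ?G (Suc m) x"
          unfolding birkhoff_sum_def by (rule sum_mono2) (use w(2) in auto)
        also have "\<dots> \<le> (lam / 2) * Suc m" by (rule L)
        finally show ?thesis .
      qed
      moreover have "(\<Sum>t | t < m \<and> m \<le> t + L. contraction ((f ^^ t) y) + lam) \<le> K"
      proof -
        have "(\<Sum>t | t < m \<and> m \<le> t + L. contraction ((f ^^ t) y) + lam)
            = (\<Sum>t | t < m \<and> m \<le> t + L. w ((g ^^ (m - t)) x))"
          by (rule sum.cong) (auto simp: yt w_def)
        also have "\<dots> = (\<Sum>k | 1 \<le> k \<and> k \<le> m \<and> k \<le> L. w ((g ^^ k) x))"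
          by (rule sum.reindex_bij_witness[of _ "\<lambda>k. m - k" "\<lambda>t. m - t"]) auto
        also have "\<dots> \<le> K" unfolding K_def by (rule sum_mono2) (use w(2) in auto)
        finally show ?thesis .
      qed
      ultimately have "norm v \<le> exp (- lam * m + (lam / 2) * Suc m + K) * norm (act f A y m v)"
        using order_trans[OF _ mult_right_mono[of "exp _" "exp (- lam * m + (lam / 2) * Suc m + K)"]] by fastforce
      also have "exp (- lam * m + (lam / 2) * Suc m + K) = exp (lam / 2 + K) * exp (- (lam / 2) * m)"
        by (simp add: field_simps flip: exp_add)
      finally show ?thesis unfolding y_def .
    qed
    then show ?case by (intro exI[of _ "exp (lam / 2 + K)"]) auto
  qed
qed

subsection \<open>The sets of uniform dichotomy bounds\<close>

definition rate :: real where "rate = lam / 2"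

text \<open>These are the dichotomy bounds with base point \<open>x\<close>: into the future on the
  stable part, and into the past for unstable vectors, which start at \<open>(g ^^ m) x\<close>.
  Comparing with the norm of a full sum builds in the norms of the projections, so
  \<open>m = 0\<close> already bounds the angle from below.\<close>

definition regular :: "real \<Rightarrow> 'x set" where
  "regular c = {x \<in> X. \<forall>m.
     (\<forall>s\<in>Es x. \<forall>u\<in>Eu x. norm (act f A x m s) \<le> c * exp (- rate * m) * norm (s + u)) \<and>
     (\<forall>w\<in>Eu ((g ^^ m) x). \<forall>s\<in>Es x.
        norm w \<le> c * exp (- rate * m) * norm (act f A ((g ^^ m) x) m w + s))}"

lemma regular_sets [measurable]: "regular c \<in> sets M"
proof -
  define S1 where "S1 m = {x \<in> space M. \<exists>v\<in>Es x \<times> Eu x.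
    c * exp (- rate * m) * norm (fst v + snd v) < norm (act f A x m (fst v))}" for m :: nat
  define S2 where "S2 m = {x \<in> space M. \<exists>v\<in>Eu ((g ^^ m) x) \<times> Es x.
    c * exp (- rate * m) * norm (act f A ((g ^^ m) x) m (fst v) + snd v) < norm (fst v)}" for m :: nat
  have "open {(B, v :: (real^'d) \<times> (real^'d)). c * exp (- rate * real m) * norm (fst v + snd v) < norm ((B :: real^'d^'d) *v fst v)}" for m
    unfolding case_prod_beta by (intro open_Collect_less continuous_intros)
  then have S1: "S1 m \<in> sets M" for m
    unfolding S1_def
    by (intro sets_ex_multifunction[OF cocycle_measurable] measurable_multifunction_Times Es_measurable Eu_measurable)
  have "open {(B, v :: (real^'d) \<times> (real^'d)). c * exp (- rate * real m) * norm ((B :: real^'d^'d) *v fst v + snd v) < norm (fst v)}" for m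
    unfolding case_prod_beta by (intro open_Collect_less continuous_intros)
  moreover have "(\<lambda>x. cocycle f A ((g ^^ m) x) m) \<in> borel_measurable M" for m
    by (rule measurable_compose[OF g.funpow_measurable cocycle_measurable])
  moreover have "measurable_multifunction M (\<lambda>x. Eu ((g ^^ m) x))" for m
    by (rule measurable_multifunction_compose[OF g.funpow_measurable Eu_measurable])
  ultimately have S2: "S2 m \<in> sets M" for m
    unfolding S2_def
    by (intro sets_ex_multifunction[where B="\<lambda>x. cocycle f A ((g ^^ m) x) m"]
       measurable_multifunction_Times Es_measurable)
  have XM: "X \<subseteq> space M" using sets.sets_into_space[OF X_sets] .
  have m1: "x \<notin> S1 m \<longleftrightarrow> (\<forall>s\<in>Es x. \<forall>u\<in>Eu x. norm (act f A x m s) \<le> c * exp (- rate * m) * norm (s + u))"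
    if "x \<in> X" for x m
    using subsetD[OF XM that] unfolding S1_def by (simp add: not_less)
  have m2: "x \<notin> S2 m \<longleftrightarrow> (\<forall>w\<in>Eu ((g ^^ m) x). \<forall>s\<in>Es x.
        norm w \<le> c * exp (- rate * m) * norm (act f A ((g ^^ m) x) m w + s))"
    if "x \<in> X" for x m
    using subsetD[OF XM that] unfolding S2_def by (simp add: not_less)
  have "x \<in> regular c \<longleftrightarrow> x \<in> X \<and> (\<forall>m. x \<notin> S1 m \<and> x \<notin> S2 m)" for x
    unfolding regular_def mem_Collect_eq by (simp only: m1 m2 cong: conj_cong)
  then have "regular c = X - (\<Union>m. S1 m \<union> S2 m)" by blast
  then show ?thesis using S1 S2 by auto
qed

lemma regular_mono: "c \<le> c' \<Longrightarrow> regular c \<subseteq> regular c'"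
proof
  fix x assume c: "c \<le> c'" and x: "x \<in> regular c"
  have "c * exp (- rate * m) * norm v \<le> c' * exp (- rate * m) * norm v" for m :: nat and v :: "real^'d"
    using c by (intro mult_right_mono) auto
  then have "a \<le> c' * exp (- rate * m) * norm v" if "a \<le> c * exp (- rate * m) * norm v"
    for a and m :: nat and v :: "real^'d"
    using that order_trans by blast
  then show "x \<in> regular c'" using x unfolding regular_def by blast
qed

text \<open>Addition is injective on the product of the two spaces, hence bounded below there, as in
  any finite-dimensional space.\<close>

lemma splitting_norm_bound: "\<exists>K\<ge>0. \<forall>s\<in>Es x. \<forall>u\<in>Eu x. norm s \<le> K * norm (s + u) \<and> norm u \<le> K * norm (s + u)"
proof -
  let ?f = "\<lambda>v :: (real^'d) \<times> (real^'d). fst v + snd v"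
  have "\<exists>e>0. \<forall>v\<in>Es x \<times> Eu x. norm (?f v) \<ge> e * norm v"
  proof (rule injective_imp_isometric)
    show "closed (Es x \<times> Eu x)" by (intro closed_Times closed_subspace Es_subspace Eu_subspace)
    show "subspace (Es x \<times> Eu x)" by (intro subspace_Times Es_subspace Eu_subspace)
    show "bounded_linear ?f" by (intro bounded_linear_add bounded_linear_fst bounded_linear_snd)
    show "\<forall>v\<in>Es x \<times> Eu x. ?f v = 0 \<longrightarrow> v = 0"
    proof (intro ballI impI)
      fix v assume v: "v \<in> Es x \<times> Eu x" "?f v = 0"
      then have "fst v = - snd v" by (simp add: eq_neg_iff_add_eq_0)
      then have "fst v \<in> Es x \<inter> Eu x" using v subspace_neg[OF Eu_subspace] by (metis IntI mem_Times_iff)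
      then have "fst v = 0" using Es_Int_Eu by auto
      then show "v = 0" using v(2) by (simp add: prod_eq_iff)
    qed
  qed
  then obtain e where e: "0 < e" "\<And>s u. s \<in> Es x \<Longrightarrow> u \<in> Eu x \<Longrightarrow> e * norm (s, u) \<le> norm (s + u)" by fastforce
  have "norm s \<le> 1 / e * norm (s + u) \<and> norm u \<le> 1 / e * norm (s + u)" if "s \<in> Es x" "u \<in> Eu x" for s u
  proof -
    have "norm s \<le> norm (s, u)" "norm u \<le> norm (s, u)"
      using norm_fst_le[of s u] norm_snd_le[of u s] by auto
    moreover have "norm (s, u) \<le> 1 / e * norm (s + u)" using e(1) e(2)[OF that] by (simp add: field_simps)
    ultimately show ?thesis by linarith
  qed
  then show ?thesis using e(1) by (intro exI[of _ "1 / e"]) auto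
qed

text \<open>The constants of the single vectors are collected over a finite orthonormal
  basis.\<close>

lemma stable_uniform:
  assumes x: "x \<in> X"
  shows "\<exists>C\<ge>0. \<forall>s\<in>Es x. \<forall>n. norm (act f A x n s) \<le> C * exp (- lam * n) * norm s"
proof -
  obtain B where B: "B \<subseteq> Es x" "pairwise orthogonal B" "\<And>b. b \<in> B \<Longrightarrow> norm b = 1"
    "independent B" "span B = Es x"
    using orthonormal_basis_subspace[OF Es_subspace] by metis
  have fin: "finite B" using B(4) independent_imp_finite by blast
  have "\<forall>b\<in>B. \<exists>C. \<forall>n. norm (act f A x n b) \<le> C * exp (- lam * n)" using stable[OF x] B(1) by blast
  then obtain C where C: "\<And>b n. b \<in> B \<Longrightarrow> norm (act f A x n b) \<le> C b * exp (- lam * n)" by metis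
  have C0: "0 \<le> C b" if "b \<in> B" for b
    using order_trans[OF norm_ge_zero C[OF that, of 0]] by simp
  have "norm (act f A x n s) \<le> (\<Sum>b\<in>B. C b) * exp (- lam * n) * norm s" if s: "s \<in> Es x" for s n
  proof -
    have "s = (\<Sum>b\<in>B. (s \<bullet> b) *\<^sub>R b)"
      using orthonormal_basis_expand[OF B(2) B(3) _ fin, of s] s B(5) by simp
    then have "act f A x n s = (\<Sum>b\<in>B. (s \<bullet> b) *\<^sub>R act f A x n b)"
      by (metis (no_types, lifting) linear_sum[OF linear_act] linear_scale[OF linear_act] sum.cong)
    also have "norm \<dots> \<le> (\<Sum>b\<in>B. norm s * (C b * exp (- lam * n)))"
    proof (rule sum_norm_le)
      fix b assume b: "b \<in> B"
      have "\<bar>s \<bullet> b\<bar> \<le> norm s" using Cauchy_Schwarz_ineq2[of s b] B(3)[OF b] by simp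
      then show "norm ((s \<bullet> b) *\<^sub>R act f A x n b) \<le> norm s * (C b * exp (- lam * n))"
        unfolding norm_scaleR using C[OF b] by (intro mult_mono) auto
    qed
    finally show ?thesis by (simp add: sum_distrib_left sum_distrib_right mult_ac)
  qed
  then show ?thesis using C0 by (intro exI[of _ "\<Sum>b\<in>B. C b"]) (auto intro: sum_nonneg)
qed

lemma AE_regular: "AE x in M. \<exists>c::nat. x \<in> regular (real c)"
  using AE_backward AE_X
proof eventually_elim
  case (elim x)
  from elim(1) obtain C where C: "0 \<le> C" "\<And>m w. w \<in> Eu ((g ^^ m) x) \<Longrightarrow>
     norm w \<le> C * exp (- (lam / 2) * m) * norm (act f A ((g ^^ m) x) m w)" by blast
  obtain K where K: "0 \<le> K" "\<And>s u. s \<in> Es x \<Longrightarrow> u \<in> Eu x \<Longrightarrow> norm s \<le> K * norm (s + u)"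
    "\<And>s u. s \<in> Es x \<Longrightarrow> u \<in> Eu x \<Longrightarrow> norm u \<le> K * norm (s + u)"
    using splitting_norm_bound by blast
  obtain C' where C': "0 \<le> C'" "\<And>s n. s \<in> Es x \<Longrightarrow> norm (act f A x n s) \<le> C' * exp (- lam * n) * norm s"
    using stable_uniform[OF elim(2)] by blast
  define D where "D = max (C * K) (C' * K)"
  have "x \<in> regular D"
    unfolding regular_def
  proof (intro CollectI conjI allI ballI elim(2))
    fix m s u assume su: "s \<in> Es x" "u \<in> Eu x"
    have "norm (act f A x m s) \<le> C' * exp (- lam * m) * norm s" by (rule C'(2)[OF su(1)])
    also have "\<dots> \<le> C' * exp (- rate * m) * (K * norm (s + u))"
      using C'(1) lam_pos by (intro mult_mono K su) (auto simp: rate_def)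
    also have "\<dots> = (C' * K) * (exp (- rate * m) * norm (s + u))" by simp
    also have "\<dots> \<le> D * (exp (- rate * m) * norm (s + u))" by (intro mult_right_mono) (auto simp: D_def)
    finally show "norm (act f A x m s) \<le> D * exp (- rate * m) * norm (s + u)" by simp
  next
    fix m w s assume ws: "w \<in> Eu ((g ^^ m) x)" "s \<in> Es x"
    let ?u = "act f A ((g ^^ m) x) m w"
    have u: "?u \<in> Eu x" using act_Eu_in[OF ws(1), of m] by (simp add: f_funpow_g)
    have "norm w \<le> C * exp (- rate * m) * norm ?u" unfolding rate_def by (rule C(2)[OF ws(1)])
    also have "\<dots> \<le> C * exp (- rate * m) * (K * norm (s + ?u))"
      using C(1) by (intro mult_left_mono K ws u) auto
    also have "\<dots> = (C * K) * (exp (- rate * m) * norm (?u + s))" by (simp add: add.commute)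
    also have "\<dots> \<le> D * (exp (- rate * m) * norm (?u + s))" by (intro mult_right_mono) (auto simp: D_def)
    finally show "norm w \<le> D * exp (- rate * m) * norm (?u + s)" by simp
  qed
  moreover obtain c :: nat where "D \<le> c" using real_arch_simple by blast
  ultimately show ?case using regular_mono by blast
qed

text \<open>One step backwards costs only the factor \<open>exp (h x + rate + 1)\<close>. This is why no control on
  the angle between the two spaces is needed beyond its positivity.\<close>

lemma regular_step:
  assumes c: "1 \<le> c" and fx: "f x \<in> regular c"
  shows "x \<in> regular (c * exp (h x + rate + 1))"
proof -
  define D where "D = c * exp (h x + rate + 1)"
  have rate0: "0 \<le> rate" using lam_pos by (simp add: rate_def)
  have x: "x \<in> X" using fx by (simp add: regular_def X_invariant)
  have st: "norm (act f A (f x) m s) \<le> c * exp (- rate * m) * norm (s + u)"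
    if "s \<in> Es (f x)" "u \<in> Eu (f x)" for m s u
    using fx that unfolding regular_def by blast
  have un: "norm w \<le> c * exp (- rate * m) * norm (act f A ((g ^^ m) (f x)) m w + s)"
    if "w \<in> Eu ((g ^^ m) (f x))" "s \<in> Es (f x)" for m w s
    using fx that unfolding regular_def by blast
  \<comment> \<open>The bound at \<open>f x\<close> with one step more is applied to images under
    \<open>A x\<close>, and \<open>norm_A_le\<close> removes the outer \<open>A x\<close>, so that
    \<open>A x\<close> is never inverted.\<close>
  have un': "norm w \<le> c * exp (h x) * exp (- rate * m) * norm (act f A ((g ^^ m) x) m w + s)"
    if ws: "w \<in> Eu ((g ^^ m) x)" "s \<in> Es x" for m w s
  proof -
    have g: "(g ^^ Suc m) (f x) = (g ^^ m) x" by (simp add: funpow_swap1 gf)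
    have "norm w \<le> c * exp (- rate * Suc m) * norm (act f A ((g ^^ m) x) (Suc m) w + A x *v s)"
      using un[of w "Suc m" "A x *v s"] ws Es_invariant unfolding g by blast
    also have "act f A ((g ^^ m) x) (Suc m) w + A x *v s = A x *v (act f A ((g ^^ m) x) m w + s)"
      unfolding act_Suc by (simp add: f_funpow_g matrix_vector_right_distrib)
    also have "c * exp (- rate * Suc m) * norm \<dots> \<le> c * exp (- rate * m) * (exp (h x) * norm (act f A ((g ^^ m) x) m w + s))"
      using c rate0 by (intro mult_mono norm_A_le) (auto intro: mult_left_mono)
    finally show ?thesis by (simp add: mult_ac)
  qed
  \<comment> \<open>The extra 1 in the exponent absorbs the summand 1 of the case
    \<open>m = 0\<close>, by \<open>exp 1 \<ge> 2\<close>; \<open>rate\<close> pays for the step by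
    which the stable time range shrinks at \<open>f x\<close>.\<close>
  have e: "1 + exp (h x) * c \<le> c * exp (h x + 1)" "exp (h x) * exp rate * c \<le> D" "exp (h x) * c \<le> D" "1 + exp (h x) * c \<le> D"
  proof -
    have "1 \<le> c * exp (h x)" using mult_mono[of 1 c 1 "exp (h x)"] c h_nonneg[of x] by simp
    moreover have "2 * (c * exp (h x)) \<le> exp 1 * (c * exp (h x))"
      using exp_ge_add_one_self[of 1] c by (intro mult_right_mono) auto
    ultimately show 1: "1 + exp (h x) * c \<le> c * exp (h x + 1)" by (simp add: exp_add mult_ac)
    have "c * exp (h x + 1) \<le> D" unfolding D_def using c rate0 by (intro mult_left_mono) auto
    with 1 show 2: "1 + exp (h x) * c \<le> D" by simp
    then show "exp (h x) * c \<le> D" by simp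
    have "c * exp (h x + rate) \<le> D" unfolding D_def using c by (intro mult_left_mono) auto
    then show "exp (h x) * exp rate * c \<le> D" by (simp add: exp_add mult_ac)
  qed
  have "x \<in> regular D"
    unfolding regular_def
  proof (intro CollectI conjI allI ballI x)
    fix m w s assume ws: "w \<in> Eu ((g ^^ m) x)" "s \<in> Es x"
    have "norm w \<le> (exp (h x) * c) * (exp (- rate * m) * norm (act f A ((g ^^ m) x) m w + s))"
      using un'[OF ws] by (simp add: mult_ac)
    also have "\<dots> \<le> D * (exp (- rate * m) * norm (act f A ((g ^^ m) x) m w + s))"
      by (intro mult_right_mono e) auto
    finally show "norm w \<le> D * exp (- rate * m) * norm (act f A ((g ^^ m) x) m w + s)" by simp
  next
    fix m s u assume su: "s \<in> Es x" "u \<in> Eu x"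
    show "norm (act f A x m s) \<le> D * exp (- rate * m) * norm (s + u)"
    proof (cases m)
      case 0
      \<comment> \<open>The stable component is bounded through the unstable one: \<open>A x\<close>
        may annihilate stable vectors, and then the stable bound at \<open>f x\<close> carries no
        information about them.\<close>
      have "norm u \<le> c * exp (h x) * norm (s + u)" using un'[of u 0 s] su by (simp add: add.commute)
      then have "norm s \<le> (1 + exp (h x) * c) * norm (s + u)"
        using norm_triangle_ineq4[of "s + u" u] by (simp add: algebra_simps)
      also have "\<dots> \<le> D * norm (s + u)" by (intro mult_right_mono e) auto
      finally show ?thesis using 0 by simp
    next
      case (Suc n)
      have "norm (act f A x m s) \<le> c * exp (- rate * n) * norm (A x *v s + A x *v u)"
        unfolding Suc act_Suc' using Eu_invariant su by (intro st Es_invariant) auto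
      also have "A x *v s + A x *v u = A x *v (s + u)" by (simp add: matrix_vector_right_distrib)
      also have "c * exp (- rate * n) * norm \<dots> \<le> c * exp (- rate * n) * (exp (h x) * norm (s + u))"
        using c by (intro mult_left_mono norm_A_le) auto
      also have "\<dots> = (exp (h x) * exp rate * c) * (exp (- rate * m) * norm (s + u))"
        unfolding Suc by (simp add: algebra_simps flip: exp_add)
      also have "\<dots> \<le> D * (exp (- rate * m) * norm (s + u))" by (intro mult_right_mono e) auto
      finally show ?thesis by simp
    qed
  qed
  then show ?thesis by (simp add: D_def)
qed

lemma regular_iterate:
  assumes c: "1 \<le> c" and "(f ^^ j) x \<in> regular c"
  shows "x \<in> regular (c * exp (birkhoff_sum f (\<lambda>x. h x + rate + 1) j x))"
  using assms(2)
proof (induction j arbitrary: x)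
  case 0
  then show ?case by (simp add: birkhoff_sum_def)
next
  case (Suc j)
  have rate0: "0 \<le> rate" using lam_pos by (simp add: rate_def)
  let ?S = "birkhoff_sum f (\<lambda>x. h x + rate + 1) j (f x)"
  have "f x \<in> regular (c * exp ?S)" using Suc.prems by (intro Suc.IH) (simp add: funpow_swap1)
  moreover have "0 \<le> ?S" unfolding birkhoff_sum_def using rate0 h_nonneg by (intro sum_nonneg) auto
  then have "1 \<le> c * exp ?S" using mult_mono[of 1 c 1 "exp ?S"] c by simp
  ultimately have "x \<in> regular (c * exp ?S * exp (h x + rate + 1))" by (rule regular_step[rotated])
  then show ?case by (simp add: birkhoff_sum_Suc exp_add mult_ac)
qed

text \<open>Towards the past the constant grows at most exponentially because each step costs a bounded
  factor on average. Towards the future one uses that a set \<open>regular c\<close> of measure close to one is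
  visited between the times \<open>n\<close> and \<open>2 n\<close>, and returns from there.\<close>

lemma AE_regular_orbit:
  "AE x in M. \<exists>D\<ge>1. \<exists>\<epsilon>\<ge>0. \<forall>n. (f ^^ n) x \<in> regular (D * exp (\<epsilon> * n)) \<and> (g ^^ n) x \<in> regular (D * exp (\<epsilon> * n))"
proof -
  define w where "w x = h x + rate + 1" for x
  have rate0: "0 \<le> rate" using lam_pos by (simp add: rate_def)
  have w: "integrable M w" "0 \<le> w x" for x
    unfolding w_def using h_integrable h_nonneg rate0 by (auto intro!: add_nonneg_nonneg)
  \<comment> \<open>The shift by 1 meets the premise \<open>1 \<le> c\<close> of
    \<open>regular_iterate\<close>.\<close>
  define B where "B c = space M - regular (real c + 1)" for c :: nat
  have "AE x in M. \<exists>c. \<forall>n. birkhoff_sum f (\<lambda>y. 1 * indicator (B c) y) n x \<le> 1 / 3 * real n"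
  proof (rule f.AE_small_birkhoff_sum)
    show "decseq B"
      unfolding decseq_def B_def using regular_mono by (intro allI impI Diff_mono) auto
    show "AE x in M. x \<notin> (\<Inter>c. B c)"
      using AE_regular
    proof eventually_elim
      case (elim x)
      then obtain c :: nat where "x \<in> regular (real c)" by blast
      then have "x \<in> regular (real c + 1)" using regular_mono[of "real c" "real c + 1"] by auto
      then show ?case by (auto simp: B_def)
    qed
  qed (auto simp: B_def)
  moreover have "AE x in M. \<exists>C\<ge>0. \<forall>n. birkhoff_sum f w n x \<le> C * real n"
    by (rule f.AE_linear_birkhoff_sum[OF w])
  moreover have "AE x in M. \<exists>C\<ge>0. \<forall>n. birkhoff_sum g w n x \<le> C * real n"
    by (rule g.AE_linear_birkhoff_sum[OF w])
  ultimately show ?thesis using AE_regular AE_space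
  proof eventually_elim
    case (elim x)
    obtain c :: nat where c: "\<And>n. birkhoff_sum f (\<lambda>y. indicator (B c) y) n x \<le> 1 / 3 * real n"
      using elim(1) by auto
    obtain C1 where C1: "0 \<le> C1" "\<And>n. birkhoff_sum f w n x \<le> C1 * real n" using elim(2) by auto
    obtain C2 where C2: "0 \<le> C2" "\<And>n. birkhoff_sum g w n x \<le> C2 * real n" using elim(3) by auto
    obtain b :: nat where b: "x \<in> regular (real b)" using elim(4) by blast
    have orbit: "(f ^^ n) x \<in> space M" for n
      using measurable_space[OF f.funpow_measurable elim(5)] .
    \<comment> \<open>In \<open>\<epsilon>\<close> below, \<open>2 * C1\<close> pays for looking
      ahead up to time \<open>2 * n\<close> and \<open>C2\<close> for the way through the past; the
      offset in \<open>C2 * (n + 1)\<close> goes into \<open>D\<close>.\<close>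
    define D where "D = max (real c + 1) (real b + 1) * exp (C1 + C2)"
    define \<epsilon> where "\<epsilon> = 2 * C1 + C2"
    have D: "max (real c + 1) (real b + 1) * exp (C1 + C2) \<le> D" by (simp add: D_def)
    have forward: "(f ^^ n) x \<in> regular (D * exp (\<epsilon> * n))" for n
    proof -
      \<comment> \<open>Otherwise all \<open>n + 1\<close> times from \<open>n\<close> to
        \<open>2 * n\<close> would be bad, more than the allowed third of
        \<open>2 * n + 1\<close>.\<close>
      have "\<exists>j\<le>n. (f ^^ (n + j)) x \<in> regular (real c + 1)"
      proof (rule ccontr)
        assume "\<not> ?thesis"
        then have bad: "(f ^^ t) x \<in> B c" if "t \<in> {n..2 * n}" for t
          using that orbit le_Suc_ex[of n t] unfolding B_def by auto
        have "real (n + 1) = (\<Sum>t\<in>{n..2 * n}. indicator (B c) ((f ^^ t) x))"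
          using bad by (simp add: indicator_def)
        also have "\<dots> \<le> birkhoff_sum f (\<lambda>y. indicator (B c) y) (2 * n + 1) x"
          unfolding birkhoff_sum_def by (rule sum_mono2) auto
        also have "\<dots> \<le> 1 / 3 * real (2 * n + 1)" by (rule c)
        finally show False by simp
      qed
      then obtain j where j: "j \<le> n" "(f ^^ j) ((f ^^ n) x) \<in> regular (real c + 1)"
        by (auto simp: funpow_add add.commute[of n])
      have "(f ^^ n) x \<in> regular ((real c + 1) * exp (birkhoff_sum f w j ((f ^^ n) x)))"
        unfolding w_def by (rule regular_iterate[OF _ j(2)]) simp
      moreover have "(real c + 1) * exp (birkhoff_sum f w j ((f ^^ n) x)) \<le> D * exp (\<epsilon> * n)"
      proof (rule mult_mono)
        have "birkhoff_sum f w (n + j) x = birkhoff_sum f w n x + birkhoff_sum f w j ((f ^^ n) x)"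
          by (rule birkhoff_sum_add)
        then have "birkhoff_sum f w j ((f ^^ n) x) \<le> birkhoff_sum f w (n + j) x"
          unfolding birkhoff_sum_def using w(2) by (simp add: sum_nonneg)
        also have "\<dots> \<le> C1 * real (n + j)" by (rule C1)
        also have "\<dots> \<le> C1 * (2 * real n)" using j C1 by (intro mult_left_mono) auto
        also have "\<dots> \<le> \<epsilon> * n" using C2 by (simp add: \<epsilon>_def algebra_simps)
        finally show "exp (birkhoff_sum f w j ((f ^^ n) x)) \<le> exp (\<epsilon> * n)" by simp
        have "(real c + 1) * 1 \<le> D" unfolding D_def using C1 C2 by (intro mult_mono) auto
        then show "real c + 1 \<le> D" by simp
      qed (auto simp: D_def)
      ultimately show ?thesis using regular_mono by blast
    qed
    have backward: "(g ^^ n) x \<in> regular (D * exp (\<epsilon> * n))" for n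
    proof -
      have "(f ^^ n) ((g ^^ n) x) \<in> regular (real b + 1)"
        using b regular_mono[of "real b" "real b + 1"] by (auto simp: f_funpow_g)
      then have "(g ^^ n) x \<in> regular ((real b + 1) * exp (birkhoff_sum f w n ((g ^^ n) x)))"
        unfolding w_def by (intro regular_iterate) auto
      moreover have "(real b + 1) * exp (birkhoff_sum f w n ((g ^^ n) x)) \<le> D * exp (\<epsilon> * n)"
      proof -
        have "birkhoff_sum f w n ((g ^^ n) x) = (\<Sum>t<n. w ((g ^^ (n - t)) x))"
          unfolding birkhoff_sum_def by (rule sum.cong) (auto simp: f_funpow_g_le)
        also have "\<dots> = (\<Sum>k\<in>{1..n}. w ((g ^^ k) x))"
          by (rule sum.reindex_bij_witness[of _ "\<lambda>k. n - k" "\<lambda>t. n - t"]) auto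
        also have "\<dots> \<le> birkhoff_sum g w (Suc n) x"
          unfolding birkhoff_sum_def by (rule sum_mono2) (use w(2) in auto)
        also have "\<dots> \<le> C2 * real (Suc n)" by (rule C2)
        also have "\<dots> \<le> (C1 + C2) + \<epsilon> * n" using C1 C2 by (simp add: \<epsilon>_def algebra_simps)
        finally have "exp (birkhoff_sum f w n ((g ^^ n) x)) \<le> exp (C1 + C2) * exp (\<epsilon> * n)"
          by (simp flip: exp_add)
        then have "(real b + 1) * exp (birkhoff_sum f w n ((g ^^ n) x))
            \<le> max (real c + 1) (real b + 1) * (exp (C1 + C2) * exp (\<epsilon> * n))"
          by (intro mult_mono) auto
        then show ?thesis by (simp add: D_def mult_ac)
      qed
      ultimately show ?thesis using regular_mono by blast
    qed
    have "1 * 1 \<le> D" unfolding D_def using C1 C2 by (intro mult_mono) auto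
    then show ?case using forward backward C1 C2
      by (intro exI[of _ D] conjI exI[of _ \<epsilon>]) (auto simp: \<epsilon>_def)
  qed
qed

end

section \<open>Projections along the splitting and the dichotomy on an orbit\<close>

context hyperbolic_splitting
begin

definition proj :: "'x \<Rightarrow> real^'d \<Rightarrow> real^'d" where
  "proj y v = (SOME s. s \<in> Es y \<and> v - s \<in> Eu y)"

lemma proj_add: "s \<in> Es y \<Longrightarrow> u \<in> Eu y \<Longrightarrow> proj y (s + u) = s"
  unfolding proj_def
proof (rule some_equality)
  fix s' assume su: "s \<in> Es y" "u \<in> Eu y" "s' \<in> Es y \<and> s + u - s' \<in> Eu y"
  then have "s - s' \<in> Es y" by (intro subspace_diff Es_subspace) auto
  moreover have "s - s' \<in> Eu y"
    using subspace_diff[OF Eu_subspace, of "s + u - s'" y u] su by simp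
  ultimately have "s - s' \<in> {0}" using Es_Int_Eu[of y] by blast
  then show "s' = s" by simp
qed auto

lemma splitE:
  obtains s u where "v = s + u" "s \<in> Es y" "u \<in> Eu y"
  using Es_plus_Eu by blast

lemma proj_idem [simp]: "proj y (proj y v) = proj y v"
proof -
  obtain s u where "v = s + u" "s \<in> Es y" "u \<in> Eu y" by (rule splitE)
  then show ?thesis using proj_add[of s y 0] proj_add[of s y u] subspace_0[OF Eu_subspace] by simp
qed

lemma linear_proj: "linear (proj y)"
proof (rule linearI)
  fix v v' :: "real^'d"
  obtain s u where v: "v = s + u" "s \<in> Es y" "u \<in> Eu y" by (rule splitE)
  obtain s' u' where v': "v' = s' + u'" "s' \<in> Es y" "u' \<in> Eu y" by (rule splitE)
  have "proj y ((s + s') + (u + u')) = s + s'"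
    using v v' by (intro proj_add subspace_add Es_subspace Eu_subspace)
  then show "proj y (v + v') = proj y v + proj y v'"
    using v v' by (simp add: proj_add algebra_simps)
  fix c :: real
  have "proj y (c *\<^sub>R s + c *\<^sub>R u) = c *\<^sub>R s"
    using v by (intro proj_add subspace_scale Es_subspace Eu_subspace)
  then show "proj y (c *\<^sub>R v) = c *\<^sub>R proj y v"
    using v by (simp add: proj_add scaleR_add_right)
qed

lemma kernel_proj: "kernel (proj y) = Eu y"
proof (intro equalityI subsetI)
  fix v assume "v \<in> kernel (proj y)"
  moreover obtain s u where "v = s + u" "s \<in> Es y" "u \<in> Eu y" by (rule splitE)
  ultimately show "v \<in> Eu y" by (simp add: kernel_def proj_add)
next
  fix v assume "v \<in> Eu y"
  then show "v \<in> kernel (proj y)"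
    using proj_add[of 0 y v] subspace_0[OF Es_subspace] by (simp add: kernel_def)
qed

lemma inv_f: "inv f = g"
  by (rule inv_equality) (auto simp: fg gf)

lemma int_iterate_add: "int_iterate f (n + int j) x = (f ^^ j) (int_iterate f n x)"
proof (cases "n \<ge> 0")
  case True
  then have "nat (n + int j) = nat n + j" by simp
  then show ?thesis using True by (simp add: int_iterate_def funpow_add add.commute)
next
  case False
  define i where "i = nat (- n)"
  have n: "n = - int i" "i > 0" using False by (auto simp: i_def)
  show ?thesis
  proof (cases "i \<le> j")
    case True
    have "(f ^^ j) ((g ^^ i) x) = (f ^^ (j - i)) ((f ^^ i) ((g ^^ i) x))"
      using True by (simp flip: funpow_add[unfolded comp_def, THEN fun_cong])
    then show ?thesis using True n by (simp add: int_iterate_def inv_f f_funpow_g nat_diff_distrib')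
  next
    case False
    then show ?thesis using n f_funpow_g_le[of j i x] by (simp add: int_iterate_def inv_f nat_diff_distrib')
  qed
qed

lemma int_iterate_diff: "(g ^^ j) (int_iterate f n x) = int_iterate f (n - int j) x"
proof -
  have gf': "(g ^^ j) ((f ^^ j) y) = y" for y
    by (induction j arbitrary: y) (auto simp: gf funpow_swap1)
  show ?thesis using int_iterate_add[of "n - int j" j x] gf' by simp
qed

text \<open>\<open>regular\<close> at the orbit point of time \<open>n\<close> contains all bounds
  with base time \<open>n\<close>, in both directions; the growth of its constant along the orbit
  becomes the nonuniform factor.\<close>

lemma dichotomy_of_regular_orbit:
  assumes x: "x \<in> X" and D: "1 \<le> D" and \<epsilon>: "0 \<le> \<epsilon>"
    and reg: "\<And>n. (f ^^ n) x \<in> regular (D * exp (\<epsilon> * real n))"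
      "\<And>n. (g ^^ n) x \<in> regular (D * exp (\<epsilon> * real n))"
  shows "nonuniform_exponential_dichotomy (\<lambda>n v. A (int_iterate f n x) *v v)"
proof -
  define z where "z n = int_iterate f n x" for n
  define L where "L n v = A (z n) *v v" for n v
  define P where "P n = proj (z n)" for n
  have z_Suc: "z (n + 1) = f (z n)" for n using int_iterate_add[of n 1 x] by (simp add: z_def)
  have zX: "z n \<in> X" for n using x by (simp add: z_def int_iterate_def inv_f)
  have zreg: "z n \<in> regular (D * exp (\<epsilon> * real_of_int \<bar>n\<bar>))" for n
    using reg(1)[of "nat n"] reg(2)[of "nat (- n)"] by (auto simp: z_def int_iterate_def inv_f)
  have fwd: "forward_evolution L n j = act f A (z n) j" for n j
  proof (induction j)
    case (Suc j)
    have "z (n + int j) = (f ^^ j) (z n)" unfolding z_def by (rule int_iterate_add)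
    then show ?case using Suc by (auto simp: L_def act_Suc simp del: cocycle.simps(2))
  qed auto
  have split: "\<exists>s u. v = s + u \<and> s \<in> Es (z n) \<and> u \<in> Eu (z n) \<and> P n v = s" for n v
    using splitE[of v "z n"] proj_add unfolding P_def by metis
  have ker: "kernel (P n) = Eu (z n)" for n by (simp add: P_def kernel_proj)
  have stable_bound: "norm (act f A (z n) j s) \<le> D * exp (- rate * j + \<epsilon> * real_of_int \<bar>n\<bar>) * norm (s + u)"
    if "s \<in> Es (z n)" "u \<in> Eu (z n)" for n j s u
  proof -
    have "norm (act f A (z n) j s) \<le> (D * exp (\<epsilon> * real_of_int \<bar>n\<bar>)) * exp (- rate * j) * norm (s + u)"
      using zreg[of n] that unfolding regular_def by blast
    then show ?thesis by (simp add: exp_add mult_ac exp_diff exp_minus divide_inverse)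
  qed
  have unstable_bound: "norm w \<le> D * exp (- rate * j + \<epsilon> * real_of_int \<bar>n\<bar>) * norm (act f A (z (n - int j)) j w + s)"
    if "w \<in> Eu (z (n - int j))" "s \<in> Es (z n)" for n j w s
  proof -
    have "(g ^^ j) (z n) = z (n - int j)" unfolding z_def by (rule int_iterate_diff)
    then have "norm w \<le> (D * exp (\<epsilon> * real_of_int \<bar>n\<bar>)) * exp (- rate * j) * norm (act f A (z (n - int j)) j w + s)"
      using zreg[of n] that unfolding regular_def by (smt (verit) mem_Collect_eq)
    then show ?thesis by (simp add: exp_add mult_ac exp_diff exp_minus divide_inverse)
  qed
  have algebra: "\<forall>n. linear (L n)" "\<forall>n. linear (P n) \<and> P n \<circ> P n = P n"
    "\<forall>n. L n \<circ> P n = P (n + 1) \<circ> L n" "\<forall>n. bij_betw (L n) (kernel (P n)) (kernel (P (n + 1)))"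
  proof (safe)
    show "linear (L n)" for n unfolding L_def by simp
    show "linear (P n)" for n unfolding P_def by (rule linear_proj)
    show "P n \<circ> P n = P n" for n by (auto simp: P_def)
    show "L n \<circ> P n = P (n + 1) \<circ> L n" for n
    proof
      fix v
      obtain s u where v: "v = s + u" "s \<in> Es (z n)" "u \<in> Eu (z n)" "P n v = s" using split by blast
      have "P (n + 1) (A (z n) *v s + A (z n) *v u) = A (z n) *v s"
        unfolding P_def z_Suc using v Eu_invariant by (intro proj_add Es_invariant) auto
      then show "(L n \<circ> P n) v = (P (n + 1) \<circ> L n) v"
        using v by (simp add: L_def matrix_vector_right_distrib)
    qed
    show "bij_betw (L n) (kernel (P n)) (kernel (P (n + 1)))" for n
      unfolding ker bij_betw_def
    proof
      have "inj_on (\<lambda>v. A (z n) *v v) (Eu (z n))"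
      proof (rule inj_onI)
        fix v w assume vw: "v \<in> Eu (z n)" "w \<in> Eu (z n)" "A (z n) *v v = A (z n) *v w"
        then have "v - w \<in> Eu (z n)" "act f A (z n) 1 (v - w) = 0"
          by (auto intro: subspace_diff Eu_subspace simp: matrix_vector_mult_diff_distrib)
        then have "v - w = 0" using act_Eu_inj zX by blast
        then show "v = w" by simp
      qed
      then show "inj_on (L n) (Eu (z n))" unfolding L_def .
      show "L n ` Eu (z n) = Eu (z (n + 1))" unfolding L_def z_Suc by (rule Eu_invariant)
    qed
  qed
  have forward: "\<forall>m n. n \<le> m \<longrightarrow> onorm (evolution L P m n \<circ> P n)
      \<le> D * exp (- rate * real_of_int (m - n) + \<epsilon> * real_of_int \<bar>n\<bar>)"
  proof (intro allI impI)
    fix m n :: int assume mn: "n \<le> m"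
    show "onorm (evolution L P m n \<circ> P n) \<le> D * exp (- rate * real_of_int (m - n) + \<epsilon> * real_of_int \<bar>n\<bar>)"
    proof (rule onorm_bound)
      fix v
      obtain s u where v: "v = s + u" "s \<in> Es (z n)" "u \<in> Eu (z n)" "P n v = s" using split by blast
      have "(evolution L P m n \<circ> P n) v = act f A (z n) (nat (m - n)) s"
        using mn v by (simp add: evolution_def fwd)
      then show "norm ((evolution L P m n \<circ> P n) v) \<le> D * exp (- rate * real_of_int (m - n) + \<epsilon> * real_of_int \<bar>n\<bar>) * norm v"
        using stable_bound[OF v(2,3), of "nat (m - n)"] v(1) mn by simp
    qed (use D in simp)
  qed
  have backward: "\<forall>m n. m \<le> n \<longrightarrow> onorm (evolution L P m n \<circ> (\<lambda>v. v - P n v))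
      \<le> D * exp (- rate * real_of_int (n - m) + \<epsilon> * real_of_int \<bar>n\<bar>)"
  proof (intro allI impI)
    fix m n :: int assume mn: "m \<le> n"
    show "onorm (evolution L P m n \<circ> (\<lambda>v. v - P n v)) \<le> D * exp (- rate * real_of_int (n - m) + \<epsilon> * real_of_int \<bar>n\<bar>)"
    proof (rule onorm_bound)
      fix v
      obtain s u where v: "v = s + u" "s \<in> Es (z n)" "u \<in> Eu (z n)" "P n v = s" using split by blast
      define j where "j = nat (n - m)"
      have m: "m = n - int j" using mn by (simp add: j_def)
      let ?w = "(evolution L P m n \<circ> (\<lambda>v. v - P n v)) v"
      \<comment> \<open>\<open>?w\<close> is the unstable vector at time \<open>m\<close> that the
        cocycle carries to \<open>u\<close>. For \<open>m = n\<close> the evolution takes its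
        forward branch with zero steps; otherwise a preimage exists because \<open>Eu\<close> is
        mapped onto \<open>Eu\<close>.\<close>
      have "?w \<in> Eu (z m) \<and> act f A (z m) j ?w = u"
      proof (cases "m = n")
        case True
        then show ?thesis using v m by (simp add: evolution_def)
      next
        case False
        then have w: "?w = inv_into (Eu (z m)) (act f A (z m) j) u"
          using v mn by (simp add: evolution_def fwd ker j_def)
        have "z n = (f ^^ j) (z m)" unfolding m z_def using int_iterate_add[of "n - int j" j x] by simp
        then have "u \<in> act f A (z m) j ` Eu (z m)" using v by (simp add: act_Eu)
        then show ?thesis unfolding w by (auto intro: inv_into_into f_inv_into_f)
      qed
      then show "norm ?w \<le> D * exp (- rate * real_of_int (n - m) + \<epsilon> * real_of_int \<bar>n\<bar>) * norm v"
        using unstable_bound[of ?w n j s] v(1,2) m by (simp add: add.commute)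
    qed (use D in simp)
  qed
  have "0 < D" "0 < rate" using D lam_pos by (simp_all add: rate_def)
  with algebra forward backward \<epsilon> have "nonuniform_exponential_dichotomy L"
    unfolding nonuniform_exponential_dichotomy_def by blast
  then show ?thesis by (simp add: L_def[abs_def] z_def)
qed

lemma AE_dichotomy:
  "AE x in M. nonuniform_exponential_dichotomy (\<lambda>n v. A (int_iterate f n x) *v v)"
  using AE_regular_orbit AE_X by eventually_elim (auto intro: dichotomy_of_regular_orbit)

end

section \<open>Oseledets splittings\<close>

lemma growth_upper:
  assumes lim: "(\<lambda>n. ereal (1 / real n) * elog (a n)) \<longlonglongrightarrow> l" and r: "l < ereal r"
  shows "\<forall>\<^sub>F n in sequentially. a n \<le> exp (r * real n)"
  using order_tendstoD(2)[OF lim r] eventually_gt_at_top[of 0]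
proof eventually_elim
  case (elim n)
  show ?case
  proof (cases "a n \<le> 0")
    case True
    then show ?thesis using exp_ge_zero order_trans by blast
  next
    case False
    then have "ln (a n) / n < r" using elim by (simp add: elog_def)
    then have "ln (a n) \<le> r * n" using elim by (simp add: field_simps)
    then have "exp (ln (a n)) \<le> exp (r * n)" by simp
    then show ?thesis using False by simp
  qed
qed

lemma growth_lower:
  assumes lim: "(\<lambda>n. ereal (1 / real n) * elog (a n)) \<longlonglongrightarrow> l" and r: "ereal r < l"
  shows "\<forall>\<^sub>F n in sequentially. exp (r * real n) < a n"
  using order_tendstoD(1)[OF lim r] eventually_gt_at_top[of 0]
proof eventually_elim
  case (elim n)
  show ?case
  proof (cases "a n \<le> 0")
    case True
    then show ?thesis using elim by (simp add: elog_def)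
  next
    case False
    then have "r < ln (a n) / n" using elim by (simp add: elog_def)
    then have "r * n < ln (a n)" using elim by (simp add: field_simps)
    then have "exp (r * n) < exp (ln (a n))" by simp
    then show ?thesis using False by simp
  qed
qed

text \<open>It separates a dominant exponent \<open>b\<close> from the smaller ones; including
  \<open>ereal l\<close> in the maximum covers an empty \<open>S\<close> and keeps \<open>r\<close>
  above \<open>l\<close>.\<close>

lemma ereal_gap:
  assumes "finite S" "\<And>i. i \<in> S \<Longrightarrow> (a i :: ereal) < b" "ereal l < b"
  shows "\<exists>r. l < r \<and> ereal r < b \<and> (\<forall>i\<in>S. a i < ereal r)"
proof -
  define m where "m = Max (insert (ereal l) (a ` S))"
  have "m < b" unfolding m_def using assms by (subst Max_less_iff) auto
  then obtain r where r: "m < ereal r" "ereal r < b" using ereal_dense2 by blast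
  have "ereal l \<le> m" "\<And>i. i \<in> S \<Longrightarrow> a i \<le> m" unfolding m_def using assms by auto
  then have "ereal l < ereal r" "\<And>i. i \<in> S \<Longrightarrow> a i < ereal r" using r(1) le_less_trans by blast+
  then show ?thesis using r(2) by auto
qed

lemma spectral_gap_at_zero:
  assumes "finite I" "\<And>i. i \<in> I \<Longrightarrow> (lam i :: ereal) \<noteq> 0"
  shows "\<exists>l>0. \<forall>i\<in>I. (lam i < 0 \<longrightarrow> lam i < ereal (- l)) \<and> (0 < lam i \<longrightarrow> ereal l < lam i)"
  using assms
proof (induction I rule: finite_induct)
  case empty
  show ?case by (intro exI[of _ 1]) auto
next
  case (insert j I)
  then obtain l where l: "0 < l" "\<And>i. i \<in> I \<Longrightarrow> lam i < 0 \<Longrightarrow> lam i < ereal (- l)"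
    "\<And>i. i \<in> I \<Longrightarrow> 0 < lam i \<Longrightarrow> ereal l < lam i" by blast
  have "\<exists>r>0. (lam j < 0 \<longrightarrow> lam j < ereal (- r)) \<and> (0 < lam j \<longrightarrow> ereal r < lam j)"
  proof (cases "lam j < 0")
    case True
    then obtain r where "lam j < ereal r" "ereal r < 0" using ereal_dense2 by blast
    then show ?thesis using True by (intro exI[of _ "- r"]) auto
  next
    case False
    then have "0 < lam j" using insert.prems[of j] by (simp add: less_le)
    then obtain r where "ereal r < lam j" "0 < ereal r" using ereal_dense2 by blast
    then show ?thesis using False by (intro exI[of _ r]) auto
  qed
  then obtain r where r: "0 < r" "lam j < 0 \<Longrightarrow> lam j < ereal (- r)" "0 < lam j \<Longrightarrow> ereal r < lam j" by blast
  show ?case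
  proof (intro exI[of _ "min l r"] conjI ballI impI)
    fix i assume i: "i \<in> insert j I"
    have m: "ereal (- l) \<le> ereal (- min l r)" "ereal (- r) \<le> ereal (- min l r)"
      "ereal (min l r) \<le> ereal l" "ereal (min l r) \<le> ereal r" by auto
    show "lam i < ereal (- min l r)" if "lam i < 0"
      using i l(2)[of i] r(2) m that less_le_trans by blast
    show "ereal (min l r) < lam i" if "0 < lam i"
      using i l(3)[of i] r(3) m that le_less_trans by blast
  qed (use l r in auto)
qed

text \<open>The body has the shape of \<open>measurable_multifunction_sum\<close>, so that
  measurability follows by unfolding. For empty \<open>J\<close> it is the zero space, which covers
  spectra of one sign.\<close>

definition partial_sum :: "'i set \<Rightarrow> ('i \<Rightarrow> 'v::real_vector set) \<Rightarrow> 'v set" where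
  "partial_sum J E = {\<Sum>i\<in>J. w i |w. \<forall>i\<in>J. w i \<in> E i}"

lemma subspace_partial_sum:
  assumes "\<And>i. i \<in> J \<Longrightarrow> subspace (E i)" shows "subspace (partial_sum J E)"
  unfolding subspace_def
proof (intro conjI ballI allI)
  have "(\<Sum>i\<in>J. 0) \<in> partial_sum J E"
    unfolding partial_sum_def using assms subspace_0 by blast
  then show "0 \<in> partial_sum J E" by simp
next
  fix v v' assume "v \<in> partial_sum J E" "v' \<in> partial_sum J E"
  then obtain w w' where "v = (\<Sum>i\<in>J. w i)" "v' = (\<Sum>i\<in>J. w' i)" and w: "\<forall>i\<in>J. w i \<in> E i" "\<forall>i\<in>J. w' i \<in> E i"
    unfolding partial_sum_def by blast
  then have "v + v' = (\<Sum>i\<in>J. w i + w' i)" by (simp add: sum.distrib)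
  moreover have "\<forall>i\<in>J. w i + w' i \<in> E i" using w assms subspace_add by blast
  ultimately show "v + v' \<in> partial_sum J E" unfolding partial_sum_def by blast
next
  fix c v assume "v \<in> partial_sum J E"
  then obtain w where "v = (\<Sum>i\<in>J. w i)" and w: "\<forall>i\<in>J. w i \<in> E i"
    unfolding partial_sum_def by blast
  then have "c *\<^sub>R v = (\<Sum>i\<in>J. c *\<^sub>R w i)" by (simp add: scaleR_sum_right)
  moreover have "\<forall>i\<in>J. c *\<^sub>R w i \<in> E i" using w assms subspace_scale by blast
  ultimately show "c *\<^sub>R v \<in> partial_sum J E" unfolding partial_sum_def by blast
qed

lemma partial_sum_image_subset:
  assumes "linear T" "\<And>i. i \<in> J \<Longrightarrow> T ` E i \<subseteq> F i"
  shows "T ` partial_sum J E \<subseteq> partial_sum J F"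
proof
  fix v assume "v \<in> T ` partial_sum J E"
  then obtain w where "v = T (\<Sum>i\<in>J. w i)" and w: "\<forall>i\<in>J. w i \<in> E i" unfolding partial_sum_def by blast
  then have "v = (\<Sum>i\<in>J. T (w i))" using linear_sum[OF assms(1)] by auto
  moreover have "\<forall>i\<in>J. T (w i) \<in> F i" using w assms(2) by blast
  ultimately show "v \<in> partial_sum J F" unfolding partial_sum_def by blast
qed

lemma partial_sum_image:
  assumes T: "linear T" and E: "\<And>i. i \<in> J \<Longrightarrow> T ` E i = F i"
  shows "T ` partial_sum J E = partial_sum J F"
proof
  show "T ` partial_sum J E \<subseteq> partial_sum J F" using assms by (intro partial_sum_image_subset) auto
  show "partial_sum J F \<subseteq> T ` partial_sum J E"
  proof
    fix v assume "v \<in> partial_sum J F"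
    then obtain w where v: "v = (\<Sum>i\<in>J. w i)" and w: "\<forall>i\<in>J. w i \<in> F i" unfolding partial_sum_def by blast
    have "\<exists>e. e \<in> E i \<and> T e = w i" if "i \<in> J" for i
    proof -
      have "w i \<in> T ` E i" using w E[OF that] that by simp
      then show ?thesis by (metis imageE)
    qed
    then obtain e where e: "\<forall>i\<in>J. e i \<in> E i \<and> T (e i) = w i" by metis
    then have "v = T (\<Sum>i\<in>J. e i)" unfolding v linear_sum[OF T] by (intro sum.cong) auto
    then show "v \<in> T ` partial_sum J E" using e unfolding partial_sum_def by blast
  qed
qed

text \<open>The components of a common vector over \<open>J\<close>, together with the negatives of
  those over \<open>K\<close>, sum to 0; uniqueness of the decomposition of 0 makes them
  vanish.\<close>

lemma direct_sum_Int:
  assumes D: "direct_sum_decomposition I E" and I: "finite I" "I = J \<union> K" "J \<inter> K = {}"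
  shows "partial_sum J E \<inter> partial_sum K E = {0}"
proof -
  have sub: "\<And>i. i \<in> I \<Longrightarrow> subspace (E i)" using D by (simp add: direct_sum_decomposition_def)
  have "v = 0" if v: "v \<in> partial_sum J E" "v \<in> partial_sum K E" for v
  proof -
    obtain a b where ab: "v = (\<Sum>i\<in>J. a i)" "\<forall>i\<in>J. a i \<in> E i" "v = (\<Sum>i\<in>K. b i)" "\<forall>i\<in>K. b i \<in> E i"
      using v unfolding partial_sum_def by blast
    define w where "w = (\<lambda>i\<in>I. if i \<in> J then a i else - b i)"
    have fin: "finite J" "finite K" using I by auto
    have "(\<Sum>i\<in>I. w i) = (\<Sum>i\<in>J. w i) + (\<Sum>i\<in>K. w i)"
      unfolding I(2) using fin I(3) by (rule sum.union_disjoint)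
    also have "(\<Sum>i\<in>J. w i) = v" unfolding ab(1) w_def I(2) by (rule sum.cong) auto
    also have "(\<Sum>i\<in>K. w i) = (\<Sum>i\<in>K. - b i)" unfolding w_def using I by (intro sum.cong) auto
    also have "\<dots> = - v" unfolding ab(3) by (simp add: sum_negf)
    finally have "0 = (\<Sum>i\<in>I. w i)" by simp
    moreover have "w \<in> Pi\<^sub>E I E"
      unfolding w_def using ab I sub by (auto simp: subspace_neg)
    moreover have "0 = (\<Sum>i\<in>I. (\<lambda>i\<in>I. 0) i)" by simp
    moreover have "(\<lambda>i\<in>I. 0) \<in> Pi\<^sub>E I E" using sub subspace_0 by auto
    ultimately have "w = (\<lambda>i\<in>I. 0)"
      using D unfolding direct_sum_decomposition_def by blast
    then have "a i = 0" if "i \<in> J" for i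
      using that I(2) unfolding w_def by (metis (mono_tags, lifting) UnI1 restrict_apply')
    then show "v = 0" using ab(1) by simp
  qed
  moreover have "0 \<in> partial_sum J E" "0 \<in> partial_sum K E"
    using sub I by (auto intro!: subspace_0 subspace_partial_sum)
  ultimately show ?thesis by blast
qed

lemma direct_sum_plus:
  assumes D: "direct_sum_decomposition I E" and I: "finite I" "I = J \<union> K" "J \<inter> K = {}"
  shows "\<exists>s\<in>partial_sum J E. \<exists>u\<in>partial_sum K E. v = s + u"
proof -
  obtain w where w: "w \<in> Pi\<^sub>E I E" "v = (\<Sum>i\<in>I. w i)"
    using D unfolding direct_sum_decomposition_def by blast
  have "v = (\<Sum>i\<in>J. w i) + (\<Sum>i\<in>K. w i)"
    unfolding w(2) I(2) using I by (intro sum.union_disjoint) auto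
  moreover have "(\<Sum>i\<in>J. w i) \<in> partial_sum J E" "(\<Sum>i\<in>K. w i) \<in> partial_sum K E"
    unfolding partial_sum_def using w(1) I(2) by blast+
  ultimately show ?thesis by blast
qed

lemma partial_sum_decay:
  fixes T :: "nat \<Rightarrow> 'a::real_normed_vector \<Rightarrow> 'b::real_normed_vector"
  assumes J: "finite J" and T: "\<And>n. linear (T n)"
    and rate: "\<And>i v. i \<in> J \<Longrightarrow> v \<in> E i - {0} \<Longrightarrow>
       (\<lambda>n. ereal (1 / real n) * elog (norm (T n v))) \<longlonglongrightarrow> lam i"
    and l: "\<And>i. i \<in> J \<Longrightarrow> lam i < ereal (- l)"
    and s: "s \<in> partial_sum J E"
  shows "\<exists>C. \<forall>n. norm (T n s) \<le> C * exp (- l * real n)"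
proof -
  have decay: "\<exists>C. \<forall>n. norm (T n v) \<le> C * exp (- l * real n)" if i: "i \<in> J" "v \<in> E i" for i v
  proof (cases "v = 0")
    case True
    then show ?thesis using linear_0[OF T] by (intro exI[of _ 0]) simp
  next
    case False
    then have "(\<lambda>n. ereal (1 / real n) * elog (norm (T n v))) \<longlonglongrightarrow> lam i" using i by (intro rate) auto
    from growth_upper[OF this l[OF i(1)]] obtain N
      where N: "\<And>n. N \<le> n \<Longrightarrow> norm (T n v) \<le> exp (- l * real n)"
      unfolding eventually_sequentially by auto
    \<comment> \<open>The sum covers the finitely many early times and the summand 1 all later
      ones.\<close>
    define C where "C = 1 + (\<Sum>n<N. norm (T n v) * exp (l * real n))"
    have "norm (T n v) \<le> C * exp (- l * real n)" for n
    proof (cases "n < N")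
      case True
      have "norm (T n v) * exp (l * real n) \<le> C"
        unfolding C_def using True member_le_sum[where i=n and A="{..<N}" and f="\<lambda>n. norm (T n v) * exp (l * real n)"] by simp
      then show ?thesis by (simp add: exp_minus field_simps)
    next
      case False
      have "norm (T n v) \<le> 1 * exp (- l * real n)" using N False by simp
      also have "\<dots> \<le> C * exp (- l * real n)"
        unfolding C_def by (intro mult_right_mono) (auto intro: sum_nonneg)
      finally show ?thesis .
    qed
    then show ?thesis by blast
  qed
  obtain w where w: "s = (\<Sum>i\<in>J. w i)" "\<forall>i\<in>J. w i \<in> E i" using s unfolding partial_sum_def by blast
  then have "\<forall>i\<in>J. \<exists>C. \<forall>n. norm (T n (w i)) \<le> C * exp (- l * real n)" using decay by blast
  then obtain C where C: "\<And>i n. i \<in> J \<Longrightarrow> norm (T n (w i)) \<le> C i * exp (- l * real n)" by metis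
  have "norm (T n s) \<le> (\<Sum>i\<in>J. C i) * exp (- l * real n)" for n
    unfolding w(1) linear_sum[OF T] sum_distrib_right by (rule sum_norm_le) (rule C)
  then show ?thesis by blast
qed

text \<open>By strict monotonicity the nonzero component of largest index has the strictly largest
  exponent, so the others cannot cancel it. Two rates \<open>r1 < r2\<close> below that exponent
  leave a factor that absorbs the number of the other components and \<open>norm u\<close>.\<close>

lemma partial_sum_growth:
  fixes T :: "nat \<Rightarrow> 'a::real_normed_vector \<Rightarrow> 'b::real_normed_vector" and lam :: "'i::linorder \<Rightarrow> ereal"
  assumes J: "finite J" and T: "\<And>n. linear (T n)"
    and rate: "\<And>i v. i \<in> J \<Longrightarrow> v \<in> E i - {0} \<Longrightarrow>
       (\<lambda>n. ereal (1 / real n) * elog (norm (T n v))) \<longlonglongrightarrow> lam i"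
    and mono: "strict_mono_on J lam"
    and l: "\<And>i. i \<in> J \<Longrightarrow> ereal l < lam i"
    and u: "u \<in> partial_sum J E" "u \<noteq> 0"
  shows "\<exists>N. \<forall>n\<ge>N. norm (T n u) > exp (l * real n) * norm u"
proof -
  obtain w where w: "u = (\<Sum>i\<in>J. w i)" "\<forall>i\<in>J. w i \<in> E i" using u unfolding partial_sum_def by blast
  define S where "S = {i \<in> J. w i \<noteq> 0}"
  have S: "finite S" "S \<noteq> {}"
  proof -
    show "S \<noteq> {}"
    proof
      assume "S = {}"
      then have "\<forall>i\<in>J. w i = 0" by (auto simp: S_def)
      then show False using u(2) w(1) by simp
    qed
  qed (use J in \<open>simp add: S_def\<close>)
  define j where "j = Max S"
  have j: "j \<in> S" "\<And>i. i \<in> S \<Longrightarrow> i \<le> j" unfolding j_def using S by auto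
  define S' where "S' = S - {j}"
  have less: "lam i < lam j" if "i \<in> S'" for i
    using that j mono unfolding S'_def S_def strict_mono_on_def by (auto simp: less_le)
  obtain r1 where r1: "l < r1" "ereal r1 < lam j" "\<And>i. i \<in> S' \<Longrightarrow> lam i < ereal r1"
    using ereal_gap[of S' lam "lam j" l] less l j S by (auto simp: S'_def S_def)
  obtain r2 where r2: "ereal r1 < ereal r2" "ereal r2 < lam j" using ereal_dense2[OF r1(2)] by auto
  have "\<forall>\<^sub>F n in sequentially. \<forall>i\<in>S'. norm (T n (w i)) \<le> exp (r1 * real n)"
  proof (rule eventually_ball_finite)
    show "\<forall>i\<in>S'. \<forall>\<^sub>F n in sequentially. norm (T n (w i)) \<le> exp (r1 * real n)"
      using r1(3) w(2) by (auto intro!: growth_upper rate simp: S'_def S_def)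
  qed (use S in \<open>simp add: S'_def\<close>)
  moreover have "\<forall>\<^sub>F n in sequentially. exp (r2 * real n) < norm (T n (w j))"
    using r2(2) w(2) j(1) by (auto intro!: growth_lower rate simp: S_def)
  moreover have "filterlim (\<lambda>n. exp ((r2 - r1) * real n)) at_top sequentially"
  proof -
    have "0 < r2 - r1" using r2(1) by simp
    then show ?thesis by real_asymp
  qed
  then have "\<forall>\<^sub>F n in sequentially. card S' + norm u < exp ((r2 - r1) * real n)"
    by (auto simp: filterlim_at_top_dense)
  ultimately have "\<forall>\<^sub>F n in sequentially. norm (T n u) > exp (l * real n) * norm u"
  proof eventually_elim
    case (elim n)
    have "u = (\<Sum>i\<in>S. w i)" unfolding w(1) by (rule sum.mono_neutral_right) (use J in \<open>auto simp: S_def\<close>)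
    also have "\<dots> = w j + (\<Sum>i\<in>S'. w i)" unfolding S'_def by (rule sum.remove) (use S j in auto)
    finally have "T n u = T n (w j) + (\<Sum>i\<in>S'. T n (w i))" using linear_add[OF T] linear_sum[OF T] by metis
    then have "norm (T n (w j)) \<le> norm (T n u) + norm (\<Sum>i\<in>S'. T n (w i))"
      by (metis add_diff_cancel_right' norm_triangle_ineq4)
    also have "norm (\<Sum>i\<in>S'. T n (w i)) \<le> (\<Sum>i\<in>S'. exp (r1 * real n))"
      by (rule sum_norm_le) (use elim(1) in auto)
    finally have 1: "exp (r2 * real n) - card S' * exp (r1 * real n) < norm (T n u)" using elim(2) by simp
    have "(card S' + norm u) * exp (r1 * real n) < exp ((r2 - r1) * real n) * exp (r1 * real n)"
      using elim(3) by (rule mult_strict_right_mono) simp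
    also have "\<dots> = exp (r2 * real n)" by (simp add: algebra_simps flip: exp_add)
    finally have "norm u * exp (r1 * real n) < norm (T n u)" using 1 by (simp add: algebra_simps)
    moreover have "exp (l * real n) * norm u \<le> norm u * exp (r1 * real n)"
      using r1(1) by (subst mult.commute) (auto intro!: mult_left_mono mult_right_mono)
    ultimately show ?case by linarith
  qed
  then show ?thesis by (simp add: eventually_sequentially)
qed

text \<open>Each sublevel set is closed, as an intersection of one closed condition per vector.
  Negative \<open>a\<close> is split off because \<open>onorm_bound\<close> asks for a nonnegative
  bound.\<close>

lemma op_norm_measurable [measurable]: "(op_norm :: real^'d^'d \<Rightarrow> real) \<in> borel_measurable borel"
  unfolding borel_measurable_iff_le
proof
  fix a :: real
  have bl: "bounded_linear (\<lambda>v. B *v v)" for B :: "real^'d^'d" by simp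
  have "op_norm B \<le> a \<longleftrightarrow> 0 \<le> a \<and> (\<forall>v. norm (B *v v) \<le> a * norm v)" for B :: "real^'d^'d"
  proof
    assume "op_norm B \<le> a"
    moreover have "norm (B *v v) \<le> op_norm B * norm v" "0 \<le> op_norm B" for v
      unfolding op_norm_def using onorm[OF bl] onorm_pos_le[OF bl] by auto
    ultimately show "0 \<le> a \<and> (\<forall>v. norm (B *v v) \<le> a * norm v)"
      using mult_right_mono[of "op_norm B" a "norm _"] by (meson norm_ge_zero order_trans)
  qed (auto simp: op_norm_def intro: onorm_bound)
  then have "{B \<in> space borel. op_norm B \<le> a}
      = (if 0 \<le> a then (\<Inter>v. {B :: real^'d^'d. norm (B *v v) \<le> a * norm v}) else {})" by auto
  moreover have "closed (\<Inter>v. {B :: real^'d^'d. norm (B *v v) \<le> a * norm v})"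
    by (intro closed_INT ballI closed_Collect_le continuous_intros)
  ultimately show "{B \<in> space borel. (op_norm B :: real) \<le> a} \<in> sets (borel :: (real^'d^'d) measure)"
    by auto
qed

section \<open>From the Oseledets spaces to a hyperbolic splitting\<close>

theorem theorem3:
  fixes M :: "'x::topological_space measure"
    and f :: "'x \<Rightarrow> 'x"
    and A :: "'x \<Rightarrow> real^'d^'d"
    and k :: nat
    and lam :: "nat \<Rightarrow> ereal"
  assumes borel: "sets M = sets borel"
    and ergodic: "ergodic_automorphism M f"
    and A_measurable: "A \<in> borel_measurable M"
    and log_integrable: "(\<integral>\<^sup>+ x. ennreal (log_plus (op_norm (A x))) \<partial>M) < \<infinity>"
    and exponents: "lyapunov_exponents M f A k lam"
    and nonzero: "\<forall>i\<in>{1..k}. lam i \<noteq> 0"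
  shows "\<exists>\<Lambda>\<in>sets borel. emeasure M \<Lambda> = 1 \<and>
           (\<forall>x\<in>\<Lambda>. nonuniform_exponential_dichotomy
              (\<lambda>(n::int) v. A (int_iterate f n x) *v v))"
proof -
  note A_measurable[measurable]
  have space: "space M = UNIV" using sets_eq_imp_space_eq[OF borel] by simp
  interpret prob_space M using ergodic by (simp add: ergodic_automorphism_def)
  define g where "g = inv f"
  have bij: "bij f" and f_meas [measurable]: "f \<in> M \<rightarrow>\<^sub>M M" and g_meas [measurable]: "g \<in> M \<rightarrow>\<^sub>M M"
    and distr_f: "distr M M f = M"
    and erg: "\<And>B. B \<in> sets M \<Longrightarrow> f -` B \<inter> space M = B \<Longrightarrow> prob B = 0 \<or> prob B = 1"
    using ergodic by (auto simp: ergodic_automorphism_def space g_def)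
  have fg: "f (g x) = x" and gf: "g (f x) = x" for x
    using bij by (auto simp: g_def bij_is_surj surj_f_inv_f bij_is_inj)
  have "distr M M g = distr (distr M M f) M g" by (simp only: distr_f)
  also have "\<dots> = distr M M (g \<circ> f)" by (rule distr_distr) auto
  also have "g \<circ> f = (\<lambda>x. x)" using gf by auto
  finally have distr_g: "distr M M g = M" by simp
  interpret f: measure_preserving M f by unfold_locales (auto simp: distr_f)
  interpret g: measure_preserving M g by unfold_locales (auto simp: distr_g)
  define h where "h x = log_plus (op_norm (A x))" for x
  have h_meas [measurable]: "h \<in> borel_measurable M" unfolding h_def log_plus_def by measurable
  have h0: "0 \<le> h x" for x by (simp add: h_def log_plus_def)
  have h_int: "integrable M h"
    using log_integrable h0 unfolding h_def[symmetric] by (intro integrableI_nonneg) auto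
  have norm_A: "norm (A x *v v) \<le> exp (h x) * norm v" for x v
  proof -
    have "norm (A x *v v) \<le> op_norm (A x) * norm v" unfolding op_norm_def by (rule onorm) simp
    also have "\<dots> \<le> exp (h x) * norm v" by (intro mult_right_mono) (auto simp: h_def log_plus_def)
    finally show ?thesis .
  qed
  have mono: "strict_mono_on {1..k} lam" using exponents by (simp add: lyapunov_exponents_def)
  obtain E where E: "oseledets_splitting M f A k lam E"
    using exponents by (auto simp: lyapunov_exponents_def)
  have E_meas: "\<And>i. i \<in> {1..k} \<Longrightarrow> measurable_multifunction M (E i)"
    using E by (simp add: oseledets_splitting_def)
  have E_AE: "AE x in M.
        direct_sum_decomposition {1..k} (\<lambda>i. E i x) \<and>
        (\<forall>i\<in>{1..k}. (\<lambda>v. A x *v v) ` E i x \<subseteq> E i (f x) \<and>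
           (lam i > - \<infinity> \<longrightarrow> (\<lambda>v. A x *v v) ` E i x = E i (f x)) \<and>
           (\<forall>v\<in>E i x - {0}. (\<lambda>n. ereal (1 / real n) * elog (norm (act f A x n v))) \<longlonglongrightarrow> lam i))"
      (is "AE x in M. ?Q x")
    using E[unfolded oseledets_splitting_def, THEN conjunct2] by eventually_elim blast
  obtain N where Q': "\<And>x. x \<in> space M - N \<Longrightarrow> ?Q x" and N: "N \<in> null_sets M"
    by (rule AE_E3[OF E_AE]) (rule that)
  have Q: "?Q x" if "x \<notin> N" for x by (rule Q') (use that space in simp)
  have [measurable]: "N \<in> sets M" using N by auto
  \<comment> \<open>Avoiding \<open>N\<close> along the whole two-sided orbit makes \<open>X\<close>
    exactly invariant, not only up to a null set.\<close>
  define X where "X = {x \<in> space M. \<forall>n. (f ^^ n) x \<notin> N \<and> (g ^^ n) x \<notin> N}"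
  have [measurable]: "X \<in> sets M"
  proof -
    have "X = space M - (\<Union>n. ((f ^^ n) -` N \<inter> space M) \<union> ((g ^^ n) -` N \<inter> space M))" by (auto simp: X_def)
    then show ?thesis by simp
  qed
  have AE_X: "AE x in M. x \<in> X"
    using f.AE_comp_funpow[OF AE_not_in[OF N]] g.AE_comp_funpow[OF AE_not_in[OF N]]
    by eventually_elim (simp add: X_def space)
  have X_inv: "f x \<in> X \<longleftrightarrow> x \<in> X" for x
  proof -
    have f': "(f ^^ n) (f x) = (f ^^ Suc n) x" and g': "(g ^^ Suc n) (f x) = (g ^^ n) x" for n
      by (simp_all add: funpow_swap1 gf)
    show ?thesis
    proof
      assume fx: "f x \<in> X"
      have "(g ^^ n) x \<notin> N" for n using fx unfolding X_def by (simp flip: g' del: funpow.simps)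
      moreover have "(f ^^ n) x \<notin> N" for n
      proof (cases n)
        case 0
        then show ?thesis using \<open>\<And>n. (g ^^ n) x \<notin> N\<close>[of 0] by simp
      next
        case (Suc m)
        then show ?thesis using fx unfolding X_def by (simp flip: f' del: funpow.simps)
      qed
      ultimately show "x \<in> X" by (simp add: X_def space)
    next
      assume x: "x \<in> X"
      have "(f ^^ n) (f x) \<notin> N" for n using x unfolding X_def f' by blast
      moreover have "(g ^^ n) (f x) \<notin> N" for n
      proof (cases n)
        case 0
        then show ?thesis using \<open>\<And>n. (f ^^ n) (f x) \<notin> N\<close>[of 0] by simp
      next
        case (Suc m)
        then show ?thesis using x unfolding X_def Suc g' by blast
      qed
      ultimately show "f x \<in> X" by (simp add: X_def space)
    qed
  qed
  have QX: "?Q x" if "x \<in> X" for x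
  proof -
    have "(f ^^ 0) x \<notin> N" using that unfolding X_def by blast
    then show ?thesis using Q by simp
  qed
  obtain l where l: "0 < l" "\<And>i. i \<in> {1..k} \<Longrightarrow> lam i < 0 \<Longrightarrow> lam i < ereal (- l)"
    "\<And>i. i \<in> {1..k} \<Longrightarrow> 0 < lam i \<Longrightarrow> ereal l < lam i"
    using spectral_gap_at_zero[of "{1..k}" lam] nonzero by auto
  define J where "J = {i \<in> {1..k}. lam i < 0}"
  define K where "K = {i \<in> {1..k}. 0 < lam i}"
  have JK: "{1..k} = J \<union> K" "J \<inter> K = {}" using nonzero by (auto simp: J_def K_def)
  \<comment> \<open>Off \<open>X\<close> the pair of the whole space and the zero space is respected
    by every matrix, so the algebraic conditions hold at all points.\<close>
  define Es where "Es x = (if x \<in> X then partial_sum J (\<lambda>i. E i x) else UNIV)" for x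
  define Eu where "Eu x = (if x \<in> X then partial_sum K (\<lambda>i. E i x) else {0})" for x
  have decomp: "direct_sum_decomposition {1..k} (\<lambda>i. E i x)" if "x \<in> X" for x
    using QX[OF that] by blast
  have sub: "subspace (E i x)" if "x \<in> X" "i \<in> {1..k}" for x i
    using QX[OF that(1)] that(2) by (simp add: direct_sum_decomposition_def)
  interpret hyperbolic_splitting M f g A Es Eu X l h
  proof unfold_locales
    have const: "measurable_multifunction M (\<lambda>x. C)" for C :: "(real^'d) set"
      by (simp add: measurable_multifunction_def)
    show "measurable_multifunction M Es" unfolding Es_def partial_sum_def
      by (intro measurable_multifunction_If measurable_multifunction_sum const E_meas) (auto simp: J_def)
    show "measurable_multifunction M Eu" unfolding Eu_def partial_sum_def
      by (intro measurable_multifunction_If measurable_multifunction_sum const E_meas) (auto simp: K_def)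
    fix x
    show "subspace (Es x)" unfolding Es_def using sub by (auto intro!: subspace_partial_sum simp: J_def)
    show "subspace (Eu x)" unfolding Eu_def using sub by (auto intro!: subspace_partial_sum simp: K_def)
    show "Es x \<inter> Eu x = {0}"
      using direct_sum_Int[OF decomp _ JK, of x] by (cases "x \<in> X") (simp_all add: Es_def Eu_def)
    show "\<exists>s\<in>Es x. \<exists>u\<in>Eu x. v = s + u" for v
      using direct_sum_plus[OF decomp _ JK, of x v] by (cases "x \<in> X") (simp_all add: Es_def Eu_def)
    show "A x *v s \<in> Es (f x)" if "s \<in> Es x" for s
    proof (cases "x \<in> X")
      case True
      have "(\<lambda>v. A x *v v) ` partial_sum J (\<lambda>i. E i x) \<subseteq> partial_sum J (\<lambda>i. E i (f x))"
        using QX[OF True] by (intro partial_sum_image_subset) (auto simp: J_def)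
      then show ?thesis using that True by (auto simp: Es_def X_inv)
    qed (simp add: Es_def X_inv)
    show "(\<lambda>v. A x *v v) ` Eu x = Eu (f x)"
    proof (cases "x \<in> X")
      case True
      have "(\<lambda>v. A x *v v) ` partial_sum K (\<lambda>i. E i x) = partial_sum K (\<lambda>i. E i (f x))"
      proof (rule partial_sum_image)
        fix i assume "i \<in> K"
        \<comment> \<open>A positive exponent exceeds minus infinity, which is the case in which the
          generator maps the Oseledets space onto the next one.\<close>
        then have "i \<in> {1..k}" "- \<infinity> < lam i" by (auto simp: K_def)
        then show "(\<lambda>v. A x *v v) ` E i x = E i (f x)" using QX[OF True] by blast
      qed simp
      then show ?thesis using True by (simp add: Eu_def X_inv)
    qed (simp add: Eu_def X_inv)
    show "\<exists>C. \<forall>n. norm (act f A x n s) \<le> C * exp (- l * real n)" if "x \<in> X" "s \<in> Es x" for s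
    proof (rule partial_sum_decay[where J=J and E="\<lambda>i. E i x" and lam=lam])
      show "lam i < ereal (- l)" if "i \<in> J" for i using that l(2) by (auto simp: J_def)
    qed (use that QX[OF that(1)] in \<open>auto simp: J_def Es_def\<close>)
    show "\<exists>N. \<forall>n\<ge>N. exp (l * real n) * norm u < norm (act f A x n u)"
      if "x \<in> X" "u \<in> Eu x" "u \<noteq> 0" for u
    proof (rule partial_sum_growth[where J=K and E="\<lambda>i. E i x" and lam=lam])
      show "ereal l < lam i" if "i \<in> K" for i using that l(3) by (auto simp: K_def)
      show "strict_mono_on K lam" using mono by (rule monotone_on_subset) (auto simp: K_def)
    qed (use that QX[OF that(1)] in \<open>auto simp: K_def Eu_def\<close>)
  qed (auto simp: fg gf h_int h0 norm_A X_inv l erg intro: AE_X)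
  obtain N' where N': "\<And>x. x \<in> space M - N' \<Longrightarrow>
      nonuniform_exponential_dichotomy (\<lambda>n v. A (int_iterate f n x) *v v)" "N' \<in> null_sets M"
    by (rule AE_E3[OF AE_dichotomy]) (rule that)
  have "prob (space M - N') = 1"
    using N'(2) by (subst prob_compl) (auto simp: null_sets_def measure_def)
  then have "emeasure M (space M - N') = 1" by (simp add: emeasure_eq_measure)
  moreover have "space M - N' \<in> sets borel" using N'(2) borel by (metis null_setsD2 sets.compl_sets)
  ultimately show ?thesis using N'(1) by blast
qed

end
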